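(* Let $s\ge 3$ and let $L(x_1,\dots,x_s)=c_1x_1+\dots+c_sx_s$ be a translation-invariant linear form (that is, $c_i\in\mathbb{Z}\setminus\{0\}$ and $c_1+\dots+c_s=0$) that is primitive. Then there is $\varepsilon_L>0$ such that \[ r_L(N)=\Omega_L\left(N^{\frac{1}{s-1}+\varepsilon_L}\right), \] i.e. there is a constant $C>0$ depending only on $L$ such that $r_L(N)\ge C\,N^{\frac1{s-1}+\varepsilon_L}$ for all integers $N\ge1$.
   Context: A form $L(x_1,\dots,x_s)=\sum_i c_ix_i$ with $c_i\in\mathbb{Z}\setminus\{0\}$, $\sum_i c_i=0$, is primitive if, among the partitions $\mathcal T$ of $[s]=\{1,\dots,s\}$ satisfying $\sum_{i\in T}c_i=0$ for all $T\in\mathcal T$, there is a unique finest one (i.e. a unique one minimal under refinement; equivalently, one that refines all the others). For a solution $(x_1,\dots,x_s)\in\mathbb{Z}^s$ to $L=0$, let $\mathcal T$ be the partition of $[s]$ in which $i,j$ lie in the same block if and only if $x_i=x_j$. The solution is trivial if $\sum_{i\in T}c_i=0$ for all $T\in\mathcal T$, and nontrivial otherwise. A set $A\subseteq\mathbb{Z}$ is $L$-free if all solutions in $A^s$ to $L=0$ are trivial. Define $r_L(N)=\max\{|A| : A\subseteq\{1,\dots,N\} \text{ is } L\text{-free}\}$. *)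

theory Defs
  imports "HOL-Analysis.Analysis" "HOL-Library.Disjoint_Sets"
begin

text \<open>
  A linear form in \<open>s\<close> variables is given by its coefficients \<open>c i\<close>, and a point of
  \<open>\<int>\<^sup>s\<close> by its coordinates \<open>x i\<close>; in both cases only the values at \<open>i \<in> {1..s}\<close> matter.
\<close>

definition translation_invariant_form :: "nat \<Rightarrow> (nat \<Rightarrow> int) \<Rightarrow> bool" where
  "translation_invariant_form s c \<longleftrightarrow> (\<forall>i\<in>{1..s}. c i \<noteq> 0) \<and> (\<Sum>i=1..s. c i) = 0"

definition zero_sum_blocks :: "(nat \<Rightarrow> int) \<Rightarrow> nat set set \<Rightarrow> bool" where
  "zero_sum_blocks c \<T> \<longleftrightarrow> (\<forall>T\<in>\<T>. (\<Sum>i\<in>T. c i) = 0)"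

definition zero_sum_partition :: "nat \<Rightarrow> (nat \<Rightarrow> int) \<Rightarrow> nat set set \<Rightarrow> bool" where
  "zero_sum_partition s c \<T> \<longleftrightarrow> partition_on {1..s} \<T> \<and> zero_sum_blocks c \<T>"

text \<open>\<open>refines A P Q\<close> means that the partition \<open>P\<close> of \<open>A\<close> is finer than (or equal to) \<open>Q\<close>.\<close>

definition finest_zero_sum_partition :: "nat \<Rightarrow> (nat \<Rightarrow> int) \<Rightarrow> nat set set \<Rightarrow> bool" where
  "finest_zero_sum_partition s c \<T> \<longleftrightarrow>
     zero_sum_partition s c \<T> \<and>
     (\<forall>\<S>. zero_sum_partition s c \<S> \<and> refines {1..s} \<S> \<T> \<longrightarrow> \<S> = \<T>)"

definition primitive_form :: "nat \<Rightarrow> (nat \<Rightarrow> int) \<Rightarrow> bool" where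
  "primitive_form s c \<longleftrightarrow> (\<exists>!\<T>. finest_zero_sum_partition s c \<T>)"

definition solution :: "nat \<Rightarrow> (nat \<Rightarrow> int) \<Rightarrow> (nat \<Rightarrow> int) \<Rightarrow> bool" where
  "solution s c x \<longleftrightarrow> (\<Sum>i=1..s. c i * x i) = 0"

definition equality_partition :: "nat \<Rightarrow> (nat \<Rightarrow> int) \<Rightarrow> nat set set" where
  "equality_partition s x = {1..s} // {(i, j). i \<in> {1..s} \<and> j \<in> {1..s} \<and> x i = x j}"

definition trivial_solution :: "nat \<Rightarrow> (nat \<Rightarrow> int) \<Rightarrow> (nat \<Rightarrow> int) \<Rightarrow> bool" where
  "trivial_solution s c x \<longleftrightarrow> solution s c x \<and> zero_sum_blocks c (equality_partition s x)"

definition form_free :: "nat \<Rightarrow> (nat \<Rightarrow> int) \<Rightarrow> int set \<Rightarrow> bool" where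
  "form_free s c A \<longleftrightarrow>
     (\<forall>x. (\<forall>i\<in>{1..s}. x i \<in> A) \<and> solution s c x \<longrightarrow> trivial_solution s c x)"

definition r_form :: "nat \<Rightarrow> (nat \<Rightarrow> int) \<Rightarrow> nat \<Rightarrow> nat" where
  "r_form s c N = Max {card A | A. A \<subseteq> {1..int N} \<and> form_free s c A}"

lemma partition_on_equality_partition: "partition_on {1..s} (equality_partition s x)"
  unfolding equality_partition_def
  by (intro partition_on_quotient equivI) (auto simp: refl_on_def sym_def trans_def)

lemma form_free_empty:
  assumes "s \<ge> 1"
  shows "form_free s c {}"
  using assms by (auto simp: form_free_def)

lemma finite_r_form_set: "finite {card A | A. A \<subseteq> {1..int N} \<and> form_free s c A}"
  by (rule finite_subset[of _ "card ` Pow {1..int N}"]) auto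

lemma r_form_attained:
  assumes "s \<ge> 1"
  shows "\<exists>A. A \<subseteq> {1..int N} \<and> form_free s c A \<and> card A = r_form s c N"
proof -
  have "{card A | A. A \<subseteq> {1..int N} \<and> form_free s c A} \<noteq> {}"
    using form_free_empty[OF assms] by blast
  from Max_in[OF finite_r_form_set this] show ?thesis
    unfolding r_form_def by auto
qed

lemma card_le_r_form:
  assumes "A \<subseteq> {1..int N}" "form_free s c A"
  shows "card A \<le> r_form s c N"
  unfolding r_form_def using assms by (intro Max_ge finite_r_form_set) auto

end

theory Submission
  imports Defs "HOL-Computational_Algebra.Computational_Algebra" "HOL-Number_Theory.Residues"
begin

text \<open>
  Call a function on \<open>{1..s}\<close> zero-sum if the coefficients sum to zero over each of its fibres. For a
  primitive form the pair of two zero-sum functions is again zero-sum. Hence an \<open>L\<close>-free set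
  \<open>A \<subseteq> {0..<q}\<close> gives \<open>L\<close>-free sets of integers whose digits lie in \<open>A\<close>, in a base \<open>K q\<close> with
  \<open>K = \<Sum>\<bar>c i\<bar>\<close> that excludes carries, and it suffices to find one \<open>A\<close> with \<open>card A ^ (s - 1) > K q\<close>.

  Over a finite field \<open>k\<close> of large characteristic, a solution of \<open>\<Sum>c i * x i ^ j = 0\<close> for
  \<open>j \<le> s - 2\<close> that is not zero-sum has distinct coordinates, by Vandermonde. Up to affine maps there
  are finitely many of these, and they are nonsingular points of the system. An elimination argument
  gives a nonzero integer polynomial, independent of \<open>k\<close>, that vanishes at the top moment
  \<open>\<Sum>c i * z i ^ (s - 1)\<close> of every solution normalised by \<open>z 1 = 0\<close> and \<open>z 2 = 1\<close>. Let \<open>l\<close> be a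
  prime divisor of \<open>s - 1\<close>. Choosing \<open>k\<close> as a residue field of a ring that contains suitable \<open>l\<close>-th
  roots of the complex roots of this polynomial, every top moment \<open>\<Sum>c i * x i ^ (s - 1)\<close> becomes an
  \<open>l\<close>-th power in \<open>k\<close>; choosing the characteristic suitably, so does every integer. If \<open>h\<close> is not an
  \<open>l\<close>-th power, the points \<open>(x, x\<^sup>2, \<dots>, x ^ (s - 2), x ^ (s - 1) + h g)\<close> with \<open>x \<in> k\<close> and \<open>g\<close> in a
  fixed \<open>L\<close>-free set \<open>G\<close> of integers form an \<open>L\<close>-free set with \<open>card k * card G\<close> elements in
  \<open>k ^ (s - 1)\<close>. Since \<open>[k : F\<^sub>p]\<close> is bounded, passing to integers costs only a bounded factor, which a
  large \<open>G\<close> absorbs.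
\<close>

section \<open>Zero-sum fibres and digit constructions\<close>

text \<open>Functions stand in for partitions: coarsening becomes composition and common refinement
  becomes pairing. Values outside the image only give empty sums, so \<open>v\<close> may range over
  the whole type.\<close>

definition zero_sum_fibres :: "nat \<Rightarrow> (nat \<Rightarrow> int) \<Rightarrow> (nat \<Rightarrow> 'b) \<Rightarrow> bool" where
  "zero_sum_fibres s c f \<longleftrightarrow> (\<forall>v. (\<Sum>i\<in>{i\<in>{1..s}. f i = v}. c i) = 0)"

text \<open>Each fibre of the composite is a disjoint union of fibres of \<open>f\<close>.\<close>

lemma zero_sum_fibres_comp:
  assumes "zero_sum_fibres s c f"
  shows "zero_sum_fibres s c (\<lambda>i. F (f i))"
  unfolding zero_sum_fibres_def
proof
  fix v
  let ?S = "{i\<in>{1..s}. F (f i) = v}"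
  have "sum c ?S = (\<Sum>y\<in>f ` ?S. sum c {i\<in>?S. f i = y})"
    by (rule sum.group[symmetric]) auto
  also have "\<dots> = (\<Sum>y\<in>f ` ?S. sum c {i\<in>{1..s}. f i = y})"
    by (intro sum.cong) (auto intro!: sum.cong)
  also have "\<dots> = 0"
    using assms by (simp add: zero_sum_fibres_def)
  finally show "sum c ?S = 0" .
qed

text \<open>Grouping the terms by the value of \<open>f\<close> factors out the fibre sums. With the
  identity for \<open>\<phi>\<close> this gives a solution of the form; with a power it makes a
  moment vanish.\<close>

lemma zero_sum_fibres_sum:
  fixes \<phi> :: "'b \<Rightarrow> 'a::comm_ring_1"
  assumes "zero_sum_fibres s c f"
  shows "(\<Sum>i=1..s. of_int (c i) * \<phi> (f i)) = 0"
proof -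
  have "(\<Sum>i=1..s. of_int (c i) * \<phi> (f i))
      = (\<Sum>y\<in>f ` {1..s}. \<Sum>i\<in>{i\<in>{1..s}. f i = y}. of_int (c i) * \<phi> (f i))"
    by (rule sum.group[symmetric]) auto
  also have "\<dots> = (\<Sum>y\<in>f ` {1..s}. of_int (\<Sum>i\<in>{i\<in>{1..s}. f i = y}. c i) * \<phi> y)"
    by (intro sum.cong refl) (simp add: sum_distrib_right)
  also have "\<dots> = 0"
    using assms by (simp add: zero_sum_fibres_def)
  finally show ?thesis .
qed

lemma trivial_solutionI:
  assumes "zero_sum_fibres s c x"
  shows "trivial_solution s c x"
proof -
  have "solution s c x"
    using zero_sum_fibres_sum[OF assms, of "\<lambda>v. v :: int"] by (simp add: solution_def)
  moreover have "zero_sum_blocks c (equality_partition s x)"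
    unfolding zero_sum_blocks_def equality_partition_def
  proof
    fix T assume "T \<in> {1..s} // {(i, j). i \<in> {1..s} \<and> j \<in> {1..s} \<and> x i = x j}"
    then obtain i where i: "i \<in> {1..s}" "T = {(i, j). i \<in> {1..s} \<and> j \<in> {1..s} \<and> x i = x j} `` {i}"
      by (auto elim: quotientE)
    hence "T = {j\<in>{1..s}. x j = x i}" by auto
    thus "sum c T = 0" using assms by (simp add: zero_sum_fibres_def)
  qed
  ultimately show ?thesis by (simp add: trivial_solution_def)
qed

text \<open>The blocks of \<open>equality_partition s x\<close> are exactly the nonempty fibres of
  \<open>x\<close> on \<open>{1..s}\<close>, so triviality can be handled through fibres, without
  quotients.\<close>

lemma form_free_iff:
  "form_free s c A \<longleftrightarrow>
    (\<forall>x. (\<forall>i\<in>{1..s}. x i \<in> A) \<and> (\<Sum>i=1..s. c i * x i) = 0 \<longrightarrow> zero_sum_fibres s c x)"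
proof -
  have "zero_sum_fibres s c x" if tr: "trivial_solution s c x" for x
    unfolding zero_sum_fibres_def
  proof
    fix v
    show "sum c {i\<in>{1..s}. x i = v} = 0"
    proof (cases "\<exists>i\<in>{1..s}. x i = v")
      case True
      then obtain i where i: "i \<in> {1..s}" "x i = v" by blast
      have "{(i, j). i \<in> {1..s} \<and> j \<in> {1..s} \<and> x i = x j} `` {i} \<in> equality_partition s x"
        unfolding equality_partition_def using i by (intro quotientI)
      moreover have "{(i, j). i \<in> {1..s} \<and> j \<in> {1..s} \<and> x i = x j} `` {i} = {j\<in>{1..s}. x j = v}"
        using i by auto
      ultimately show ?thesis using tr by (auto simp: trivial_solution_def zero_sum_blocks_def)
    next
      case False
      hence "{i\<in>{1..s}. x i = v} = {}" by blast
      thus ?thesis by (simp only: sum.empty)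
    qed
  qed
  thus ?thesis
    unfolding form_free_def using trivial_solutionI by (auto simp: solution_def)
qed

section \<open>Common refinement for primitive forms\<close>

lemma zero_sum_partition_fibres:
  assumes "zero_sum_fibres s c f"
  shows "zero_sum_partition s c ((\<lambda>v. {i\<in>{1..s}. f i = v}) ` f ` {1..s})"
  unfolding zero_sum_partition_def zero_sum_blocks_def
  using assms by (auto simp: zero_sum_fibres_def intro!: partition_onI) (auto simp: disjnt_def)

text \<open>Strict refinement among the finitely many zero-sum partitions below \<open>\<S>\<close>
  is transitive and irreflexive, hence well-founded. A minimal one below \<open>\<S>\<close> is
  minimal outright, because refinement is transitive.\<close>

lemma finest_zero_sum_partition_below:
  assumes "zero_sum_partition s c \<S>"
  shows "\<exists>\<T>. finest_zero_sum_partition s c \<T> \<and> refines {1..s} \<T> \<S>"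
proof -
  define X where "X = {\<T>. zero_sum_partition s c \<T> \<and> refines {1..s} \<T> \<S>}"
  define r where "r = {(\<U>, \<T>). \<U> \<in> X \<and> \<T> \<in> X \<and> refines {1..s} \<U> \<T> \<and> \<U> \<noteq> \<T>}"
  have "X \<subseteq> Pow (Pow {1..s})"
    by (auto simp: X_def zero_sum_partition_def partition_on_def)
  hence "finite X" by (rule finite_subset) (intro finite_Pow_iff[THEN iffD2], simp)
  hence "finite (X \<times> X)" by simp
  moreover have "r \<subseteq> X \<times> X" by (auto simp: r_def)
  ultimately have "finite r" by (rule finite_subset[rotated])
  moreover have "acyclic r"
  proof -
    have "trans r"
      unfolding r_def trans_def by (auto intro: refines_trans dest: refines_asym)
    hence "r\<^sup>+ = r" by (rule trancl_id)
    thus ?thesis by (auto simp: acyclic_def r_def)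
  qed
  ultimately have "wf r" by (rule finite_acyclic_wf)
  moreover have "\<S> \<in> X"
    using assms by (auto simp: X_def zero_sum_partition_def intro: refines_refl)
  ultimately obtain \<T> where \<T>: "\<T> \<in> X" "\<And>\<U>. (\<U>, \<T>) \<in> r \<Longrightarrow> \<U> \<notin> X"
    by (rule wfE_min) blast
  have "finest_zero_sum_partition s c \<T>"
    unfolding finest_zero_sum_partition_def
  proof (intro conjI allI impI)
    show "zero_sum_partition s c \<T>" using \<T> by (simp add: X_def)
    fix \<U> assume \<U>: "zero_sum_partition s c \<U> \<and> refines {1..s} \<U> \<T>"
    hence "\<U> \<in> X" using \<T> by (auto simp: X_def intro: refines_trans)
    hence "(\<U>, \<T>) \<notin> r" using \<T>(2) by blast
    with \<open>\<U> \<in> X\<close> show "\<U> = \<T>" using \<T>(1) \<U> unfolding r_def by blast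
  qed
  thus ?thesis using \<T> by (auto simp: X_def)
qed

text \<open>The unique finest partition lies below both fibre partitions, so \<open>f\<close> and
  \<open>g\<close> are constant on its blocks and each fibre of the pair is a union of blocks. This
  is the one place where primitivity is unfolded.\<close>

lemma zero_sum_fibres_Pair:
  assumes "primitive_form s c" "zero_sum_fibres s c f" "zero_sum_fibres s c g"
  shows "zero_sum_fibres s c (\<lambda>i. (f i, g i))"
proof -
  obtain \<T> where \<T>: "finest_zero_sum_partition s c \<T>"
    and uniq: "\<And>\<U>. finest_zero_sum_partition s c \<U> \<Longrightarrow> \<U> = \<T>"
    using assms(1) by (auto simp: primitive_form_def)
  have part: "partition_on {1..s} \<T>" and zs: "\<And>T. T \<in> \<T> \<Longrightarrow> sum c T = 0"
    using \<T> by (auto simp: finest_zero_sum_partition_def zero_sum_partition_def zero_sum_blocks_def)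
  have const: "f i = f j" if "zero_sum_fibres s c f" "T \<in> \<T>" "i \<in> T" "j \<in> T" for f :: "nat \<Rightarrow> 'd" and T i j
  proof -
    have "refines {1..s} \<T> ((\<lambda>v. {i\<in>{1..s}. f i = v}) ` f ` {1..s})"
      using finest_zero_sum_partition_below[OF zero_sum_partition_fibres[OF that(1)]] uniq by blast
    then obtain v where "T \<subseteq> {i\<in>{1..s}. f i = v}"
      using \<open>T \<in> \<T>\<close> unfolding refines_def by blast
    thus ?thesis using \<open>i \<in> T\<close> \<open>j \<in> T\<close> by blast
  qed
  show ?thesis unfolding zero_sum_fibres_def
  proof
    fix v
    define S where "S = {i\<in>{1..s}. (f i, g i) = v}"
    define \<B> where "\<B> = {T\<in>\<T>. T \<inter> S \<noteq> {}}"
    have "T \<subseteq> S" if TB: "T \<in> \<B>" for T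
    proof (rule subsetI)
      fix j assume "j \<in> T"
      obtain i where "i \<in> T" "i \<in> S" using TB by (auto simp: \<B>_def)
      moreover have "j \<in> {1..s}" using TB \<open>j \<in> T\<close> part by (auto simp: \<B>_def partition_on_def)
      moreover have "T \<in> \<T>" using TB by (simp add: \<B>_def)
      ultimately show "j \<in> S"
        using const[OF assms(2) _ \<open>j \<in> T\<close>] const[OF assms(3) _ \<open>j \<in> T\<close>] by (auto simp: S_def)
    qed
    moreover have "S \<subseteq> \<Union>\<B>"
    proof
      fix i assume i: "i \<in> S"
      hence "i \<in> \<Union>\<T>" using part by (simp add: partition_on_def S_def)
      thus "i \<in> \<Union>\<B>" using i by (auto simp: \<B>_def)
    qed
    ultimately have "S = \<Union>\<B>" by blast
    moreover have "sum c (\<Union>\<B>) = (\<Sum>T\<in>\<B>. sum c T)"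
    proof (rule sum.Union_disjoint[unfolded o_def])
      show "\<forall>A\<in>\<B>. finite A"
        using part by (auto simp: \<B>_def partition_on_def intro!: finite_subset[of _ "{1..s}"])
      show "\<forall>A\<in>\<B>. \<forall>B\<in>\<B>. A \<noteq> B \<longrightarrow> A \<inter> B = {}"
        using part by (auto simp: \<B>_def partition_on_def disjoint_def)
    qed
    ultimately show "sum c {i\<in>{1..s}. (f i, g i) = v} = 0"
      using zs by (simp add: S_def \<B>_def)
  qed
qed

text \<open>Each further entry of the list is one pairing. The empty list is a constant function,
  whose only nonempty fibre is \<open>{1..s}\<close>; this is where the total coefficient sum
  enters.\<close>

lemma zero_sum_fibres_map:
  assumes "primitive_form s c" "(\<Sum>i=1..s. c i) = 0"
    and "\<And>k. k < D \<Longrightarrow> zero_sum_fibres s c (\<lambda>i. u i k)"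
  shows "zero_sum_fibres s c (\<lambda>i. map (u i) [0..<D])"
  using assms(3)
proof (induction D)
  case 0
  show ?case
    unfolding zero_sum_fibres_def
  proof
    fix v :: "'a list"
    show "sum c {i \<in> {1..s}. map (u i) [0..<0] = v} = 0"
      using assms(2) by (cases "v = []") (auto simp: atLeastAtMost_def atLeast_def atMost_def Int_def)
  qed
next
  case (Suc D)
  have "zero_sum_fibres s c (\<lambda>i. (map (u i) [0..<D], u i D))"
    using Suc by (intro zero_sum_fibres_Pair assms(1)) auto
  from zero_sum_fibres_comp[OF this, of "\<lambda>(a, b). a @ [b]"]
  show ?case by simp
qed

section \<open>Digit expansions without carries\<close>

lemma digits_eq_0:
  fixes a :: "nat \<Rightarrow> int"
  assumes "\<And>k. k < D \<Longrightarrow> \<bar>a k\<bar> < Q" "(\<Sum>k<D. a k * Q ^ k) = 0" "k < D"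
  shows "a k = 0"
  using assms
proof (induction D arbitrary: a k)
  case (Suc D)
  have eq: "a 0 + Q * (\<Sum>k<D. a (Suc k) * Q ^ k) = 0"
    using Suc.prems(2) unfolding sum.lessThan_Suc_shift by (simp add: sum_distrib_left mult_ac)
  \<comment> \<open>The lowest digit is a multiple of \<open>Q\<close> of absolute value below
    \<open>Q\<close>, hence zero; dividing by \<open>Q\<close> leaves a shorter expansion.\<close>
  hence "Q dvd a 0" by (metis add_eq_0_iff dvd_minus_iff dvd_triv_left)
  hence a0: "a 0 = 0"
    using Suc.prems(1)[of 0] by (metis abs_0_eq dvd_imp_le_int less_le_not_le zero_less_Suc abs_ge_self order_trans)
  have "Q > 0" using Suc.prems(1)[of 0] by simp
  hence "(\<Sum>k<D. a (Suc k) * Q ^ k) = 0" using eq a0 by simp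
  hence "a (Suc k) = 0" if "k < D" for k
    using Suc.IH[of "\<lambda>k. a (Suc k)" k] Suc.prems(1) that by simp
  thus ?case using a0 Suc.prems(3) by (cases k) auto
qed simp

lemma zero_sum_fibres_cong:
  assumes "\<And>i. i \<in> {1..s} \<Longrightarrow> f i = g i"
  shows "zero_sum_fibres s c f \<longleftrightarrow> zero_sum_fibres s c g"
proof -
  have "{i\<in>{1..s}. f i = v} = {i\<in>{1..s}. g i = v}" for v using assms by auto
  thus ?thesis by (simp only: zero_sum_fibres_def)
qed

lemma abs_form_less:
  fixes u :: "nat \<Rightarrow> int"
  assumes "\<And>i. i \<in> {1..s} \<Longrightarrow> u i \<in> {0..<q}" "0 < (\<Sum>i=1..s. \<bar>c i\<bar>)"
  shows "\<bar>\<Sum>i=1..s. c i * u i\<bar> < (\<Sum>i=1..s. \<bar>c i\<bar>) * q"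
proof -
  have "\<bar>\<Sum>i=1..s. c i * u i\<bar> \<le> (\<Sum>i=1..s. \<bar>c i * u i\<bar>)" by (rule sum_abs)
  also have "\<dots> \<le> (\<Sum>i=1..s. \<bar>c i\<bar> * (q - 1))"
    using assms(1) by (intro sum_mono) (auto simp: abs_mult intro!: mult_left_mono)
  also have "\<dots> = (\<Sum>i=1..s. \<bar>c i\<bar>) * (q - 1)" by (simp add: sum_distrib_right)
  also have "\<dots> < (\<Sum>i=1..s. \<bar>c i\<bar>) * q"
    using assms(2) by (intro mult_strict_left_mono) auto
  finally show ?thesis .
qed

text \<open>Applying the form to one digit position gives a number of absolute value below
  \<open>K * q\<close>, with \<open>K\<close> the sum of the absolute coefficients. The base is at
  least that large, so no carries occur and the equation splits into one for each digit.\<close>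

lemma digitwise_solution:
  fixes u :: "nat \<Rightarrow> nat \<Rightarrow> int"
  assumes "\<And>i k. i \<in> {1..s} \<Longrightarrow> k < D \<Longrightarrow> u i k \<in> {0..<q}"
    and "0 < (\<Sum>i=1..s. \<bar>c i\<bar>)" "(\<Sum>i=1..s. \<bar>c i\<bar>) * q \<le> Q"
    and "(\<Sum>i=1..s. c i * (\<Sum>k<D. u i k * Q ^ k)) = 0" "k < D"
  shows "(\<Sum>i=1..s. c i * u i k) = 0"
proof (rule digits_eq_0[where Q = Q and D = D and a = "\<lambda>k. \<Sum>i=1..s. c i * u i k"])
  show "\<bar>\<Sum>i=1..s. c i * u i k\<bar> < Q" if "k < D" for k
    using abs_form_less[of s "\<lambda>i. u i k" q c] assms that by force
  have "(\<Sum>k<D. (\<Sum>i=1..s. c i * u i k) * Q ^ k) = (\<Sum>k<D. \<Sum>i=1..s. c i * u i k * Q ^ k)"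
    by (simp add: sum_distrib_right)
  also have "\<dots> = (\<Sum>i=1..s. c i * (\<Sum>k<D. u i k * Q ^ k))"
    by (subst sum.swap) (simp add: sum_distrib_left mult_ac)
  finally show "(\<Sum>k<D. (\<Sum>i=1..s. c i * u i k) * Q ^ k) = 0"
    using assms by simp
qed (use assms in auto)

lemma digits_unique:
  fixes u v :: "nat \<Rightarrow> int"
  assumes "\<And>k. k < D \<Longrightarrow> u k \<in> {0..<Q}" "\<And>k. k < D \<Longrightarrow> v k \<in> {0..<Q}"
    and "(\<Sum>k<D. u k * Q ^ k) = (\<Sum>k<D. v k * Q ^ k)" "k < D"
  shows "u k = v k"
proof -
  have "u k - v k = 0"
  proof (rule digits_eq_0[where Q = Q and D = D and a = "\<lambda>k. u k - v k"])
    show "\<bar>u k - v k\<bar> < Q" if "k < D" for k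
      using assms(1,2)[OF that] by auto
    show "(\<Sum>k<D. (u k - v k) * Q ^ k) = 0"
      using assms(3) by (simp add: left_diff_distrib sum_subtractf)
  qed fact
  thus ?thesis by simp
qed

lemma digits_less:
  fixes u :: "nat \<Rightarrow> int"
  assumes "\<And>k. k < D \<Longrightarrow> u k \<in> {0..<Q}"
  shows "(\<Sum>k<D. u k * Q ^ k) < Q ^ D"
  using assms
proof (induction D)
  case (Suc D)
  have "u D \<le> Q - 1" "0 \<le> Q" using Suc.prems[of D] by auto
  hence "u D * Q ^ D \<le> (Q - 1) * Q ^ D" by (intro mult_right_mono) auto
  with Suc show ?case by (simp add: algebra_simps)
qed simp

lemma digits_nonneg:
  fixes u :: "nat \<Rightarrow> int"
  assumes "\<And>k. k < D \<Longrightarrow> u k \<in> {0..<Q}"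
  shows "0 \<le> (\<Sum>k<D. u k * Q ^ k)"
  using assms by (intro sum_nonneg mult_nonneg_nonneg) force+

text \<open>The witness consists of the numbers with \<open>D\<close> digits from \<open>A\<close>
  in base \<open>Q\<close>, shifted by 1 to start at 1. Every digit of a solution is trivial, and
  the digits are recombined by pairing.\<close>

lemma card_power_le_r_form:
  assumes "primitive_form s c" "(\<Sum>i=1..s. c i) = 0" "0 < (\<Sum>i=1..s. \<bar>c i\<bar>)"
    and "form_free s c A" "A \<subseteq> {0..<int q}" "Q = (\<Sum>i=1..s. \<bar>c i\<bar>) * int q"
  shows "card A ^ D \<le> r_form s c (nat (Q ^ D))"
proof -
  let ?val = "\<lambda>u. 1 + (\<Sum>k<D. u k * Q ^ k)"
  define S where "S = ?val ` (PiE {..<D} (\<lambda>_. A))"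
  have "1 * int q \<le> Q" unfolding assms(6) using assms(3) by (intro mult_right_mono) auto
  hence AQ: "A \<subseteq> {0..<Q}" using assms(5) by auto
  have dig: "u k \<in> {0..<Q}" if "u \<in> PiE {..<D} (\<lambda>_. A)" "k < D" for u k
    using that AQ by (auto simp: PiE_def Pi_def)
  have "inj_on ?val (PiE {..<D} (\<lambda>_. A))"
  proof (rule inj_onI)
    fix u v assume uv: "u \<in> PiE {..<D} (\<lambda>_. A)" "v \<in> PiE {..<D} (\<lambda>_. A)" "?val u = ?val v"
    show "u = v"
    proof (rule PiE_ext[OF uv(1,2)])
      fix k assume "k \<in> {..<D}"
      thus "u k = v k"
        using digits_unique[of D u Q v k] dig[OF uv(1)] dig[OF uv(2)] uv(3) by auto
    qed
  qed
  hence card: "card S = card A ^ D"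
    unfolding S_def by (subst card_image) (auto simp: card_PiE)
  have "S \<subseteq> {1..int (nat (Q ^ D))}"
  proof
    fix y assume "y \<in> S"
    then obtain u where "u \<in> PiE {..<D} (\<lambda>_. A)" "y = ?val u" by (auto simp: S_def)
    thus "y \<in> {1..int (nat (Q ^ D))}"
      using digits_less[of D u Q] digits_nonneg[of D u Q] dig[of u] by auto
  qed
  moreover have "form_free s c S"
    unfolding form_free_iff
  proof (intro allI impI, elim conjE)
    fix x assume x: "\<forall>i\<in>{1..s}. x i \<in> S" and sol: "(\<Sum>i=1..s. c i * x i) = 0"
    have "\<forall>i\<in>{1..s}. \<exists>u. u \<in> PiE {..<D} (\<lambda>_. A) \<and> x i = ?val u"
      using x by (auto simp: S_def)
    then obtain u where u: "\<And>i. i \<in> {1..s} \<Longrightarrow> u i \<in> PiE {..<D} (\<lambda>_. A)"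
      "\<And>i. i \<in> {1..s} \<Longrightarrow> x i = ?val (u i)" by metis
    \<comment> \<open>The shift by 1 drops out because the coefficients sum to zero.\<close>
    have "(\<Sum>i=1..s. c i * (\<Sum>k<D. u i k * Q ^ k)) = (\<Sum>i=1..s. c i * x i)"
      using u(2) assms(2) by (simp add: distrib_left sum.distrib)
    hence sol': "(\<Sum>i=1..s. c i * (\<Sum>k<D. u i k * Q ^ k)) = 0" using sol by simp
    have uA: "u i k \<in> A" if "i \<in> {1..s}" "k < D" for i k
      using u(1)[OF that(1)] that(2) by auto
    have "zero_sum_fibres s c (\<lambda>i. u i k)" if "k < D" for k
    proof -
      have "(\<Sum>i=1..s. c i * u i k) = 0"
        by (rule digitwise_solution[of s D u "int q" c Q k])
           (use uA assms(3,5,6) sol' that in \<open>auto dest!: subsetD\<close>)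
      thus ?thesis using assms(4) uA that by (auto simp: form_free_iff)
    qed
    hence "zero_sum_fibres s c (\<lambda>i. map (u i) [0..<D])"
      by (intro zero_sum_fibres_map assms)
    from zero_sum_fibres_comp[OF this, of "\<lambda>l. 1 + (\<Sum>k<D. l ! k * Q ^ k)"]
    show "zero_sum_fibres s c x"
      by (subst zero_sum_fibres_cong[of s x "\<lambda>i. ?val (u i)"]) (use u(2) in auto)
  qed
  ultimately have "card S \<le> r_form s c (nat (Q ^ D))" by (rule card_le_r_form)
  thus ?thesis using card by simp
qed

section \<open>From a single dense set to a power of N\<close>

lemma r_form_mono:
  assumes "s \<ge> 1" "M \<le> N"
  shows "r_form s c M \<le> r_form s c N"
proof -
  obtain A where "A \<subseteq> {1..int M}" "form_free s c A" "card A = r_form s c M"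
    using r_form_attained[OF assms(1)] by blast
  thus ?thesis using card_le_r_form[of A N s c] assms(2) by force
qed

text \<open>Powers of the one set \<open>A\<close> give \<open>m ^ D\<close> elements below
  \<open>Q ^ D\<close>, an exponent of \<open>ln m / ln Q\<close>. The hypothesis \<open>big\<close>
  says precisely that this exponent exceeds \<open>1 / (s - 1)\<close>.\<close>

lemma polynomial_lower_bound:
  assumes "primitive_form s c" "(\<Sum>i=1..s. c i) = 0" "0 < (\<Sum>i=1..s. \<bar>c i\<bar>)" "s \<ge> 3"
    and "form_free s c A" "A \<subseteq> {0..<int q}"
    and big: "(\<Sum>i=1..s. \<bar>c i\<bar>) * int q < int (card A) ^ (s - 1)"
  shows "\<exists>\<epsilon>>0. \<exists>C>0. \<forall>N::nat. N \<ge> 1 \<longrightarrow>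
           real (r_form s c N) \<ge> C * real N powr (1 / (real s - 1) + \<epsilon>)"
proof -
  define K where "K = nat (\<Sum>i=1..s. \<bar>c i\<bar>)"
  have K: "int K = (\<Sum>i=1..s. \<bar>c i\<bar>)" "K \<ge> 1" using assms(3) by (auto simp: K_def)
  define Q where "Q = K * q"
  define m where "m = card A"
  have "int Q < int (m ^ (s - 1))" using big unfolding K(1)[symmetric] by (simp add: Q_def m_def)
  hence mQ: "Q < m ^ (s - 1)" by simp
  have "m \<le> q" using card_mono[OF _ assms(6)] by (simp add: m_def)
  also have "q \<le> Q" using K(2) by (simp add: Q_def)
  finally have "m \<le> Q" .
  have "m \<noteq> 0" using mQ assms(4) by (cases "m = 0") (auto simp: power_0_left)
  moreover have "m \<noteq> 1" using mQ \<open>m \<le> Q\<close> by auto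
  ultimately have "m \<ge> 2" by simp
  hence "Q \<ge> 2" using \<open>m \<le> Q\<close> by simp
  define \<theta> where "\<theta> = ln (real m) / ln (real Q)"
  have lnQ: "ln (real Q) > 0" using \<open>Q \<ge> 2\<close> by simp
  have "ln (real Q) < ln (real m ^ (s - 1))"
  proof (subst ln_less_cancel_iff)
    show "real Q < real m ^ (s - 1)" using mQ by (simp flip: of_nat_power)
  qed (use \<open>Q \<ge> 2\<close> \<open>m \<ge> 2\<close> in auto)
  also have "\<dots> = (real s - 1) * ln (real m)"
    using \<open>m \<ge> 2\<close> assms(4) by (simp add: ln_realpow of_nat_diff)
  finally have \<theta>: "\<theta> > 1 / (real s - 1)"
    unfolding \<theta>_def using lnQ assms(4) by (simp add: field_simps)
  have Qm: "real Q powr \<theta> = real m"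
    using lnQ \<open>Q \<ge> 2\<close> \<open>m \<ge> 2\<close> by (simp add: powr_def \<theta>_def)
  have "1 / (real s - 1) > 0" using assms(4) by simp
  hence \<theta>0: "\<theta> > 0" using \<theta> by linarith
  \<comment> \<open>Rounding \<open>N\<close> down to a power of \<open>Q\<close> loses at most a
    factor \<open>Q\<close>, hence at most \<open>Q powr \<theta>\<close> in the bound; the constant
    \<open>C\<close> pays for it.\<close>
  have bound: "real Q powr (-\<theta>) * real N powr \<theta> \<le> real (r_form s c N)" if N1: "N \<ge> 1" for N
  proof -
    obtain D where D: "Q ^ D \<le> N" "N < Q ^ (D + 1)"
      using ex_power_ivl1[of Q N] \<open>Q \<ge> 2\<close> N1 by auto
    have "real N powr \<theta> \<le> real (Q ^ (D + 1)) powr \<theta>"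
      using less_imp_le[OF D(2)] \<theta>0 by (intro powr_mono2 of_nat_mono) auto
    also have "\<dots> = (real Q powr real (D + 1)) powr \<theta>"
      using \<open>Q \<ge> 2\<close> by (subst powr_realpow) auto
    also have "\<dots> = (real Q powr \<theta>) powr real (D + 1)"
      by (simp only: powr_powr mult.commute)
    also have "\<dots> = (real Q powr \<theta>) ^ (D + 1)"
      using \<open>Q \<ge> 2\<close> by (intro powr_realpow) auto
    also have "\<dots> = real Q powr \<theta> * real m ^ D" by (simp add: Qm)
    finally have "real Q powr (-\<theta>) * real N powr \<theta> \<le> real Q powr (-\<theta>) * (real Q powr \<theta> * real m ^ D)"
      by (intro mult_left_mono) auto
    also have "\<dots> = real (m ^ D)" using \<open>Q \<ge> 2\<close> by (simp add: powr_minus)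
    also have "m ^ D \<le> r_form s c (nat (int Q ^ D))"
      unfolding m_def
      by (rule card_power_le_r_form[OF assms(1,2,3,5,6)]) (simp add: Q_def K)
    also have "nat (int Q ^ D) = Q ^ D" by (simp add: nat_power_eq)
    also have "r_form s c (Q ^ D) \<le> r_form s c N" using D(1) assms(4) by (intro r_form_mono) auto
    finally show ?thesis by simp
  qed
  show ?thesis
  proof (rule exI[of _ "\<theta> - 1 / (real s - 1)"], rule conjI[rotated],
      rule exI[of _ "real Q powr (-\<theta>)"], intro conjI allI impI)
    show "\<theta> - 1 / (real s - 1) > 0" using \<theta> by simp
    show "real Q powr (-\<theta>) > 0" using \<open>Q \<ge> 2\<close> by simp
    fix N :: nat assume "N \<ge> 1"
    thus "real (r_form s c N) \<ge> real Q powr (-\<theta>) * real N powr (1 / (real s - 1) + (\<theta> - 1 / (real s - 1)))"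
      using bound by simp
  qed
qed

text \<open>Collecting equal powers turns a solution into a base \<open>Y\<close> expansion of zero
  whose digits are fibre sums, all smaller than \<open>Y\<close> in absolute value. This supplies
  \<open>L\<close>-free sets of any prescribed size \<open>M\<close>.\<close>

lemma form_free_powers:
  assumes "Y > (\<Sum>i=1..s. \<bar>c i\<bar>)" "\<And>x. x \<in> G \<Longrightarrow> \<exists>k<M. x = Y ^ k"
  shows "form_free s c G"
  unfolding form_free_iff
proof (intro allI impI, elim conjE)
  fix x assume x: "\<forall>i\<in>{1..s}. x i \<in> G" and sol: "(\<Sum>i=1..s. c i * x i) = 0"
  from x assms(2) have "\<forall>i\<in>{1..s}. \<exists>k<M. x i = Y ^ k" by blast
  then obtain k where k: "\<And>i. i \<in> {1..s} \<Longrightarrow> k i < M" "\<And>i. i \<in> {1..s} \<Longrightarrow> x i = Y ^ k i" by metis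
  have "(\<Sum>l<M. (\<Sum>i\<in>{i\<in>{1..s}. k i = l}. c i) * Y ^ l) = (\<Sum>l<M. \<Sum>i\<in>{i\<in>{1..s}. k i = l}. c i * x i)"
  proof (rule sum.cong[OF refl])
    fix l
    show "(\<Sum>i\<in>{i\<in>{1..s}. k i = l}. c i) * Y ^ l = (\<Sum>i\<in>{i\<in>{1..s}. k i = l}. c i * x i)"
      unfolding sum_distrib_right by (rule sum.cong) (use k(2) in auto)
  qed
  also have "\<dots> = (\<Sum>i=1..s. c i * x i)" using k(1) by (intro sum.group) auto
  also have "\<dots> = 0" by (fact sol)
  finally have eq: "(\<Sum>l<M. (\<Sum>i\<in>{i\<in>{1..s}. k i = l}. c i) * Y ^ l) = 0" .
  have "\<bar>\<Sum>i\<in>{i\<in>{1..s}. k i = l}. c i\<bar> < Y" for l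
  proof -
    have "\<bar>\<Sum>i\<in>{i\<in>{1..s}. k i = l}. c i\<bar> \<le> (\<Sum>i\<in>{i\<in>{1..s}. k i = l}. \<bar>c i\<bar>)" by (rule sum_abs)
    also have "\<dots> \<le> (\<Sum>i=1..s. \<bar>c i\<bar>)" by (intro sum_mono2) auto
    finally show ?thesis using assms(1) by simp
  qed
  note small = this
  have fib: "(\<Sum>i\<in>{i\<in>{1..s}. k i = l}. c i) = 0" if "l < M" for l
    by (rule digits_eq_0[where Q = Y and D = M and a = "\<lambda>l. (\<Sum>i\<in>{i\<in>{1..s}. k i = l}. c i)", OF small eq that])
  have "zero_sum_fibres s c k"
    unfolding zero_sum_fibres_def
  proof
    fix l show "(\<Sum>i\<in>{i\<in>{1..s}. k i = l}. c i) = 0"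
    proof (cases "l < M")
      case False
      hence "{i\<in>{1..s}. k i = l} = {}" using k(1) by auto
      thus ?thesis by (simp only: sum.empty)
    qed (rule fib)
  qed
  from zero_sum_fibres_comp[OF this, of "\<lambda>l. Y ^ l"]
  show "zero_sum_fibres s c x"
    by (subst zero_sum_fibres_cong[of s x "\<lambda>i. Y ^ k i"]) (use k(2) in auto)
qed

section \<open>An algebraic relation between the moments\<close>

text \<open>Gaussian elimination for fewer equations than unknowns. Rows are cross-multiplied by the
  pivot instead of divided, so the solution stays integral.\<close>

lemma integer_kernel_nontrivial:
  fixes a :: "'y \<Rightarrow> 'x \<Rightarrow> int"
  assumes "finite Y" "finite X" "card Y < card X"
  shows "\<exists>\<phi>. (\<exists>x\<in>X. \<phi> x \<noteq> 0) \<and> (\<forall>y\<in>Y. (\<Sum>x\<in>X. a y x * \<phi> x) = 0)"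
  using assms
proof (induction Y arbitrary: X a rule: finite_induct)
  case empty
  hence "X \<noteq> {}" by auto
  thus ?case by (intro exI[of _ "\<lambda>_. 1"]) auto
next
  case (insert y Y)
  show ?case
  proof (cases "\<exists>x\<in>X. a y x \<noteq> 0")
    case False
    obtain \<phi> where "\<exists>x\<in>X. \<phi> x \<noteq> 0" "\<forall>y\<in>Y. (\<Sum>x\<in>X. a y x * \<phi> x) = 0"
      using insert.IH[of X a] insert.prems insert.hyps by auto
    thus ?thesis using False by (intro exI[of _ \<phi>]) auto
  next
    case True
    then obtain x0 where x0: "x0 \<in> X" "a y x0 \<noteq> 0" by blast
    define X' where "X' = X - {x0}"
    have X': "finite X'" "x0 \<notin> X'" "X = insert x0 X'" using insert.prems x0 by (auto simp: X'_def)
    have "card Y < card X'" using insert.prems insert.hyps x0 by (auto simp: X'_def)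
    then obtain \<psi> where \<psi>: "\<exists>x\<in>X'. \<psi> x \<noteq> 0"
      "\<forall>y'\<in>Y. (\<Sum>x\<in>X'. (a y x0 * a y' x - a y' x0 * a y x) * \<psi> x) = 0"
      using insert.IH[of X' "\<lambda>y' x. a y x0 * a y' x - a y' x0 * a y x"] X'(1) by blast
    \<comment> \<open>Scaling \<open>\<psi>\<close> by the pivot allows the pivot row to be solved
      for the value at \<open>x0\<close> without division.\<close>
    define \<phi> where "\<phi> x = (if x = x0 then - (\<Sum>x\<in>X'. a y x * \<psi> x) else a y x0 * \<psi> x)" for x
    have sum_\<phi>: "(\<Sum>x\<in>X. a y' x * \<phi> x)
        = (\<Sum>x\<in>X'. (a y x0 * a y' x - a y' x0 * a y x) * \<psi> x)" for y'
    proof -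
      have "(\<Sum>x\<in>X. a y' x * \<phi> x) = a y' x0 * \<phi> x0 + (\<Sum>x\<in>X'. a y' x * \<phi> x)"
        using X' by simp
      also have "(\<Sum>x\<in>X'. a y' x * \<phi> x) = (\<Sum>x\<in>X'. a y x0 * a y' x * \<psi> x)"
        using X'(2) by (intro sum.cong) (auto simp: \<phi>_def)
      finally show ?thesis
        by (simp add: \<phi>_def sum_distrib_left sum_subtractf left_diff_distrib mult.assoc)
    qed
    show ?thesis
    proof (intro exI[of _ \<phi>] conjI ballI)
      show "\<exists>x\<in>X. \<phi> x \<noteq> 0" using \<psi>(1) X' x0 by (auto simp: \<phi>_def)
      fix y' assume "y' \<in> insert y Y"
      thus "(\<Sum>x\<in>X. a y' x * \<phi> x) = 0" using sum_\<phi> \<psi>(2) by (auto simp: mult.commute)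
    qed
  qed
qed

text \<open>Multivariate polynomials are replaced by functions of all coordinates whose degree in
  coordinate \<open>i\<close> is at most \<open>H\<close> when the others are frozen; this is all
  that the grid argument needs.\<close>

definition poly_in :: "nat \<Rightarrow> nat \<Rightarrow> ((nat \<Rightarrow> 'a::comm_ring_1) \<Rightarrow> 'a) \<Rightarrow> bool" where
  "poly_in i H F \<longleftrightarrow> (\<forall>x. \<exists>q. degree q \<le> H \<and> (\<forall>t. F (x(i := t)) = poly q t))"

lemma poly_in_mono: "poly_in i H F \<Longrightarrow> H \<le> H' \<Longrightarrow> poly_in i H' F"
  unfolding poly_in_def by (meson order_trans)

lemma poly_in_const: "poly_in i 0 (\<lambda>_. a)"
  unfolding poly_in_def by (intro allI exI[of _ "[:a:]"]) auto

lemma poly_in_var_power: "poly_in i m (\<lambda>x. x j ^ m)"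
  unfolding poly_in_def
proof
  fix x :: "nat \<Rightarrow> 'a"
  show "\<exists>q. degree q \<le> m \<and> (\<forall>t. (x(i := t)) j ^ m = poly q t)"
    by (cases "i = j")
       (auto intro: exI[of _ "Polynomial.monom 1 m"] exI[of _ "[:x j ^ m:]"] simp: poly_monom degree_monom_le)
qed

lemma poly_in_mult: "poly_in i H F \<Longrightarrow> poly_in i H' G \<Longrightarrow> poly_in i (H + H') (\<lambda>x. F x * G x)"
  unfolding poly_in_def
proof
  fix x
  assume "\<forall>x. \<exists>q. degree q \<le> H \<and> (\<forall>t. F (x(i := t)) = poly q t)"
    and "\<forall>x. \<exists>q. degree q \<le> H' \<and> (\<forall>t. G (x(i := t)) = poly q t)"
  then obtain p q where "degree p \<le> H" "\<forall>t. F (x(i := t)) = poly p t"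
    "degree q \<le> H'" "\<forall>t. G (x(i := t)) = poly q t" by meson
  thus "\<exists>q. degree q \<le> H + H' \<and> (\<forall>t. F (x(i := t)) * G (x(i := t)) = poly q t)"
    by (intro exI[of _ "p * q"]) (auto intro: order_trans[OF degree_mult_le])
qed

lemma poly_in_add: "poly_in i H F \<Longrightarrow> poly_in i H G \<Longrightarrow> poly_in i H (\<lambda>x. F x + G x)"
  unfolding poly_in_def
proof
  fix x
  assume "\<forall>x. \<exists>q. degree q \<le> H \<and> (\<forall>t. F (x(i := t)) = poly q t)"
    and "\<forall>x. \<exists>q. degree q \<le> H \<and> (\<forall>t. G (x(i := t)) = poly q t)"
  then obtain p q where "degree p \<le> H" "\<forall>t. F (x(i := t)) = poly p t"
    "degree q \<le> H" "\<forall>t. G (x(i := t)) = poly q t" by meson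
  thus "\<exists>q. degree q \<le> H \<and> (\<forall>t. F (x(i := t)) + G (x(i := t)) = poly q t)"
    by (intro exI[of _ "p + q"]) (auto intro: degree_add_le)
qed

lemma poly_in_sum:
  "finite S \<Longrightarrow> (\<And>k. k \<in> S \<Longrightarrow> poly_in i H (F k)) \<Longrightarrow> poly_in i H (\<lambda>x. \<Sum>k\<in>S. F k x)"
  by (induction S rule: finite_induct)
     (auto intro!: poly_in_add intro: poly_in_mono[OF poly_in_const])

lemma poly_in_prod:
  "finite S \<Longrightarrow> (\<And>k. k \<in> S \<Longrightarrow> poly_in i (H k) (F k)) \<Longrightarrow>
    poly_in i (\<Sum>k\<in>S. H k) (\<lambda>x. \<Prod>k\<in>S. F k x)"
  by (induction S rule: finite_induct) (auto intro!: poly_in_mult intro: poly_in_const)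

lemma poly_in_power: "poly_in i H F \<Longrightarrow> poly_in i (m * H) (\<lambda>x. F x ^ m)"
  by (induction m) (auto intro!: poly_in_mult intro: poly_in_const)

text \<open>Coordinates are freed one at a time: in each, a polynomial of degree at most
  \<open>H\<close> has the \<open>H + 1\<close> roots \<open>0, ..., H\<close>, which are distinct
  in characteristic zero.\<close>

lemma vanishing_on_grid:
  fixes F :: "(nat \<Rightarrow> 'a::{idom, ring_char_0}) \<Rightarrow> 'a"
  assumes "finite V" "\<And>i. i \<in> V \<Longrightarrow> poly_in i H F"
    and "\<And>x. (\<forall>i\<in>V. x i \<in> of_nat ` {..H}) \<Longrightarrow> (\<forall>i. i \<notin> V \<longrightarrow> x i = x0 i) \<Longrightarrow> F x = 0"
    and "\<And>i. i \<notin> V \<Longrightarrow> x i = x0 i"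
  shows "F x = 0"
  using assms
proof (induction V arbitrary: x x0 rule: finite_induct)
  case (insert v V)
  obtain q where q: "degree q \<le> H" "\<And>t. F (x(v := t)) = poly q t"
    using insert.prems(1)[of v] unfolding poly_in_def by (meson insertI1)
  have root: "poly q t = 0" if t: "t \<in> of_nat ` {..H}" for t
  proof -
    have "F (x(v := t)) = 0"
    proof (rule insert.IH[where x = "x(v := t)" and ?x0.0 = "x0(v := t)"])
      fix y assume y: "\<forall>i\<in>V. y i \<in> of_nat ` {..H}" "\<forall>i. i \<notin> V \<longrightarrow> y i = (x0(v := t)) i"
      show "F y = 0"
        by (rule insert.prems(2)) (use y t insert.hyps in \<open>auto split: if_splits\<close>)
    qed (use insert in auto)
    thus ?thesis using q by simp
  qed
  have "q = 0"
  proof (rule ccontr)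
    assume "q \<noteq> 0"
    have "card (of_nat ` {..H} :: 'a set) \<le> card {t. poly q t = 0}"
      using root poly_roots_finite[OF \<open>q \<noteq> 0\<close>] by (intro card_mono) auto
    also have "\<dots> \<le> degree q" by (rule card_poly_roots_bound) fact
    finally show False using q(1) by (simp add: card_image inj_on_def)
  qed
  thus ?case using q(2)[of "x v"] by simp
qed auto

text \<open>The ring is left open because moments are taken at integer points, at complex points and
  at linear polynomials.\<close>

definition moment :: "nat \<Rightarrow> (nat \<Rightarrow> int) \<Rightarrow> nat \<Rightarrow> (nat \<Rightarrow> 'a::comm_ring_1) \<Rightarrow> 'a" where
  "moment s c j x = (\<Sum>i=1..s. of_int (c i) * x i ^ j)"

lemma poly_in_moment: "poly_in i j (moment s c j)"
  unfolding moment_def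
  by (intro poly_in_sum poly_in_mult[of i 0 _ j, simplified] poly_in_const poly_in_var_power) auto

text \<open>
  The exponents of the lower moments are the digits of \<open>m\<close> in base \<open>A + 1\<close>, so that monomials are
  indexed by pairs of natural numbers.
\<close>
definition moment_monomial where
  "moment_monomial s c A a m x =
     moment s c (s - 1) x ^ a * (\<Prod>j<s-2. moment s c (Suc j) x ^ (m div (A + 1) ^ j mod (A + 1)))"

text \<open>The \<open>s - 1\<close> moments of positive order depend on only \<open>s - 2\<close>
  free coordinates, so they are algebraically dependent. Vanishing on an integer grid imposes fewer
  linear conditions than there are monomials, which gives integer coefficients.\<close>

lemma moment_relation:
  assumes "s \<ge> 3"
  obtains A \<phi> where
    "\<exists>a\<le>A. \<exists>m<(A + 1) ^ (s - 2). \<phi> a m \<noteq> (0::int)"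
    "\<And>x :: nat \<Rightarrow> complex. x 1 = 0 \<Longrightarrow> x 2 = 1 \<Longrightarrow>
       (\<Sum>a\<le>A. \<Sum>m<(A + 1) ^ (s - 2). of_int (\<phi> a m) * moment_monomial s c A a m x) = 0"
proof -
  define n where "n = s - 2"
  have sn: "s = n + 2" using assms by (simp add: n_def)
  \<comment> \<open>Each monomial has degree at most
    \<open>A * (n + 1) + n * A * (n + 1) = H\<close> in each coordinate. With this \<open>A\<close>
    the grid has at most \<open>(A + 1) ^ n * A\<close> points, against
    \<open>(A + 1) ^ (n + 1)\<close> monomials.\<close>
  define A where "A = (n + 1) ^ (2 * n)"
  define H where "H = A * (n + 1)\<^sup>2"
  define X where "X = {..A} \<times> {..<(A + 1) ^ n}"
  define Y where "Y = PiE {3..s} (\<lambda>_. {0..int H})"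
  define y0 :: "(nat \<Rightarrow> int) \<Rightarrow> nat \<Rightarrow> int" where "y0 y = y(1 := 0, 2 := 1)" for y
  have "card Y = (H + 1) ^ n" by (simp add: Y_def card_PiE sn nat_add_distrib)
  also have "\<dots> \<le> ((A + 1) * (n + 1)\<^sup>2) ^ n"
    by (intro power_mono) (auto simp: H_def)
  also have "\<dots> = (A + 1) ^ n * A" by (simp only: power_mult_distrib A_def power_mult)
  also have "\<dots> < (A + 1) ^ n * (A + 1)" by simp
  also have "\<dots> = card X" by (simp add: X_def)
  finally have "card Y < card X" .
  moreover have "finite X" "finite Y" by (auto simp: X_def Y_def intro: finite_PiE)
  ultimately obtain \<phi> where \<phi>: "\<exists>x\<in>X. \<phi> x \<noteq> 0"
    "\<forall>y\<in>Y. (\<Sum>x\<in>X. moment_monomial s c A (fst x) (snd x) (y0 y) * \<phi> x) = 0"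
    using integer_kernel_nontrivial[of Y X "\<lambda>y x. moment_monomial s c A (fst x) (snd x) (y0 y)"] by blast
  define F :: "(nat \<Rightarrow> complex) \<Rightarrow> complex" where
    "F x = (\<Sum>(a, m)\<in>X. of_int (\<phi> (a, m)) * moment_monomial s c A a m x)" for x
  have "poly_in i H F" for i
    unfolding F_def
  proof (rule poly_in_sum)
    fix z assume z: "z \<in> X"
    obtain a m where am: "z = (a, m)" by force
    have "poly_in i (0 + (a * (s - 1) + (\<Sum>j<s-2. (m div (A + 1) ^ j mod (A + 1)) * Suc j)))
        (\<lambda>x. of_int (\<phi> (a, m)) * moment_monomial s c A a m x :: complex)"
      unfolding moment_monomial_def
      by (intro poly_in_mult poly_in_const poly_in_power poly_in_prod poly_in_moment) auto
    moreover have "0 + (a * (s - 1) + (\<Sum>j<s-2. (m div (A + 1) ^ j mod (A + 1)) * Suc j)) \<le> H"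
    proof -
      have "(\<Sum>j<s-2. (m div (A + 1) ^ j mod (A + 1)) * Suc j) \<le> (\<Sum>j<n. A * (n + 1))"
        unfolding n_def[symmetric] by (intro sum_mono mult_mono) (auto simp: less_Suc_eq_le[symmetric])
      moreover have "a * (s - 1) \<le> A * (n + 1)" using z am unfolding sn by (intro mult_mono) (auto simp: X_def)
      ultimately show ?thesis by (simp add: H_def power2_eq_square algebra_simps)
    qed
    ultimately show "poly_in i H (\<lambda>x. case z of (a, m) \<Rightarrow> (of_int (\<phi> (a, m)) * moment_monomial s c A a m x :: complex))"
      unfolding am prod.case by (rule poly_in_mono)
  qed (auto simp: X_def)
  have F0: "F x = 0" if x: "x 1 = 0" "x 2 = 1" for x
  proof (rule vanishing_on_grid[where V = "{3..s}" and F = F and H = H and x = x and ?x0.0 = x])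
    fix y assume y: "\<forall>i\<in>{3..s}. y i \<in> of_nat ` {..H}" "\<forall>i. i \<notin> {3..s} \<longrightarrow> y i = x i"
    have "\<forall>i\<in>{3..s}. \<exists>k. y i = of_nat k \<and> k \<le> H" using y(1) by auto
    from bchoice[OF this] obtain k where k: "\<And>i. i \<in> {3..s} \<Longrightarrow> y i = of_nat (k i) \<and> k i \<le> H"
      by blast
    \<comment> \<open>The value \<open>undefined\<close> outside \<open>{3..s}\<close> is the one
      that membership in \<open>PiE\<close> demands.\<close>
    define v where "v i = (if i \<in> {3..s} then int (k i) else undefined)" for i
    have v: "v \<in> Y" using k by (auto simp: Y_def v_def)
    have "y i = of_int (y0 v i)" if "i \<in> {1..s}" for i
      using that k y x by (cases "i = 1"; cases "i = 2") (auto simp: y0_def v_def)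
    hence "moment s c j y = of_int (moment s c j (y0 v))" for j
      by (simp add: moment_def)
    hence "moment_monomial s c A a m y = of_int (moment_monomial s c A a m (y0 v))" for a m
      by (simp add: moment_monomial_def)
    hence "F y = of_int (\<Sum>x\<in>X. moment_monomial s c A (fst x) (snd x) (y0 v) * \<phi> x)"
      unfolding F_def by (simp add: case_prod_beta mult.commute)
    thus "F y = 0" using \<phi>(2) v by simp
  qed (use \<open>\<And>i. poly_in i H F\<close> in auto)
  show thesis
  proof (rule that[of A "\<lambda>a m. \<phi> (a, m)"])
    show "\<exists>a\<le>A. \<exists>m<(A + 1) ^ (s - 2). \<phi> (a, m) \<noteq> 0"
      using \<phi>(1) by (auto simp: X_def n_def)
    fix x :: "nat \<Rightarrow> complex" assume "x 1 = 0" "x 2 = 1"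
    from F0[OF this] show "(\<Sum>a\<le>A. \<Sum>m<(A + 1) ^ (s - 2).
        of_int (\<phi> (a, m)) * moment_monomial s c A a m x) = 0"
      by (simp add: F_def X_def n_def sum.cartesian_product)
  qed
qed

section \<open>Residue fields of finitely generated subrings of the complex numbers\<close>

interpretation int_module: Modules.module "\<lambda>(n::int) (x::complex). of_int n * x"
  by unfold_locales (auto simp: algebra_simps)

text \<open>As a simp rule this would loop with \<open>of_int_mult\<close>.\<close>
declare int_module.scale_scale [simp del]

text \<open>The residue field \<open>R / I\<close> is handled through congruences in
  \<open>R\<close>, without a quotient type. The axiom \<open>inverse_mod\<close> expresses
  maximality of \<open>I\<close>, and the finite generating set \<open>B\<close> of the additive
  group bounds the degree over the prime field.\<close>

locale residue_field =
  fixes R I B :: "complex set" and p :: nat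
  assumes one_R: "1 \<in> R"
    and diff_R: "x \<in> R \<Longrightarrow> y \<in> R \<Longrightarrow> x - y \<in> R"
    and mult_R: "x \<in> R \<Longrightarrow> y \<in> R \<Longrightarrow> x * y \<in> R"
    and finite_B: "finite B" and R_span: "R = int_module.span B"
    and I_subset: "I \<subseteq> R"
    and diff_I: "x \<in> I \<Longrightarrow> y \<in> I \<Longrightarrow> x - y \<in> I"
    and mult_I: "r \<in> R \<Longrightarrow> x \<in> I \<Longrightarrow> r * x \<in> I"
    and one_I: "1 \<notin> I"
    and inverse_mod: "x \<in> R \<Longrightarrow> x \<notin> I \<Longrightarrow> \<exists>y\<in>R. x * y - 1 \<in> I"
    and prime_p: "prime p" and p_I: "of_nat p \<in> I"
begin

lemma zero_I: "0 \<in> I" using diff_I[OF p_I p_I] by simp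
lemma I_R: "x \<in> I \<Longrightarrow> x \<in> R" using I_subset by blast
lemma zero_R: "0 \<in> R" using zero_I I_R by blast
lemma uminus_R: "x \<in> R \<Longrightarrow> -x \<in> R" using diff_R[OF zero_R] by simp
lemma uminus_I: "x \<in> I \<Longrightarrow> -x \<in> I" using diff_I[OF zero_I] by simp
lemma add_R: "x \<in> R \<Longrightarrow> y \<in> R \<Longrightarrow> x + y \<in> R" using diff_R[OF _ uminus_R] by force
lemma add_I: "x \<in> I \<Longrightarrow> y \<in> I \<Longrightarrow> x + y \<in> I" using diff_I[OF _ uminus_I] by force
lemma mult_I': "x \<in> I \<Longrightarrow> r \<in> R \<Longrightarrow> x * r \<in> I" using mult_I by (simp add: mult.commute)
lemma sum_R: "(\<And>i. i \<in> A \<Longrightarrow> f i \<in> R) \<Longrightarrow> sum f A \<in> R"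
  by (induction A rule: infinite_finite_induct) (auto intro: zero_R add_R)
lemma sum_I: "(\<And>i. i \<in> A \<Longrightarrow> f i \<in> I) \<Longrightarrow> sum f A \<in> I"
  by (induction A rule: infinite_finite_induct) (auto intro: zero_I add_I)
lemma prod_R: "(\<And>i. i \<in> A \<Longrightarrow> f i \<in> R) \<Longrightarrow> prod f A \<in> R"
  by (induction A rule: infinite_finite_induct) (auto intro: one_R mult_R)
lemma power_R: "x \<in> R \<Longrightarrow> x ^ k \<in> R"
  by (induction k) (auto intro: one_R mult_R)
lemma of_nat_R: "of_nat k \<in> R"
  by (induction k) (auto intro: one_R zero_R add_R)
lemma of_int_R: "of_int k \<in> R"
  by (cases k rule: int_cases2) (auto intro: of_nat_R uminus_R)

lemmas R_intros = zero_R one_R diff_R uminus_R add_R mult_R sum_R prod_R power_R of_nat_R of_int_R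

lemma moment_R: "(\<And>i. i \<in> {1..s} \<Longrightarrow> x i \<in> R) \<Longrightarrow> moment s c j x \<in> R"
  unfolding moment_def by (intro R_intros)

lemma prime_I: "x \<in> R \<Longrightarrow> y \<in> R \<Longrightarrow> x * y \<in> I \<Longrightarrow> x \<in> I \<or> y \<in> I"
proof (rule ccontr)
  assume a: "x \<in> R" "y \<in> R" "x * y \<in> I" "\<not> (x \<in> I \<or> y \<in> I)"
  then obtain x' where "x' \<in> R" "x * x' - 1 \<in> I" using inverse_mod by blast
  hence "x' * (x * y) - y * (x * x' - 1) \<in> I" using a by (blast intro: diff_I mult_I)
  also have "x' * (x * y) - y * (x * x' - 1) = y" by (simp add: algebra_simps)
  finally show False using a by simp
qed

lemma prod_I: "finite A \<Longrightarrow> (\<And>i. i \<in> A \<Longrightarrow> f i \<in> R) \<Longrightarrow> prod f A \<in> I \<Longrightarrow> \<exists>i\<in>A. f i \<in> I"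
proof (induction A rule: finite_induct)
  case empty
  thus ?case using one_I by simp
next
  case (insert a A)
  hence "f a * prod f A \<in> I" "f a \<in> R" "prod f A \<in> R" by (simp_all add: prod_R)
  hence "f a \<in> I \<or> prod f A \<in> I" using prime_I by blast
  thus ?case using insert.IH insert.prems(1) by blast
qed

text \<open>If an integer prime to \<open>p\<close> lay in \<open>I\<close>, Bezout would put 1 into
  \<open>I\<close>.\<close>

lemma of_int_I_iff: "of_int n \<in> I \<longleftrightarrow> int p dvd n"
proof
  assume "int p dvd n"
  then obtain k where "n = int p * k" by auto
  thus "of_int n \<in> I" using mult_I'[OF p_I of_int_R[of k]] by simp
next
  assume n: "of_int n \<in> I"
  show "int p dvd n"
  proof (rule ccontr)
    assume "\<not> int p dvd n"
    hence "coprime (int p) n" using prime_p by (simp add: prime_imp_coprime)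
    then obtain u v where "u * int p + v * n = 1" by (metis bezout_int coprime_iff_gcd_eq_1)
    hence "of_int (u * int p + v * n) = (1 :: complex)" by simp
    moreover have "of_int u * of_nat p + of_int v * of_int n \<in> I"
      using n p_I by (intro add_I mult_I of_int_R)
    ultimately show False using one_I by simp
  qed
qed

section \<open>Congruence modulo the ideal\<close>

definition equiv_mod (infix "\<doteq>" 50) where "x \<doteq> y \<longleftrightarrow> x - y \<in> I"

lemma equiv_refl [simp]: "x \<doteq> x" by (simp add: equiv_mod_def zero_I)
lemma equiv_sym: "x \<doteq> y \<Longrightarrow> y \<doteq> x" using uminus_I[of "x - y"] by (simp add: equiv_mod_def)
lemma equiv_trans [trans]: "x \<doteq> y \<Longrightarrow> y \<doteq> z \<Longrightarrow> x \<doteq> z"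
  using add_I[of "x - y" "y - z"] by (simp add: equiv_mod_def)
lemma equiv_I_iff: "x \<doteq> y \<Longrightarrow> x \<in> I \<longleftrightarrow> y \<in> I"
  using add_I[of "x - y" y] diff_I[of x "x - y"] by (auto simp: equiv_mod_def)
lemma equiv_0_iff: "x \<doteq> 0 \<longleftrightarrow> x \<in> I" by (simp add: equiv_mod_def)
lemma equiv_add: "x \<doteq> y \<Longrightarrow> x' \<doteq> y' \<Longrightarrow> x + x' \<doteq> y + y'"
  using add_I[of "x - y" "x' - y'"] by (simp add: equiv_mod_def algebra_simps)
lemma equiv_diff: "x \<doteq> y \<Longrightarrow> x' \<doteq> y' \<Longrightarrow> x - x' \<doteq> y - y'"
  using diff_I[of "x - y" "x' - y'"] by (simp add: equiv_mod_def algebra_simps)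
lemma equiv_sum: "(\<And>i. i \<in> A \<Longrightarrow> f i \<doteq> g i) \<Longrightarrow> sum f A \<doteq> sum g A"
  using sum_I[of A "\<lambda>i. f i - g i"] by (simp add: equiv_mod_def sum_subtractf)
lemma equiv_mult: "x \<doteq> y \<Longrightarrow> x' \<doteq> y' \<Longrightarrow> x \<in> R \<Longrightarrow> y' \<in> R \<Longrightarrow> x * x' \<doteq> y * y'"
proof -
  assume "x \<doteq> y" "x' \<doteq> y'" "x \<in> R" "y' \<in> R"
  hence "x * (x' - y') + y' * (x - y) \<in> I" unfolding equiv_mod_def by (blast intro: add_I mult_I)
  thus ?thesis by (simp add: equiv_mod_def algebra_simps)
qed
lemma equiv_power: "x \<doteq> y \<Longrightarrow> x \<in> R \<Longrightarrow> y \<in> R \<Longrightarrow> x ^ k \<doteq> y ^ k"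
  by (induction k) (auto intro: equiv_mult power_R)
lemma equiv_prod: "(\<And>i. i \<in> A \<Longrightarrow> f i \<doteq> g i \<and> f i \<in> R \<and> g i \<in> R) \<Longrightarrow> prod f A \<doteq> prod g A"
  by (induction A rule: infinite_finite_induct) (auto intro: equiv_mult prod_R)

text \<open>A spanning set modulo \<open>I\<close> of least size is independent modulo
  \<open>p\<close>: a coefficient not divisible by \<open>p\<close> could be inverted, and its
  vector expressed through the others.\<close>

lemma ex_basis:
  obtains S where "finite S" "S \<subseteq> R" "card S \<le> card B"
    "\<And>x. x \<in> R \<Longrightarrow> \<exists>n. x \<doteq> (\<Sum>b\<in>S. of_int (n b) * b)"
    "\<And>n b. (\<Sum>b\<in>S. of_int (n b) * b) \<in> I \<Longrightarrow> b \<in> S \<Longrightarrow> int p dvd n b"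
proof -
  define good where "good S \<longleftrightarrow> finite S \<and> S \<subseteq> R \<and> card S \<le> card B \<and>
    (\<forall>x\<in>R. \<exists>n. x \<doteq> (\<Sum>b\<in>S. of_int (n b) * b))" for S
  have "good B"
    unfolding good_def
  proof (intro conjI ballI finite_B)
    show "B \<subseteq> R" using R_span int_module.span_superset by blast
    fix x assume "x \<in> R"
    then obtain n where "x = (\<Sum>b\<in>B. of_int (n b) * b)"
      unfolding R_span int_module.span_finite[OF finite_B] by auto
    hence "x \<doteq> (\<Sum>b\<in>B. of_int (n b) * b)" by simp
    thus "\<exists>n. x \<doteq> (\<Sum>b\<in>B. of_int (n b) * b)" by (intro exI[of _ n])
  qed simp
  then obtain S where S: "good S" "\<And>S'. good S' \<Longrightarrow> card S \<le> card S'"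
    using ex_has_least_nat[of good B card] by blast
  have fin: "finite S" and SR: "S \<subseteq> R" and sp: "\<And>x. x \<in> R \<Longrightarrow> \<exists>n. x \<doteq> (\<Sum>b\<in>S. of_int (n b) * b)"
    and cB: "card S \<le> card B"
    using S(1) by (auto simp: good_def)
  show thesis
  proof (rule that[OF fin SR cB sp])
    fix n b0 assume n: "(\<Sum>b\<in>S. of_int (n b) * b) \<in> I" and b0: "b0 \<in> S"
    show "int p dvd n b0"
    proof (rule ccontr)
      assume "\<not> int p dvd n b0"
      hence "coprime (int p) (n b0)" using prime_p by (simp add: prime_imp_coprime)
      \<comment> \<open>Here \<open>v\<close> is an inverse of \<open>n b0\<close> modulo
        \<open>p\<close>.\<close>
      then obtain u v where uv: "u * int p + v * n b0 = 1" by (metis bezout_int coprime_iff_gcd_eq_1)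
      have "of_int (u * int p + v * n b0) = (1::complex)" using uv by simp
      hence vn: "of_int v * of_int (n b0) = 1 - of_int u * (of_nat p :: complex)"
        by (simp add: algebra_simps)
      have b0': "b0 \<doteq> - (\<Sum>b\<in>S-{b0}. of_int (v * n b) * b)"
      proof -
        have "of_int v * (\<Sum>b\<in>S. of_int (n b) * b) + of_int u * b0 * of_nat p \<in> I"
          using n p_I SR b0 by (intro add_I mult_I of_int_R mult_R) auto
        also have "of_int v * (\<Sum>b\<in>S. of_int (n b) * b) =
            of_int v * of_int (n b0) * b0 + (\<Sum>b\<in>S-{b0}. of_int (v * n b) * b)"
          by (subst sum.remove[OF fin b0]) (simp add: algebra_simps sum_distrib_left)
        also have "\<dots> + of_int u * b0 * of_nat p = b0 - (- (\<Sum>b\<in>S-{b0}. of_int (v * n b) * b))"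
          unfolding vn by (simp add: algebra_simps)
        finally show ?thesis by (simp add: equiv_mod_def)
      qed
      have "\<exists>m. x \<doteq> (\<Sum>b\<in>S-{b0}. of_int (m b) * b)" if xR: "x \<in> R" for x
      proof -
        obtain m where m: "x \<doteq> (\<Sum>b\<in>S. of_int (m b) * b)" using sp[OF xR] by blast
        let ?T = "\<Sum>b\<in>S-{b0}. of_int (v * n b) * b" and ?U = "\<Sum>b\<in>S-{b0}. of_int (m b) * b"
        have "?T \<in> R" using SR by (intro sum_R mult_R of_int_R) blast
        hence "of_int (m b0) * b0 + ?U \<doteq> of_int (m b0) * - ?T + ?U"
          by (intro equiv_add[OF equiv_mult[OF equiv_refl b0' of_int_R] equiv_refl] uminus_R)
        moreover have "of_int (m b0) * - ?T + ?U = (\<Sum>b\<in>S-{b0}. of_int (m b - m b0 * (v * n b)) * b)"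
        proof -
          have "of_int (m b0) * ?T = (\<Sum>b\<in>S-{b0}. of_int (m b0 * (v * n b)) * b)"
            by (simp only: sum_distrib_left of_int_mult mult.assoc)
          thus ?thesis by (simp only: of_int_diff left_diff_distrib sum_subtractf mult_minus_right) simp
        qed
        moreover have "(\<Sum>b\<in>S. of_int (m b) * b) = of_int (m b0) * b0 + ?U"
          by (rule sum.remove[OF fin b0])
        ultimately have "x \<doteq> (\<Sum>b\<in>S-{b0}. of_int (m b - m b0 * (v * n b)) * b)"
          using equiv_trans[OF m] by simp
        thus ?thesis by (intro exI[of _ "\<lambda>b. m b - m b0 * (v * n b)"])
      qed
      moreover have "card (S - {b0}) \<le> card B" using cB by (metis card_Diff1_le le_trans)
      ultimately have "good (S - {b0})" unfolding good_def using fin SR by auto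
      from S(2)[OF this] show False using fin b0
        by (metis card_Diff1_less not_le)
    qed
  qed
qed

text \<open>Reducing coordinates to \<open>{0..<p}\<close> turns the basis into a transversal
  \<open>X\<close> of \<open>R / I\<close>. The coordinates themselves later serve as digits, and
  \<open>card S\<close> is the degree of the residue field over its prime field.\<close>

lemma ex_residues:
  obtains S X where "finite S" "S \<subseteq> R" "card S \<le> card B"
    "\<And>x. x \<in> R \<Longrightarrow> \<exists>n\<in>PiE S (\<lambda>_. {0..<int p}). x \<doteq> (\<Sum>b\<in>S. of_int (n b) * b)"
    "finite X" "X \<subseteq> R" "card X = p ^ card S"
    "\<And>x. x \<in> R \<Longrightarrow> \<exists>y\<in>X. x \<doteq> y" "\<And>x y. x \<in> X \<Longrightarrow> y \<in> X \<Longrightarrow> x \<doteq> y \<Longrightarrow> x = y"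
proof -
  obtain S where S: "finite S" "S \<subseteq> R" "card S \<le> card B"
    "\<And>x. x \<in> R \<Longrightarrow> \<exists>n. x \<doteq> (\<Sum>b\<in>S. of_int (n b) * b)"
    "\<And>n b. (\<Sum>b\<in>S. of_int (n b) * b) \<in> I \<Longrightarrow> b \<in> S \<Longrightarrow> int p dvd n b"
    using ex_basis by blast
  have p0: "int p > 0" using prime_p by (simp add: prime_gt_0_nat)
  let ?N = "PiE S (\<lambda>_. {0..<int p})"
  let ?comb = "\<lambda>n. \<Sum>b\<in>S. of_int (n b) * b"
  have rep: "\<exists>n\<in>?N. x \<doteq> ?comb n" if "x \<in> R" for x
  proof -
    obtain m where m: "x \<doteq> ?comb m" using S(4) \<open>x \<in> R\<close> by blast
    define n where "n = restrict (\<lambda>b. m b mod int p) S"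
    have "?comb m \<doteq> ?comb n"
    proof (intro equiv_sum equiv_mult equiv_refl of_int_R)
      fix b assume b: "b \<in> S"
      have "int p dvd m b - n b" using b by (simp add: n_def minus_mod_eq_mult_div)
      hence "of_int (m b - n b) \<in> I" by (simp only: of_int_I_iff)
      thus "of_int (m b) \<doteq> of_int (n b)" by (simp add: equiv_mod_def)
    qed (use S(2) in auto)
    moreover have "n \<in> ?N" using p0 by (auto simp: n_def)
    ultimately show ?thesis using equiv_trans[OF m] by blast
  qed
  have inj: "n = n'" if n: "n \<in> ?N" "n' \<in> ?N" and eq: "?comb n \<doteq> ?comb n'" for n n'
  proof (rule PiE_ext[OF n])
    fix b assume b: "b \<in> S"
    have "(\<Sum>b\<in>S. of_int (n b - n' b) * b) \<in> I"
      using eq by (simp add: equiv_mod_def left_diff_distrib sum_subtractf)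
    hence "int p dvd n b - n' b" by (rule S(5)) fact
    hence "n b mod int p = n' b mod int p" by (rule mod_eq_dvd_iff[THEN iffD2])
    thus "n b = n' b" using n b by (auto simp: PiE_def Pi_def)
  qed
  define X where "X = ?comb ` ?N"
  have "inj_on ?comb ?N"
    by (rule inj_onI, rule inj) simp_all
  hence 1: "card X = p ^ card S" unfolding X_def by (subst card_image) (simp_all add: card_PiE S(1))
  have "?comb n \<in> R" for n using S(2) by (intro sum_R mult_R of_int_R) blast
  hence 2: "X \<subseteq> R" unfolding X_def by blast
  have 3: "finite X" unfolding X_def using S(1) by (intro finite_imageI finite_PiE) simp_all
  have 4: "\<exists>y\<in>X. x \<doteq> y" if "x \<in> R" for x
    using rep[OF that] unfolding X_def by blast
  have 5: "x = y" if xy: "x \<in> X" "y \<in> X" "x \<doteq> y" for x y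
  proof -
    obtain n n' where n: "n \<in> ?N" "x = ?comb n" "n' \<in> ?N" "y = ?comb n'"
      using xy(1,2) unfolding X_def by blast
    have "n = n'" using inj[OF n(1,3)] xy(3) n(2,4) by simp
    thus ?thesis using n by simp
  qed
  show thesis by (rule that[OF S(1-3) rep 3 2 1 4 5])
qed

text \<open>Both 1 and \<open>\<zeta>\<close> have \<open>l\<close>-th power 1 and differ modulo
  \<open>I\<close>, so the \<open>l\<close>-th power map on the finite residue field is not
  injective, hence not surjective.\<close>

lemma ex_nonpower:
  assumes "\<zeta> \<in> R" "\<zeta> ^ l = 1" "\<zeta> - 1 \<notin> I"
  obtains h where "h \<in> R" "\<And>y. y \<in> R \<Longrightarrow> \<not> h \<doteq> y ^ l"
proof -
  obtain X where X: "finite X" "X \<subseteq> R" "\<And>x. x \<in> R \<Longrightarrow> \<exists>y\<in>X. x \<doteq> y"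
    "\<And>x y. x \<in> X \<Longrightarrow> y \<in> X \<Longrightarrow> x \<doteq> y \<Longrightarrow> x = y"
    using ex_residues by metis
  from X(3) obtain r where r: "\<And>x. x \<in> R \<Longrightarrow> r x \<in> X" "\<And>x. x \<in> R \<Longrightarrow> x \<doteq> r x" by metis
  have rcong: "r x = r y" if "x \<doteq> y" "x \<in> R" "y \<in> R" for x y
    using that X(4) r by (meson equiv_sym equiv_trans)
  have "\<not> (\<lambda>y. r (y ^ l)) ` X = X"
  proof
    assume "(\<lambda>y. r (y ^ l)) ` X = X"
    hence inj: "inj_on (\<lambda>y. r (y ^ l)) X" using X(1) by (simp add: eq_card_imp_inj_on)
    have XR: "x \<in> R" if "x \<in> X" for x using that X(2) by blast
    have pw: "r (r x ^ l) = r (x ^ l)" if "x \<in> R" for x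
      using that r XR by (intro rcong equiv_power R_intros equiv_sym[OF r(2)]) auto
    have "r (r \<zeta> ^ l) = r (r 1 ^ l)" using pw[OF assms(1)] pw[OF one_R] assms(2) by simp
    hence "r \<zeta> = r 1" using inj r(1) assms(1) one_R by (auto dest: inj_onD)
    hence "\<zeta> \<doteq> 1" using r(2) assms(1) one_R by (metis equiv_sym equiv_trans)
    thus False using assms(3) by (simp add: equiv_mod_def)
  qed
  moreover have "(\<lambda>y. r (y ^ l)) ` X \<subseteq> X" using r(1) X(2) power_R by auto
  ultimately obtain h where h: "h \<in> X" "h \<notin> (\<lambda>y. r (y ^ l)) ` X" by blast
  show thesis
  proof (rule that[of h])
    show "h \<in> R" using h X(2) by blast
    fix y assume y: "y \<in> R"
    show "\<not> h \<doteq> y ^ l"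
    proof
      assume "h \<doteq> y ^ l"
      moreover have ryR: "r y \<in> R" using r(1)[OF y] X(2) by (rule subsetD[rotated])
      have "y ^ l \<doteq> r y ^ l" using r(2)[OF y] y ryR by (rule equiv_power)
      moreover have "r y ^ l \<doteq> r (r y ^ l)" using power_R[OF ryR] by (rule r(2))
      ultimately have "h \<doteq> r (r y ^ l)" using equiv_trans by blast
      hence "h = r (r y ^ l)" by (rule X(4)[OF h(1) r(1)[OF power_R[OF ryR]]])
      thus False using h(2) r(1)[OF y] by blast
    qed
  qed
qed

text \<open>A linear map with trivial kernel is injective on tuples of representatives. Domain and
  codomain are finite of equal size, so it is onto; no determinants are involved.\<close>

lemma square_system_solvable:
  assumes "finite V" "finite J" "card V = card J" "\<And>j i. j \<in> J \<Longrightarrow> i \<in> V \<Longrightarrow> M j i \<in> R"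
    and inj: "\<And>w. (\<And>i. i \<in> V \<Longrightarrow> w i \<in> R) \<Longrightarrow> (\<And>j. j \<in> J \<Longrightarrow> (\<Sum>i\<in>V. M j i * w i) \<in> I) \<Longrightarrow>
      (\<And>i. i \<in> V \<Longrightarrow> w i \<in> I)"
    and u: "\<And>j. j \<in> J \<Longrightarrow> u j \<in> R"
  obtains w where "\<And>i. w i \<in> R" "\<And>i. i \<notin> V \<Longrightarrow> w i = 0" "\<And>j. j \<in> J \<Longrightarrow> (\<Sum>i\<in>V. M j i * w i) \<doteq> u j"
proof -
  obtain X where X: "finite X" "X \<subseteq> R" "\<And>x. x \<in> R \<Longrightarrow> \<exists>y\<in>X. x \<doteq> y"
    "\<And>x y. x \<in> X \<Longrightarrow> y \<in> X \<Longrightarrow> x \<doteq> y \<Longrightarrow> x = y"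
    using ex_residues by metis
  from X(3) obtain r where r: "\<And>x. x \<in> R \<Longrightarrow> r x \<in> X" "\<And>x. x \<in> R \<Longrightarrow> x \<doteq> r x" by metis
  define T where "T w = restrict (\<lambda>j. r (\<Sum>i\<in>V. M j i * w i)) J" for w
  have XV: "w i \<in> R" if "w \<in> PiE V (\<lambda>_. X)" "i \<in> V" for w i using that X(2) by auto
  have sR: "(\<Sum>i\<in>V. M j i * w i) \<in> R" if "w \<in> PiE V (\<lambda>_. X)" "j \<in> J" for w j
    using that XV assms(4) by (intro R_intros)
  have "T ` PiE V (\<lambda>_. X) \<subseteq> PiE J (\<lambda>_. X)" unfolding T_def using r(1) sR by auto
  moreover have "inj_on T (PiE V (\<lambda>_. X))"
  proof (rule inj_onI)
    fix w w' assume w: "w \<in> PiE V (\<lambda>_. X)" "w' \<in> PiE V (\<lambda>_. X)" and eq: "T w = T w'"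
    have "(\<Sum>i\<in>V. M j i * (w i - w' i)) \<in> I" if j: "j \<in> J" for j
    proof -
      have "r (\<Sum>i\<in>V. M j i * w i) = r (\<Sum>i\<in>V. M j i * w' i)"
        using fun_cong[OF eq, of j] j by (simp add: T_def)
      hence "(\<Sum>i\<in>V. M j i * w i) \<doteq> (\<Sum>i\<in>V. M j i * w' i)"
        using r(2)[OF sR[OF w(1) j]] r(2)[OF sR[OF w(2) j]] by (metis equiv_sym equiv_trans)
      thus ?thesis by (simp add: equiv_mod_def right_diff_distrib sum_subtractf)
    qed
    hence "w i - w' i \<in> I" if "i \<in> V" for i
      using inj[of "\<lambda>i. w i - w' i" i] XV w that by (auto intro: diff_R)
    hence "w i = w' i" if "i \<in> V" for i
      using that w X(4)[of "w i" "w' i"] PiE_mem[OF w(1) that] PiE_mem[OF w(2) that]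
      by (simp add: equiv_mod_def)
    thus "w = w'" by (rule PiE_ext[OF w])
  qed
  moreover have "card (PiE V (\<lambda>_. X)) = card (PiE J (\<lambda>_. X))"
    using assms(1-3) by (simp add: card_PiE)
  ultimately have "T ` PiE V (\<lambda>_. X) = PiE J (\<lambda>_. X)"
    using assms(2) X(1) by (intro card_subset_eq finite_PiE) (auto simp: card_image)
  moreover have "restrict (\<lambda>j. r (u j)) J \<in> PiE J (\<lambda>_. X)" using u r(1) by auto
  ultimately obtain w where w: "w \<in> PiE V (\<lambda>_. X)" "T w = restrict (\<lambda>j. r (u j)) J" by (metis imageE)
  show thesis
  proof (rule that[of "\<lambda>i. if i \<in> V then w i else 0"])
    fix j assume j: "j \<in> J"
    have "(\<Sum>i\<in>V. M j i * w i) \<doteq> r (\<Sum>i\<in>V. M j i * w i)" using r(2) sR[OF w(1) j] by blast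
    also have "r (\<Sum>i\<in>V. M j i * w i) = r (u j)" using fun_cong[OF w(2), of j] j by (simp add: T_def)
    also have "\<dots> \<doteq> u j" using r(2)[OF u[OF j]] by (rule equiv_sym)
    finally show "(\<Sum>i\<in>V. M j i * (if i \<in> V then w i else 0)) \<doteq> u j"
      by (simp cong: sum.cong)
  qed (use XV w zero_R in auto)
qed

section \<open>Polynomials over the ring and their reduction\<close>

definition polys_R where "polys_R = {q. \<forall>k. poly.coeff q k \<in> R}"
definition polys_I where "polys_I = {q. \<forall>k. poly.coeff q k \<in> I}"

lemma polys_R_mult: "q \<in> polys_R \<Longrightarrow> q' \<in> polys_R \<Longrightarrow> q * q' \<in> polys_R"
  by (auto simp: polys_R_def coeff_mult intro!: R_intros)
lemma polys_I_mult: "q \<in> polys_R \<Longrightarrow> q' \<in> polys_I \<Longrightarrow> q * q' \<in> polys_I"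
  by (auto simp: polys_R_def polys_I_def coeff_mult intro!: sum_I mult_I)
lemma polys_R_add: "q \<in> polys_R \<Longrightarrow> q' \<in> polys_R \<Longrightarrow> q + q' \<in> polys_R"
  by (auto simp: polys_R_def intro!: R_intros)
lemma polys_I_add: "q \<in> polys_I \<Longrightarrow> q' \<in> polys_I \<Longrightarrow> q + q' \<in> polys_I"
  by (auto simp: polys_I_def intro!: add_I)
lemma polys_R_pCons: "a \<in> R \<Longrightarrow> q \<in> polys_R \<Longrightarrow> pCons a q \<in> polys_R"
  by (auto simp: polys_R_def coeff_pCons split: nat.splits)
lemma polys_R_0: "0 \<in> polys_R" by (simp add: polys_R_def zero_R)
lemma polys_I_0: "0 \<in> polys_I" by (simp add: polys_I_def zero_I)
lemma polys_R_1: "1 \<in> polys_R" by (auto simp: polys_R_def coeff_1 intro: R_intros)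
lemma polys_R_power: "q \<in> polys_R \<Longrightarrow> q ^ k \<in> polys_R"
  by (induction k) (auto intro: polys_R_1 polys_R_mult)
lemma polys_R_prod: "(\<And>i. i \<in> A \<Longrightarrow> f i \<in> polys_R) \<Longrightarrow> prod f A \<in> polys_R"
  by (induction A rule: infinite_finite_induct) (auto intro: polys_R_1 polys_R_mult)
lemma polys_R_sum: "(\<And>i. i \<in> A \<Longrightarrow> f i \<in> polys_R) \<Longrightarrow> sum f A \<in> polys_R"
  by (induction A rule: infinite_finite_induct) (auto intro: polys_R_0 polys_R_add)
lemma polys_R_of_int: "of_int k \<in> polys_R"
  by (auto simp: polys_R_def of_int_poly coeff_pCons split: nat.splits intro: R_intros)

lemmas polys_R_intros = polys_R_0 polys_R_1 polys_R_add polys_R_mult polys_R_pCons polys_R_power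
  polys_R_prod polys_R_sum polys_R_of_int

lemma poly_R: "q \<in> polys_R \<Longrightarrow> x \<in> R \<Longrightarrow> poly q x \<in> R"
  unfolding poly_altdef by (auto simp: polys_R_def intro!: R_intros)

lemma sum_poly_in_I:
  assumes "\<And>m. m \<le> degree q \<Longrightarrow> (\<Sum>i\<in>S. C i * v i ^ m) \<in> I" "q \<in> polys_R"
  shows "(\<Sum>i\<in>S. C i * poly q (v i)) \<in> I"
proof -
  have "(\<Sum>i\<in>S. C i * poly q (v i)) = (\<Sum>i\<in>S. \<Sum>m\<le>degree q. poly.coeff q m * (C i * v i ^ m))"
    by (simp add: poly_altdef sum_distrib_left mult_ac)
  also have "\<dots> = (\<Sum>m\<le>degree q. poly.coeff q m * (\<Sum>i\<in>S. C i * v i ^ m))"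
    by (subst sum.swap) (simp add: sum_distrib_left)
  also have "\<dots> \<in> I"
  proof (rule sum_I)
    fix m assume "m \<in> {..degree q}"
    thus "poly.coeff q m * (\<Sum>i\<in>S. C i * v i ^ m) \<in> I"
      using assms by (intro mult_I[of "poly.coeff q m"]) (auto simp: polys_R_def)
  qed
  finally show ?thesis .
qed

text \<open>Test the power sums against the polynomial that vanishes at all nodes except
  \<open>v i0\<close>. Only the term of \<open>i0\<close> survives, and its second factor is a
  product of differences outside \<open>I\<close>.\<close>

lemma vandermonde_kernel:
  assumes "finite S" "\<And>i. i \<in> S \<Longrightarrow> v i \<in> R" "\<And>i. i \<in> S \<Longrightarrow> C i \<in> R"
    and "\<And>i k. i \<in> S \<Longrightarrow> k \<in> S \<Longrightarrow> i \<noteq> k \<Longrightarrow> \<not> v i \<doteq> v k"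
    and "\<And>m. m < card S \<Longrightarrow> (\<Sum>i\<in>S. C i * v i ^ m) \<in> I" "i0 \<in> S"
  shows "C i0 \<in> I"
proof -
  define q where "q = (\<Prod>k\<in>S-{i0}. [:- v k, 1:])"
  have qR: "q \<in> polys_R" unfolding q_def using assms(2) by (intro polys_R_intros R_intros) auto
  have "degree q \<le> (\<Sum>k\<in>S-{i0}. degree [:- v k, 1:])"
    unfolding q_def using degree_prod_sum_le[of "S-{i0}" "\<lambda>k. [:- v k, 1:]"] assms(1) by (simp add: o_def)
  also have "\<dots> = card S - 1" using assms by simp
  finally have dq: "degree q < card S" using assms(1,6) by (metis card_gt_0_iff diff_less empty_iff le_less_trans less_one)
  have "(\<Sum>i\<in>S. C i * poly q (v i)) \<in> I"
    by (rule sum_poly_in_I) (use assms(5) dq qR in auto)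
  also have "(\<Sum>i\<in>S. C i * poly q (v i)) = C i0 * poly q (v i0) + (\<Sum>i\<in>S-{i0}. C i * poly q (v i))"
    using assms(1,6) by (rule sum.remove)
  also have "(\<Sum>i\<in>S-{i0}. C i * poly q (v i)) = 0"
    using assms(1) by (intro sum.neutral) (auto simp: q_def poly_prod)
  finally have "C i0 * poly q (v i0) \<in> I" by simp
  moreover have "poly q (v i0) \<notin> I"
  proof
    assume "poly q (v i0) \<in> I"
    hence "(\<Prod>k\<in>S-{i0}. v i0 - v k) \<in> I" by (simp add: q_def poly_prod)
    then obtain k where "k \<in> S-{i0}" "v i0 - v k \<in> I"
      using prod_I[of "S-{i0}" "\<lambda>k. v i0 - v k"] assms(1,2,6) by (auto intro: diff_R)
    thus False using assms(4)[of i0 k] assms(6) by (auto simp: equiv_mod_def)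
  qed
  ultimately show ?thesis using prime_I[of "C i0" "poly q (v i0)"] assms(2,3,6) poly_R qR by blast
qed

text \<open>The nodes \<open>0, ..., N - 1\<close> are distinct modulo \<open>p\<close> because
  \<open>N \<le> p\<close>. Solving a Vandermonde system gives weights \<open>w\<close> that extract
  the coefficient \<open>\<psi> m0\<close> from the values.\<close>

lemma coeffs_in_I:
  assumes "N \<le> p" "\<And>m. m < N \<Longrightarrow> \<psi> m \<in> R"
    and "\<And>t. t < N \<Longrightarrow> (\<Sum>m<N. \<psi> m * of_nat t ^ m) \<in> I" "m0 < N"
  shows "\<psi> m0 \<in> I"
proof -
  have diff: "\<not> of_nat a \<doteq> of_nat b" if "a < N" "b < N" "a \<noteq> b" for a b
  proof
    assume "of_nat a \<doteq> of_nat b"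
    hence "of_int (int a - int b) \<in> I" by (simp add: equiv_mod_def)
    hence "int p dvd int a - int b" by (simp only: of_int_I_iff)
    moreover have "\<bar>int a - int b\<bar> < int p" using that assms(1) by linarith
    ultimately show False using that(3)
      by (metis dvd_imp_le_int eq_iff_diff_eq_0 linorder_not_less of_nat_eq_iff abs_of_nat)
  qed
  obtain w where w: "\<And>t. w t \<in> R" "\<And>m. m \<in> {..<N} \<Longrightarrow> (\<Sum>t<N. of_nat t ^ m * w t) \<doteq> (if m = m0 then 1 else 0)"
  proof (rule square_system_solvable[of "{..<N}" "{..<N}" "\<lambda>m t. of_nat t ^ m" "\<lambda>m. if m = m0 then 1 else 0"])
    fix w i assume w: "\<And>i. i \<in> {..<N} \<Longrightarrow> w i \<in> R" 
      "\<And>j. j \<in> {..<N} \<Longrightarrow> (\<Sum>i<N. of_nat i ^ j * w i) \<in> I" "i \<in> {..<N}"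
    show "w i \<in> I"
      by (rule vandermonde_kernel[of "{..<N}" "of_nat"])
         (use w diff in \<open>auto simp: mult.commute intro: R_intros\<close>)
  qed (auto intro: R_intros)
  have "(\<Sum>t<N. w t * (\<Sum>m<N. \<psi> m * of_nat t ^ m)) \<in> I"
  proof (rule sum_I)
    fix t assume "t \<in> {..<N}"
    thus "w t * (\<Sum>m<N. \<psi> m * of_nat t ^ m) \<in> I"
      using assms(3) w(1) by (intro mult_I[of "w t"]) auto
  qed
  also have "(\<Sum>t<N. w t * (\<Sum>m<N. \<psi> m * of_nat t ^ m)) = (\<Sum>m<N. \<psi> m * (\<Sum>t<N. of_nat t ^ m * w t))"
    by (simp add: sum_distrib_left sum_distrib_right) (subst sum.swap, simp add: mult_ac)
  finally have 1: "(\<Sum>m<N. \<psi> m * (\<Sum>t<N. of_nat t ^ m * w t)) \<in> I" .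
  have 2: "(\<Sum>m<N. \<psi> m * (\<Sum>t<N. of_nat t ^ m * w t)) \<doteq> (\<Sum>m<N. \<psi> m * (if m = m0 then 1 else 0))"
    using w assms(2) by (intro equiv_sum equiv_mult equiv_refl) (auto intro: R_intros)
  have 3: "(\<Sum>m<N. \<psi> m * (if m = m0 then 1 else 0)) = \<psi> m0"
  proof -
    have "(\<Sum>m<N. \<psi> m * (if m = m0 then 1 else 0)) = (\<Sum>m<N. if m = m0 then \<psi> m else 0)"
      by (intro sum.cong) auto
    thus ?thesis using assms(4) by simp
  qed
  show ?thesis using equiv_I_iff[OF 2] 1 3 by simp
qed

end

section \<open>The eliminant\<close>

lemma sum_digits: "(\<Sum>j<n. (m div b ^ j mod b) * b ^ j) = (m mod b ^ n :: nat)"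
proof (induction n)
  case (Suc n)
  have "m mod b ^ Suc n = b ^ n * (m div b ^ n mod b) + m mod b ^ n"
    by (simp only: power_Suc2 mod_mult2_eq)
  thus ?case using Suc by (simp add: algebra_simps)
qed simp

lemma coeff_0_power_linear: "poly.coeff ([:z, w:] ^ j) 0 = (z::'a::comm_ring_1) ^ j"
  by (simp flip: poly_0_coeff_0)

lemma coeff_1_power_linear:
  "poly.coeff ([:z, w:] ^ j) (Suc 0) = of_nat j * (z::'a::comm_ring_1) ^ (j - 1) * w"
proof (induction j)
  case (Suc j)
  have "poly.coeff ([:z, w:] ^ Suc j) (Suc 0) = z * poly.coeff ([:z, w:] ^ j) (Suc 0) + w * z ^ j"
    by (simp add: coeff_pCons coeff_0_power_linear)
  also have "\<dots> = of_nat (Suc j) * z ^ j * w"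
    using Suc by (cases j) (auto simp: algebra_simps)
  finally show ?case by simp
qed simp

text \<open>For \<open>n = s - 2\<close> and \<open>b = A + 1\<close> this is the total degree in
  the lower moments of the monomial with index \<open>m\<close>.\<close>

definition digit_sum :: "nat \<Rightarrow> nat \<Rightarrow> nat \<Rightarrow> nat" where
  "digit_sum n b m = (\<Sum>j<n. m div b ^ j mod b)"

context residue_field
begin

lemma polys_I_mult_diff:
  "q1 - q1' \<in> polys_I \<Longrightarrow> q2 - q2' \<in> polys_I \<Longrightarrow> q1 \<in> polys_R \<Longrightarrow> q2' \<in> polys_R \<Longrightarrow>
    q1 * q2 - q1' * q2' \<in> polys_I"
proof -
  assume "q1 - q1' \<in> polys_I" "q2 - q2' \<in> polys_I" "q1 \<in> polys_R" "q2' \<in> polys_R"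
  hence "q1 * (q2 - q2') + q2' * (q1 - q1') \<in> polys_I" by (intro polys_I_add polys_I_mult)
  thus ?thesis by (simp add: algebra_simps)
qed

lemma polys_I_power_diff:
  "q - q' \<in> polys_I \<Longrightarrow> q \<in> polys_R \<Longrightarrow> q' \<in> polys_R \<Longrightarrow> q ^ k - q' ^ k \<in> polys_I"
  by (induction k) (auto intro: polys_I_0 polys_I_mult_diff polys_R_power)

lemma polys_I_prod_diff:
  "(\<And>i. i \<in> A \<Longrightarrow> f i - g i \<in> polys_I \<and> f i \<in> polys_R \<and> g i \<in> polys_R) \<Longrightarrow> prod f A - prod g A \<in> polys_I"
  by (induction A rule: infinite_finite_induct) (auto intro: polys_I_0 polys_I_mult_diff polys_R_prod)

text \<open>
  Substitute \<open>z + X w\<close> into the relation and compare coefficients of \<open>X ^ k\<close>, where \<open>k\<close> is the least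
  total degree in the lower moments. Modulo \<open>I\<close> only the terms of degree exactly \<open>k\<close> contribute, with
  each lower moment replaced by its differential at \<open>z\<close>. The Jacobian is essentially a Vandermonde
  matrix, hence invertible, so the differentials can be prescribed as \<open>t ^ (A + 1) ^ j\<close>, which turns
  the monomial with index \<open>m\<close> into \<open>t ^ m\<close> and separates the coefficients.
\<close>
lemma eliminant_vanishes:
  fixes z :: "nat \<Rightarrow> complex"
  assumes s: "s \<ge> 3"
    and rel: "\<And>x :: nat \<Rightarrow> complex. x 1 = 0 \<Longrightarrow> x 2 = 1 \<Longrightarrow>
       (\<Sum>a\<le>A. \<Sum>m<(A + 1) ^ (s - 2). of_int (\<phi> a m) * moment_monomial s c A a m x) = 0"
    and min: "\<And>a m. a \<le> A \<Longrightarrow> m < (A + 1) ^ (s - 2) \<Longrightarrow> \<phi> a m \<noteq> 0 \<Longrightarrow> k \<le> digit_sum (s - 2) (A + 1) m"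
    and m0: "m0 < (A + 1) ^ (s - 2)" "digit_sum (s - 2) (A + 1) m0 = k"
    and z: "\<And>i. i \<in> {1..s} \<Longrightarrow> z i \<in> R" "z 1 = 0" "z 2 = 1"
    and dist: "\<And>i j. i \<in> {1..s} \<Longrightarrow> j \<in> {1..s} \<Longrightarrow> i \<noteq> j \<Longrightarrow> \<not> z i \<doteq> z j"
    and mom: "\<And>j. 1 \<le> j \<Longrightarrow> j \<le> s - 2 \<Longrightarrow> moment s c j z \<in> I"
    and p: "p > s" "(A + 1) ^ (s - 2) \<le> p" "\<And>i. i \<in> {1..s} \<Longrightarrow> \<not> int p dvd c i"
  shows "(\<Sum>a\<le>A. of_int (\<phi> a m0) * moment s c (s - 1) z ^ a) \<in> I"
proof -
  define mz where "mz = moment s c (s - 1) z"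
  define n where "n = s - 2"
  define N where "N = (A + 1) ^ n"
  define e where "e m j = m div (A + 1) ^ j mod (A + 1)" for m j
  have wt: "digit_sum (s - 2) (A + 1) m = (\<Sum>j<n. e m j)" for m
    by (simp add: digit_sum_def e_def n_def)
  define M where "M j i = of_nat (Suc j) * of_int (c i) * z i ^ j" for j i
  \<comment> \<open>Once the differentials are prescribed, \<open>\<psi> m\<close> is what
    multiplies \<open>t ^ m\<close> in the coefficient of \<open>X ^ k\<close> modulo
    \<open>I\<close>; monomials of larger degree contribute nothing there.\<close>
  define \<psi> where "\<psi> m = (if (\<Sum>j<n. e m j) = k then \<Sum>a\<le>A. of_int (\<phi> a m) * mz ^ a else 0)" for m
  have mzR: "mz \<in> R" unfolding mz_def using z(1) by (rule moment_R)
  have "\<psi> m0 \<in> I"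
  proof (rule coeffs_in_I[of N])
    show "N \<le> p" using p(2) by (simp add: N_def n_def)
    show "m0 < N" using m0 by (simp add: N_def n_def)
    show "\<psi> m \<in> R" for m unfolding \<psi>_def using mzR by (auto intro: R_intros)
    fix t assume "t < N"
    \<comment> \<open>The direction \<open>w\<close> vanishes at coordinates 1 and 2, so the line
      through \<open>z\<close> keeps the normalisation under which the relation holds.\<close>
    obtain w where w: "\<And>i. w i \<in> R" "\<And>i. i \<notin> {3..s} \<Longrightarrow> w i = 0"
      "\<And>j. j \<in> {..<n} \<Longrightarrow> (\<Sum>i\<in>{3..s}. M j i * w i) \<doteq> of_nat t ^ ((A + 1) ^ j)"
    proof (rule square_system_solvable[of "{3..s}" "{..<n}" M "\<lambda>j. of_nat t ^ ((A + 1) ^ j)"])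
      show "card {3..s} = card {..<n}" using s by (simp add: n_def)
      show "M j i \<in> R" if "j \<in> {..<n}" "i \<in> {3..s}" for j i
        using that z(1) by (auto simp: M_def intro!: R_intros)
      fix w i assume w: "\<And>i. i \<in> {3..s} \<Longrightarrow> w i \<in> R"
        "\<And>j. j \<in> {..<n} \<Longrightarrow> (\<Sum>i\<in>{3..s}. M j i * w i) \<in> I" "i \<in> {3..s}"
      \<comment> \<open>The row factors \<open>j + 1\<close> and the column factors
        \<open>c i\<close> are units modulo \<open>p\<close>; what remains is a Vandermonde matrix
        with distinct nodes.\<close>
      have "of_int (c i) * w i \<in> I"
      proof (rule vandermonde_kernel[of "{3..s}" z "\<lambda>i. of_int (c i) * w i"])
        fix j assume "j < card {3..s}"
        hence j: "j < n" by (simp add: n_def)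
        have "of_nat (Suc j) * (\<Sum>i\<in>{3..s}. of_int (c i) * w i * z i ^ j) = (\<Sum>i\<in>{3..s}. M j i * w i)"
          by (simp only: M_def sum_distrib_left mult_ac)
        hence "of_nat (Suc j) * (\<Sum>i\<in>{3..s}. of_int (c i) * w i * z i ^ j) \<in> I"
          using w(2) j by simp
        moreover have "of_nat (Suc j) \<notin> I"
        proof
          assume "of_nat (Suc j) \<in> I"
          hence "of_int (int (Suc j)) \<in> I" by simp
          hence "int p dvd int (Suc j)" by (simp only: of_int_I_iff)
          hence "p \<le> Suc j" by (intro dvd_imp_le) (simp_all only: int_dvd_int_iff zero_less_Suc)
          thus False using j p(1) by (simp add: n_def)
        qed
        moreover have "(\<Sum>i\<in>{3..s}. of_int (c i) * w i * z i ^ j) \<in> R"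
          using w(1) z(1) by (intro R_intros) auto
        ultimately show "(\<Sum>i\<in>{3..s}. of_int (c i) * w i * z i ^ j) \<in> I"
          using prime_I of_nat_R by blast
      qed (use w z dist in \<open>auto intro!: R_intros\<close>)
      moreover have "of_int (c i) \<notin> I" using p(3)[of i] w(3) by (auto simp: of_int_I_iff)
      ultimately show "w i \<in> I" using prime_I of_int_R w(1,3) by blast
    qed (auto intro: R_intros)
    define zp where "zp i = [:z i, w i:]" for i
    define f where "f j = moment s c j zp" for j
    have fR: "f j \<in> polys_R" for j
      unfolding f_def moment_def zp_def using z(1) w(1) by (intro polys_R_intros) auto
    have f0: "poly.coeff (f j) 0 = moment s c j z" for j
      by (simp add: f_def moment_def zp_def coeff_sum of_int_poly coeff_0_power_linear)
    have f1: "poly.coeff (f (Suc j)) (Suc 0) = (\<Sum>i\<in>{3..s}. M j i * w i)" for j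
    proof -
      have "poly.coeff (f (Suc j)) (Suc 0) = (\<Sum>i=1..s. M j i * w i)"
        by (simp add: f_def moment_def zp_def coeff_sum of_int_poly coeff_1_power_linear M_def
            mult_ac del: power_Suc)
      also have "\<dots> = (\<Sum>i\<in>{3..s}. M j i * w i)"
        using w(2) by (intro sum.mono_neutral_right) auto
      finally show ?thesis .
    qed
    \<comment> \<open>For \<open>j < n\<close> the constant term of \<open>f (Suc j)\<close> is a
      lower moment of \<open>z\<close> and lies in \<open>I\<close>. Hence \<open>f (Suc j)\<close>
      is \<open>X * g j\<close> modulo \<open>I\<close>, and \<open>g j\<close> at 0 is the
      differential.\<close>
    define g where "g j = poly_shift 1 (f (Suc j))" for j
    have gR: "g j \<in> polys_R" for j using fR[of "Suc j"] by (auto simp: g_def polys_R_def coeff_poly_shift)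
    have g0: "poly (g j) 0 = (\<Sum>i\<in>{3..s}. M j i * w i)" for j
      using f1[of j] by (simp add: poly_0_coeff_0 g_def coeff_poly_shift)
    let ?X = "Polynomial.monom (1::complex) 1"
    have XR: "?X \<in> polys_R" by (auto simp: polys_R_def intro: R_intros)
    have fg: "f (Suc j) - ?X * g j \<in> polys_I" if "j < n" for j
    proof -
      have "poly.coeff (f (Suc j) - ?X * g j) l = (if l = 0 then moment s c (Suc j) z else 0)" for l
        using f0[of "Suc j"] by (cases l) (auto simp: coeff_monom_mult g_def coeff_poly_shift)
      thus ?thesis using mom[of "Suc j"] that by (auto simp: polys_I_def n_def zero_I)
    qed
    define G where "G = (\<Sum>a\<le>A. \<Sum>m<N. of_int (\<phi> a m) * moment_monomial s c A a m zp)"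
    have "poly G x = 0" for x
    proof -
      have "poly (moment s c j zp) x = moment s c j (\<lambda>i. z i + x * w i)" for j
        by (simp add: moment_def zp_def poly_sum poly_power)
      hence "poly (moment_monomial s c A a m zp) x = moment_monomial s c A a m (\<lambda>i. z i + x * w i)" for a m
        by (simp add: moment_monomial_def poly_prod poly_power)
      hence "poly G x = (\<Sum>a\<le>A. \<Sum>m<N. of_int (\<phi> a m) * moment_monomial s c A a m (\<lambda>i. z i + x * w i))"
        by (simp add: G_def poly_sum)
      also have "\<dots> = 0" unfolding N_def n_def by (rule rel) (use z w in auto)
      finally show ?thesis .
    qed
    hence "G = 0" by (simp add: poly_all_0_iff_0[symmetric])
    have mono: "poly.coeff (moment_monomial s c A a m zp) k \<doteq>
        (if (\<Sum>j<n. e m j) = k then mz ^ a * of_nat t ^ m else 0)"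
      if km: "k \<le> (\<Sum>j<n. e m j)" and mN: "m < N" for a m
    proof -
      let ?E = "\<Sum>j<n. e m j"
      let ?h = "f (s - 1) ^ a * (\<Prod>j<n. g j ^ e m j)"
      have eq: "f (s - 1) ^ a * (\<Prod>j<n. (?X * g j) ^ e m j) = Polynomial.monom 1 ?E * ?h"
      proof -
        have "Polynomial.monom 1 ?E = ?X ^ ?E" by (simp add: monom_power)
        thus ?thesis by (simp only: power_mult_distrib prod.distrib power_sum mult_ac)
      qed
      have "moment_monomial s c A a m zp - f (s - 1) ^ a * (\<Prod>j<n. (?X * g j) ^ e m j) \<in> polys_I"
        unfolding moment_monomial_def f_def[symmetric] n_def[symmetric] e_def[symmetric]
        using fg fR gR XR
        by (intro polys_I_mult_diff polys_I_prod_diff conjI polys_I_power_diff polys_R_intros)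
           (auto simp: polys_I_0)
      hence "poly.coeff (moment_monomial s c A a m zp) k \<doteq> poly.coeff (Polynomial.monom 1 ?E * ?h) k"
        unfolding eq by (auto simp: polys_I_def equiv_mod_def)
      also have "poly.coeff (Polynomial.monom 1 ?E * ?h) k = (if ?E = k then poly ?h 0 else 0)"
        using km by (auto simp: coeff_monom_mult poly_0_coeff_0)
      also have "\<dots> \<doteq> (if ?E = k then mz ^ a * of_nat t ^ m else 0)"
      proof (cases "?E = k")
        case True
        have "poly ?h 0 = mz ^ a * (\<Prod>j<n. (\<Sum>i\<in>{3..s}. M j i * w i) ^ e m j)"
        proof -
          have "poly (f (s - 1)) 0 = mz" unfolding poly_0_coeff_0 mz_def by (rule f0)
          thus ?thesis by (simp only: poly_mult poly_power poly_prod g0)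
        qed
        also have "\<dots> \<doteq> mz ^ a * (\<Prod>j<n. (of_nat t ^ ((A + 1) ^ j)) ^ e m j)"
          using w(1,3) z(1) mzR by (intro equiv_mult equiv_prod equiv_refl conjI equiv_power R_intros)
            (auto simp: M_def intro!: R_intros)
        also have "(\<Prod>j<n. (of_nat t ^ ((A + 1) ^ j)) ^ e m j) = (of_nat t ^ (\<Sum>j<n. e m j * (A + 1) ^ j) :: complex)"
          by (simp add: power_sum power_mult[symmetric] mult.commute)
        also have "(\<Sum>j<n. e m j * (A + 1) ^ j) = m"
          using sum_digits[of m "A + 1" n] mN by (simp add: e_def N_def)
        finally show ?thesis using True by simp
      qed simp
      finally show ?thesis .
    qed
    have "0 = (\<Sum>a\<le>A. \<Sum>m<N. of_int (\<phi> a m) * poly.coeff (moment_monomial s c A a m zp) k)"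
      using \<open>G = 0\<close> by (simp add: G_def coeff_sum of_int_poly poly_eq_iff)
    also have "\<dots> \<doteq> (\<Sum>a\<le>A. \<Sum>m<N. of_int (\<phi> a m) * (if (\<Sum>j<n. e m j) = k then mz ^ a * of_nat t ^ m else 0))"
    proof (intro equiv_sum)
      fix a m assume am: "a \<in> {..A}" "m \<in> {..<N}"
      show "of_int (\<phi> a m) * poly.coeff (moment_monomial s c A a m zp) k \<doteq>
        of_int (\<phi> a m) * (if (\<Sum>j<n. e m j) = k then mz ^ a * of_nat t ^ m else 0)"
      proof (cases "\<phi> a m = 0")
        case False
        hence "k \<le> (\<Sum>j<n. e m j)" using min[of a m] am unfolding wt by (simp add: N_def n_def)
        from mono[OF this] show ?thesis
          using am mzR by (intro equiv_mult equiv_refl) (auto intro: R_intros)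
      qed simp
    qed
    also have "\<dots> = (\<Sum>m<N. \<psi> m * of_nat t ^ m)"
      by (subst sum.swap) (auto simp: \<psi>_def sum_distrib_left mult_ac intro!: sum.cong)
    finally show "(\<Sum>m<N. \<psi> m * of_nat t ^ m) \<in> I"
      using equiv_I_iff zero_I by blast
  qed
  thus ?thesis using m0 unfolding \<psi>_def wt mz_def by simp
qed

end

text \<open>The polynomial \<open>P\<close> is the coefficient, in powers of the top moment, of a
  monomial of least degree in the lower moments. Both \<open>P\<close> and \<open>p0\<close> are
  fixed before \<open>R\<close>, \<open>I\<close> and \<open>p\<close>, since the ring is later
  built from the roots of \<open>P\<close>.\<close>

lemma eliminant:
  assumes "s \<ge> 3"
  obtains P :: "int poly" and p0 :: nat where "P \<noteq> 0"
    "\<And>R I B p z. residue_field R I B p \<Longrightarrow> p0 \<le> p \<Longrightarrow> (\<And>i. i \<in> {1..s} \<Longrightarrow> \<not> int p dvd c i) \<Longrightarrow>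
       (\<And>i. i \<in> {1..s} \<Longrightarrow> z i \<in> R) \<Longrightarrow> z 1 = 0 \<Longrightarrow> z 2 = 1 \<Longrightarrow>
       (\<And>i j. i \<in> {1..s} \<Longrightarrow> j \<in> {1..s} \<Longrightarrow> i \<noteq> j \<Longrightarrow> z i - z j \<notin> I) \<Longrightarrow>
       (\<And>j. 1 \<le> j \<Longrightarrow> j \<le> s - 2 \<Longrightarrow> moment s c j z \<in> I) \<Longrightarrow>
       poly (map_poly of_int P) (moment s c (s - 1) z) \<in> I"
proof -
  obtain A \<phi> where nz: "\<exists>a\<le>A. \<exists>m<(A + 1) ^ (s - 2). \<phi> a m \<noteq> (0::int)"
    and rel: "\<And>x :: nat \<Rightarrow> complex. x 1 = 0 \<Longrightarrow> x 2 = 1 \<Longrightarrow>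
       (\<Sum>a\<le>A. \<Sum>m<(A + 1) ^ (s - 2). of_int (\<phi> a m) * moment_monomial s c A a m x) = 0"
    using moment_relation[OF assms, of c] by blast
  define good where "good m \<longleftrightarrow> m < (A + 1) ^ (s - 2) \<and> (\<exists>a\<le>A. \<phi> a m \<noteq> 0)" for m
  obtain m1 where "good m1" using nz by (auto simp: good_def)
  then obtain m0 where m0: "good m0"
    "\<And>m. good m \<Longrightarrow> digit_sum (s - 2) (A + 1) m0 \<le> digit_sum (s - 2) (A + 1) m"
    using ex_has_least_nat[of good m1 "digit_sum (s - 2) (A + 1)"] by blast
  define P where "P = (\<Sum>a\<le>A. Polynomial.monom (\<phi> a m0) a)"
  have coeff_P: "poly.coeff P a = (if a \<le> A then \<phi> a m0 else 0)" for a
    by (simp add: P_def coeff_sum)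
  have poly_P: "poly (map_poly of_int P) x = (\<Sum>a\<le>A. of_int (\<phi> a m0) * x ^ a)" for x :: complex
  proof -
    have "map_poly of_int P = (\<Sum>a\<le>A. Polynomial.monom (of_int (\<phi> a m0)) a :: complex poly)"
      by (intro poly_eqI) (simp add: coeff_map_poly coeff_P coeff_sum)
    thus ?thesis by (simp add: poly_sum poly_monom)
  qed
  show thesis
  proof (rule that[of P "Suc s + (A + 1) ^ (s - 2)"])
    show "P \<noteq> 0" using m0(1) coeff_P by (auto simp: good_def poly_eq_iff)
    fix R I B p and z :: "nat \<Rightarrow> complex"
    assume rf: "residue_field R I B p"
    interpret residue_field R I B p by fact
    assume a: "Suc s + (A + 1) ^ (s - 2) \<le> p" "\<And>i. i \<in> {1..s} \<Longrightarrow> \<not> int p dvd c i"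
       "\<And>i. i \<in> {1..s} \<Longrightarrow> z i \<in> R" "z 1 = 0" "z 2 = 1"
       "\<And>i j. i \<in> {1..s} \<Longrightarrow> j \<in> {1..s} \<Longrightarrow> i \<noteq> j \<Longrightarrow> z i - z j \<notin> I"
       "\<And>j. 1 \<le> j \<Longrightarrow> j \<le> s - 2 \<Longrightarrow> moment s c j z \<in> I"
    show "poly (map_poly of_int P) (moment s c (s - 1) z) \<in> I"
      unfolding poly_P
    proof (rule eliminant_vanishes[OF assms rel])
      show "digit_sum (s - 2) (A + 1) m0 \<le> digit_sum (s - 2) (A + 1) m"
        if "a \<le> A" "m < (A + 1) ^ (s - 2)" "\<phi> a m \<noteq> 0" for a m
        using m0(2)[of m] that by (auto simp: good_def)
      show "m0 < (A + 1) ^ (s - 2)" using m0(1) by (simp add: good_def)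
    qed (use a in \<open>auto simp: equiv_mod_def\<close>)
  qed
qed

section \<open>Existence of residue fields\<close>

text \<open>Generation by \<open>B\<close> is meant for the additive group. This bounds the residue
  degrees and keeps \<open>1 / p\<close> out of the ring.\<close>

definition finite_subring :: "complex set \<Rightarrow> complex set \<Rightarrow> bool" where
  "finite_subring R B \<longleftrightarrow>
     1 \<in> R \<and> (\<forall>x\<in>R. \<forall>y\<in>R. x - y \<in> R \<and> x * y \<in> R) \<and> finite B \<and> R = int_module.span B"

lemma finite_subring_int: "finite_subring (int_module.span {1}) {1}"
proof -
  have "int_module.span {1} = range (of_int :: int \<Rightarrow> complex)"
    by (auto simp: int_module.span_singleton)
  moreover have "of_int a - of_int b \<in> range (of_int :: int \<Rightarrow> complex)"
    "of_int a * of_int b \<in> range (of_int :: int \<Rightarrow> complex)" for a b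
    by (metis of_int_diff rangeI, metis of_int_mult rangeI)
  moreover have "1 \<in> range (of_int :: int \<Rightarrow> complex)" by (metis of_int_1 rangeI)
  ultimately show ?thesis unfolding finite_subring_def by auto
qed

text \<open>A monic integer equation of degree \<open>D\<close> expresses \<open>\<rho> ^ D\<close>
  through lower powers, so the \<open>R\<close>-combinations of \<open>\<rho> ^ j\<close> with
  \<open>j < D\<close> already form a ring.\<close>

lemma finite_subring_adjoin:
  assumes R: "finite_subring R B" and "algebraic_int \<rho>"
  obtains R' B' where "finite_subring R' B'" "R \<subseteq> R'" "\<rho> \<in> R'"
proof -
  have one: "1 \<in> R" and diff: "\<And>x y. x \<in> R \<Longrightarrow> y \<in> R \<Longrightarrow> x - y \<in> R"
    and mult: "\<And>x y. x \<in> R \<Longrightarrow> y \<in> R \<Longrightarrow> x * y \<in> R" and finB: "finite B" and span: "R = int_module.span B"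
    using R by (auto simp: finite_subring_def)
  have zero: "0 \<in> R" using diff[OF one one] by simp
  have of_int: "of_int n \<in> R" for n
    using int_module.span_scale[of 1 B n] one span by simp
  obtain q :: "complex poly" where q: "lead_coeff q = 1" "\<And>i. poly.coeff q i \<in> \<int>" "poly q \<rho> = 0"
    using assms(2) by (auto simp: algebraic_int.simps)
  define D where "D = Polynomial.degree q"
  have qR: "poly.coeff q i \<in> R" for i using q(2)[of i] of_int by (auto elim: Ints_cases)
  have D: "D > 0"
  proof (rule ccontr)
    assume "\<not> D > 0"
    then obtain a where "q = [:a:]" using degree_eq_zeroE by (auto simp: D_def)
    thus False using q(1,3) by simp
  qed
  have \<rho>D: "\<rho> ^ D = - (\<Sum>j<D. poly.coeff q j * \<rho> ^ j)"
  proof -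
    have "0 = (\<Sum>j\<le>D. poly.coeff q j * \<rho> ^ j)" using q(3) by (simp add: poly_altdef D_def)
    also have "\<dots> = (\<Sum>j<D. poly.coeff q j * \<rho> ^ j) + \<rho> ^ D"
      using q(1) by (simp add: D_def lessThan_Suc_atMost[symmetric])
    finally show ?thesis by (simp add: eq_neg_iff_add_eq_0 add.commute)
  qed
  define R' where "R' = {\<Sum>j<D. r j * \<rho> ^ j | r. \<forall>j. r j \<in> R}"
  have R'I: "(\<Sum>j<D. r j * \<rho> ^ j) \<in> R'" if "\<And>j. r j \<in> R" for r
    using that by (auto simp: R'_def)
  have R'E: "\<exists>r. (\<forall>j. r j \<in> R) \<and> x = (\<Sum>j<D. r j * \<rho> ^ j)" if "x \<in> R'" for x
    using that by (auto simp: R'_def)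
  have diff': "x - y \<in> R'" if xy: "x \<in> R'" "y \<in> R'" for x y
  proof -
    obtain r t where r: "\<And>j. r j \<in> R" "x = (\<Sum>j<D. r j * \<rho> ^ j)" and t: "\<And>j. t j \<in> R" "y = (\<Sum>j<D. t j * \<rho> ^ j)"
      using R'E[OF xy(1)] R'E[OF xy(2)] by blast
    have "x - y = (\<Sum>j<D. (r j - t j) * \<rho> ^ j)"
      by (simp add: r(2) t(2) sum_subtractf left_diff_distrib)
    thus ?thesis using R'I[of "\<lambda>j. r j - t j"] diff r(1) t(1) by simp
  qed
  have RR': "x \<in> R'" if xR: "x \<in> R" for x
  proof -
    have "(\<Sum>j<D. (if j = 0 then x else 0) * \<rho> ^ j) \<in> R'" using xR zero by (intro R'I) auto
    also have "(\<Sum>j<D. (if j = 0 then x else 0) * \<rho> ^ j) = (\<Sum>j<D. if j = 0 then x else 0)"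
      by (intro sum.cong) auto
    also have "\<dots> = x" using D by simp
    finally show ?thesis .
  qed
  have zero': "0 \<in> R'" using RR'[OF zero] .
  have add': "x + y \<in> R'" if "x \<in> R'" "y \<in> R'" for x y
    using diff'[OF that(1) diff'[OF zero' that(2)]] by simp
  have sum': "sum f A \<in> R'" if "\<And>i. i \<in> A \<Longrightarrow> f i \<in> R'" for f and A :: "nat set"
    using that by (induction A rule: infinite_finite_induct) (auto intro: zero' add')
  have smult': "a * x \<in> R'" if ax: "a \<in> R" "x \<in> R'" for a x
  proof -
    obtain r where r: "\<And>j. r j \<in> R" "x = (\<Sum>j<D. r j * \<rho> ^ j)" using R'E[OF ax(2)] by blast
    have "a * x = (\<Sum>j<D. (a * r j) * \<rho> ^ j)" by (simp add: r(2) sum_distrib_left mult.assoc)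
    thus ?thesis using R'I[of "\<lambda>j. a * r j"] mult[OF ax(1)] r(1) by simp
  qed
  have \<rho>_pow_D: "\<rho> ^ D \<in> R'"
  proof -
    have "0 - (\<Sum>j<D. poly.coeff q j * \<rho> ^ j) \<in> R'" using qR by (intro diff'[OF zero'] R'I)
    thus ?thesis by (simp add: \<rho>D)
  qed
  have \<rho>_pow_less: "\<rho> ^ j \<in> R'" if j: "j < D" for j
  proof -
    have "(\<Sum>i<D. (if i = j then 1 else 0) * \<rho> ^ i) \<in> R'" using one zero by (intro R'I) auto
    also have "(\<Sum>i<D. (if i = j then 1 else 0) * \<rho> ^ i) = (\<Sum>i<D. if i = j then \<rho> ^ i else 0)"
      by (intro sum.cong) auto
    also have "\<dots> = \<rho> ^ j" using j by simp
    finally show ?thesis .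
  qed
  have \<rho>_mult: "\<rho> * x \<in> R'" if x: "x \<in> R'" for x
  proof -
    obtain r where r: "\<And>j. r j \<in> R" "x = (\<Sum>j<D. r j * \<rho> ^ j)" using R'E[OF x] by blast
    have "\<rho> * x = (\<Sum>j<D. r j * \<rho> ^ Suc j)" by (simp add: r(2) sum_distrib_left mult_ac)
    also have "\<dots> \<in> R'"
    proof (rule sum')
      fix j assume "j \<in> {..<D}"
      hence "\<rho> ^ Suc j \<in> R'" using \<rho>_pow_D \<rho>_pow_less[of "Suc j"] by (cases "Suc j = D") auto
      thus "r j * \<rho> ^ Suc j \<in> R'" by (rule smult'[OF r(1)])
    qed
    finally show ?thesis .
  qed
  have \<rho>_pow_mult: "\<rho> ^ j * x \<in> R'" if "x \<in> R'" for x j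
    by (induction j) (auto simp: mult.assoc intro: that \<rho>_mult)
  have mult': "x * y \<in> R'" if xy: "x \<in> R'" "y \<in> R'" for x y
  proof -
    obtain r where r: "\<And>j. r j \<in> R" "x = (\<Sum>j<D. r j * \<rho> ^ j)" using R'E[OF xy(1)] by blast
    have "x * y = (\<Sum>j<D. r j * (\<rho> ^ j * y))" by (simp add: r(2) sum_distrib_right mult.assoc)
    also have "\<dots> \<in> R'" by (intro sum' smult' r(1) \<rho>_pow_mult xy(2))
    finally show ?thesis .
  qed
  define B' where "B' = (\<lambda>(b, j). b * \<rho> ^ j) ` (B \<times> {..<D})"
  have "R' = int_module.span B'"
  proof
    show "R' \<subseteq> int_module.span B'"
    proof
      fix x assume "x \<in> R'"
      then obtain r where r: "\<And>j. r j \<in> R" "x = (\<Sum>j<D. r j * \<rho> ^ j)" using R'E by blast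
      have "r j * \<rho> ^ j \<in> int_module.span B'" if j: "j < D" for j
      proof -
        obtain n where n: "r j = (\<Sum>b\<in>B. of_int (n b) * b)"
          using r(1)[of j] unfolding span int_module.span_finite[OF finB] by auto
        have "r j * \<rho> ^ j = (\<Sum>b\<in>B. of_int (n b) * (b * \<rho> ^ j))"
          by (simp add: n sum_distrib_right mult.assoc)
        also have "\<dots> \<in> int_module.span B'"
        proof (intro int_module.span_sum int_module.span_scale int_module.span_base)
          fix b assume "b \<in> B"
          thus "b * \<rho> ^ j \<in> B'" using j by (auto simp: B'_def)
        qed
        finally show ?thesis .
      qed
      thus "x \<in> int_module.span B'" unfolding r(2) by (intro int_module.span_sum) auto
    qed
    have "B \<subseteq> R" unfolding span by (rule int_module.span_superset)
    hence "B' \<subseteq> R'" unfolding B'_def using smult' \<rho>_pow_less by auto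
    moreover have "int_module.subspace R'"
      by (intro int_module.subspaceI zero' add' smult' of_int)
    ultimately show "int_module.span B' \<subseteq> R'" by (rule int_module.span_minimal)
  qed
  moreover have "finite B'" unfolding B'_def using finB by simp
  ultimately have "finite_subring R' B'"
    unfolding finite_subring_def using RR'[OF one] diff' mult' by blast
  moreover have "\<rho> \<in> R'" using \<rho>_mult[OF RR'[OF one]] by simp
  ultimately show thesis using that RR' by blast
qed

lemma ex_finite_subring:
  assumes "finite Z" "\<And>z. z \<in> Z \<Longrightarrow> algebraic_int z"
  shows "\<exists>R B. finite_subring R B \<and> Z \<subseteq> R"
  using assms
proof (induction Z rule: finite_induct)
  case empty
  show ?case using finite_subring_int by blast
next
  case (insert z Z)
  then obtain R B where RB: "finite_subring R B" "Z \<subseteq> R" by auto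
  obtain R' B' where "finite_subring R' B'" "R \<subseteq> R'" "z \<in> R'"
    using finite_subring_adjoin[OF RB(1)] insert.prems by blast
  thus ?case using RB(2) by blast
qed

text \<open>Induction over generators. If no nonzero multiple of \<open>b\<close> is rational modulo
  the span of \<open>B\<close>, then \<open>b\<close> cannot occur in a rational element. Otherwise
  one such rational \<open>x\<close> serves to eliminate \<open>b\<close>.\<close>

lemma bounded_denominators:
  assumes "finite B"
  shows "\<exists>N>0. \<forall>x\<in>int_module.span B \<inter> \<rat>. of_int N * x \<in> \<int>"
  using assms
proof (induction B rule: finite_induct)
  case empty
  show ?case by (intro exI[of _ 1]) auto
next
  case (insert b B)
  then obtain N where N: "N > 0" "\<And>x. x \<in> int_module.span B \<Longrightarrow> x \<in> \<rat> \<Longrightarrow> of_int N * x \<in> \<int>" by auto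
  show ?case
  proof (cases "\<exists>n x. n \<noteq> 0 \<and> x \<in> \<rat> \<and> x - of_int n * b \<in> int_module.span B")
    case False
    have "of_int N * x \<in> \<int>" if x: "x \<in> int_module.span (insert b B)" "x \<in> \<rat>" for x
    proof -
      obtain n where n: "x - of_int n * b \<in> int_module.span B"
        using x(1) unfolding int_module.span_insert by blast
      hence "n = 0" using False x(2) by blast
      thus ?thesis using n N(2) x(2) by simp
    qed
    thus ?thesis using N(1) by blast
  next
    case True
    then obtain n x where nx: "n \<noteq> 0" "x \<in> \<rat>" "x - of_int n * b \<in> int_module.span B" by blast
    obtain u v :: int where uv: "v > 0" "x = of_int u / of_int v"
      using nx(2) by (auto elim: Rats_cases')
    \<comment> \<open>The factor \<open>v\<close> clears the denominator of \<open>x\<close>, and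
      \<open>n\<close> comes from cancelling \<open>b\<close> by cross-multiplication.\<close>
    have "of_int (N * v * \<bar>n\<bar>) * y \<in> \<int>" if y: "y \<in> int_module.span (insert b B)" "y \<in> \<rat>" for y
    proof -
      obtain m where m: "y - of_int m * b \<in> int_module.span B"
        using y(1) unfolding int_module.span_insert by blast
      have "of_int n * (y - of_int m * b) - of_int m * (x - of_int n * b) \<in> int_module.span B"
        by (rule int_module.span_diff[OF int_module.span_scale[OF m] int_module.span_scale[OF nx(3)]])
      also have "of_int n * (y - of_int m * b) - of_int m * (x - of_int n * b) = of_int n * y - of_int m * x"
        by (simp add: algebra_simps)
      finally have "of_int N * (of_int n * y - of_int m * x) \<in> \<int>"
        using N(2) y(2) nx(2) by auto
      hence "of_int v * (of_int N * (of_int n * y - of_int m * x)) + of_int (N * m * u) \<in> \<int>"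
        by (rule Ints_add[OF Ints_mult[OF Ints_of_int] Ints_of_int])
      also have "of_int v * (of_int N * (of_int n * y - of_int m * x)) + of_int (N * m * u) = of_int (N * v * n) * y"
      proof -
        have "of_int v * x = of_int u" using uv by simp
        moreover have "of_int v * (of_int N * (of_int n * y - of_int m * x))
            = of_int (N * v * n) * y - of_int (N * m) * (of_int v * x)"
          by (simp add: algebra_simps)
        ultimately show ?thesis by simp
      qed
      finally have "of_int (sgn n) * (of_int (N * v * n) * y) \<in> \<int>" by (rule Ints_mult[OF Ints_of_int])
      thus ?thesis by (simp add: abs_sgn mult_ac)
    qed
    moreover have "N * v * \<bar>n\<bar> > 0" using N(1) uv(1) nx(1) by simp
    ultimately show ?thesis by blast
  qed
qed

text \<open>With \<open>1 / p\<close> the ring would contain all its powers, whose denominators are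
  unbounded.\<close>

lemma finite_subring_inverse_prime:
  assumes R: "finite_subring R B" and "prime (p::nat)"
  shows "1 / of_nat p \<notin> R"
proof
  assume p: "1 / of_nat p \<in> R"
  have span: "R = int_module.span B" and "finite B" using R by (auto simp: finite_subring_def)
  obtain N where N: "N > 0" "\<And>x. x \<in> R \<Longrightarrow> x \<in> \<rat> \<Longrightarrow> of_int N * x \<in> \<int>"
    using bounded_denominators[OF \<open>finite B\<close>] span by blast
  have "(1 / of_nat p) ^ k \<in> R" for k
  proof (induction k)
    case (Suc k)
    have "1 / of_nat p * (1 / of_nat p) ^ k \<in> R"
      using R p Suc unfolding finite_subring_def by blast
    thus ?case by (simp only: power_Suc)
  next
    case 0
    show ?case using R unfolding finite_subring_def power_0 by blast
  qed
  \<comment> \<open>The exponent \<open>N\<close> is large enough: \<open>p ^ N\<close> would divide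
    the positive number \<open>N\<close>, although \<open>N < p ^ N\<close>.\<close>
  hence "of_int N * (1 / of_nat p) ^ nat N \<in> (\<int> :: complex set)"
    by (intro N(2)) (auto intro!: Rats_power)
  then obtain m where "of_int N * (1 / of_nat p) ^ nat N = (of_int m :: complex)" by (auto elim: Ints_cases)
  hence "(of_int N :: complex) = of_int m * of_nat p ^ nat N"
    using prime_gt_0_nat[OF assms(2)] by (simp add: field_simps)
  hence "(of_int N :: complex) = of_int (m * int p ^ nat N)" by simp
  hence eq: "N = m * int p ^ nat N" by (simp only: of_int_eq_iff)
  have "int p ^ nat N dvd N" using eq by (metis dvd_triv_right)
  hence "int p ^ nat N \<le> N" using N(1) by (rule zdvd_imp_le)
  moreover have "nat N < p ^ nat N"
    using prime_ge_2_nat[OF assms(2)] by (meson less_le_trans less_exp power_mono zero_le)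
  hence "int (nat N) < int (p ^ nat N)" by (simp only: of_nat_less_iff)
  ultimately show False using N(1) by simp
qed

text \<open>Zorn's lemma yields a maximal proper ideal containing \<open>p\<close>. The starting
  ideal \<open>p R\<close> is proper because \<open>1 / p\<close> is not in
  \<open>R\<close>.\<close>

lemma ex_residue_field:
  assumes R: "finite_subring R B" and p: "prime (p::nat)"
  obtains I where "residue_field R I B p"
proof -
  have one: "1 \<in> R" and diff: "\<And>x y. x \<in> R \<Longrightarrow> y \<in> R \<Longrightarrow> x - y \<in> R"
    and mult: "\<And>x y. x \<in> R \<Longrightarrow> y \<in> R \<Longrightarrow> x * y \<in> R" and finB: "finite B" and span: "R = int_module.span B"
    using R by (auto simp: finite_subring_def)
  have zero: "0 \<in> R" using diff[OF one one] by simp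
  have add: "x + y \<in> R" if "x \<in> R" "y \<in> R" for x y using diff[OF that(1) diff[OF zero that(2)]] by simp
  have p0: "(of_nat p :: complex) \<noteq> 0" using prime_gt_0_nat[OF p] by simp
  define \<A> where "\<A> = {J. J \<subseteq> R \<and> (\<forall>x\<in>J. \<forall>y\<in>J. x - y \<in> J) \<and> (\<forall>r\<in>R. \<forall>x\<in>J. r * x \<in> J) \<and>
    1 \<notin> J \<and> (of_nat p :: complex) \<in> J}"
  have pR: "of_nat p \<in> R" using int_module.span_scale[of 1 B "int p"] one span by simp
  have "(\<lambda>x. of_nat p * x) ` R \<in> \<A>"
    unfolding \<A>_def
  proof (intro CollectI conjI)
    show "(\<lambda>x. of_nat p * x) ` R \<subseteq> R" using mult[OF pR] by auto
    show "\<forall>x\<in>(\<lambda>x. of_nat p * x) ` R. \<forall>y\<in>(\<lambda>x. of_nat p * x) ` R. x - y \<in> (\<lambda>x. of_nat p * x) ` R"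
      using diff by (auto simp: right_diff_distrib[symmetric])
    show "\<forall>r\<in>R. \<forall>x\<in>(\<lambda>x. of_nat p * x) ` R. r * x \<in> (\<lambda>x. of_nat p * x) ` R"
      using mult by (auto simp: mult.left_commute)
    show "of_nat p \<in> (\<lambda>x. of_nat p * x) ` R" using one by force
    show "1 \<notin> (\<lambda>x. of_nat p * x) ` R"
    proof
      assume "1 \<in> (\<lambda>x. of_nat p * x) ` R"
      then obtain x where "x \<in> R" "1 = of_nat p * x" by blast
      moreover from this have "x = 1 / of_nat p" using p0 by (simp add: field_simps)
      ultimately show False using finite_subring_inverse_prime[OF R p] by simp
    qed
  qed
  hence ne: "\<A> \<noteq> {}" by blast
  have "\<exists>M\<in>\<A>. \<forall>X\<in>\<A>. M \<subseteq> X \<longrightarrow> X = M"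
  proof (rule subset_Zorn_nonempty[OF ne])
    fix \<C> assume C: "\<C> \<noteq> {}" "subset.chain \<A> \<C>"
    have CA: "\<C> \<subseteq> \<A>" and lin: "\<And>X Y. X \<in> \<C> \<Longrightarrow> Y \<in> \<C> \<Longrightarrow> X \<subseteq> Y \<or> Y \<subseteq> X"
      using C(2) by (auto simp: subset_chain_def)
    show "\<Union>\<C> \<in> \<A>"
      unfolding \<A>_def
    proof (intro CollectI conjI ballI)
      show "\<Union>\<C> \<subseteq> R" using CA by (auto simp: \<A>_def)
      show "1 \<notin> \<Union>\<C>" using CA by (auto simp: \<A>_def)
      show "of_nat p \<in> \<Union>\<C>" using CA C(1) by (fastforce simp: \<A>_def)
      show "r * x \<in> \<Union>\<C>" if "r \<in> R" "x \<in> \<Union>\<C>" for r x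
        using that CA by (fastforce simp: \<A>_def)
      fix x y assume "x \<in> \<Union>\<C>" "y \<in> \<Union>\<C>"
      then obtain X Y where XY: "X \<in> \<C>" "x \<in> X" "Y \<in> \<C>" "y \<in> Y" by blast
      obtain Z where "Z \<in> \<C>" "x \<in> Z" "y \<in> Z" using lin[OF XY(1,3)] XY by blast
      moreover from this have "x - y \<in> Z" using CA by (auto simp: \<A>_def)
      ultimately show "x - y \<in> \<Union>\<C>" by blast
    qed
  qed
  then obtain I where I: "I \<in> \<A>" and max: "\<And>X. X \<in> \<A> \<Longrightarrow> I \<subseteq> X \<Longrightarrow> X = I" by blast
  have IR: "I \<subseteq> R" and Idiff: "\<And>x y. x \<in> I \<Longrightarrow> y \<in> I \<Longrightarrow> x - y \<in> I"
    and Imult: "\<And>r x. r \<in> R \<Longrightarrow> x \<in> I \<Longrightarrow> r * x \<in> I" and I1: "1 \<notin> I" and Ip: "of_nat p \<in> I"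
    using I by (auto simp: \<A>_def)
  have I0: "0 \<in> I" using Idiff[OF Ip Ip] by simp
  have inv: "\<exists>y\<in>R. x * y - 1 \<in> I" if x: "x \<in> R" "x \<notin> I" for x
  proof -
    \<comment> \<open>The ideal generated by \<open>I\<close> and \<open>x\<close> is strictly
      larger than \<open>I\<close>, so by maximality it contains 1, which exhibits the inverse of
      \<open>x\<close>.\<close>
    define J where "J = {i + r * x | i r. i \<in> I \<and> r \<in> R}"
    have JI: "i + r * x \<in> J" if "i \<in> I" "r \<in> R" for i r using that by (auto simp: J_def)
    have "I \<subseteq> J" using JI[OF _ zero] by auto
    have "x \<in> J" using JI[OF I0 one] by simp
    hence "J \<notin> \<A>" using max[OF _ \<open>I \<subseteq> J\<close>] x(2) by blast
    moreover have "J \<subseteq> R" using IR x(1) by (auto simp: J_def intro!: add mult)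
    moreover have "a - b \<in> J" if "a \<in> J" "b \<in> J" for a b
    proof -
      obtain i r i' r' where e: "a = i + r * x" "i \<in> I" "r \<in> R" "b = i' + r' * x" "i' \<in> I" "r' \<in> R"
        using \<open>a \<in> J\<close> \<open>b \<in> J\<close> by (auto simp: J_def)
      have "a - b = (i - i') + (r - r') * x" using e by (simp add: algebra_simps)
      thus ?thesis using JI[OF Idiff[OF e(2,5)] diff[OF e(3,6)]] by simp
    qed
    moreover have "t * a \<in> J" if ta: "t \<in> R" "a \<in> J" for t a
    proof -
      obtain i r where e: "a = i + r * x" "i \<in> I" "r \<in> R" using ta(2) by (auto simp: J_def)
      have "t * a = t * i + (t * r) * x" using e by (simp add: algebra_simps)
      thus ?thesis using JI[OF Imult[OF ta(1) e(2)] mult[OF ta(1) e(3)]] by simp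
    qed
    moreover have "of_nat p \<in> J" using Ip \<open>I \<subseteq> J\<close> by blast
    ultimately have "1 \<in> J" unfolding \<A>_def by blast
    then obtain i r where e: "1 = i + r * x" "i \<in> I" "r \<in> R" by (auto simp: J_def)
    have "x * r - 1 = 0 - i" using e(1) by (simp add: algebra_simps)
    hence "x * r - 1 \<in> I" using Idiff[OF I0 e(2)] by simp
    thus ?thesis using e(3) by (rule bexI)
  qed
  have "residue_field R I B p"
    by unfold_locales (fact one diff mult finB span IR Idiff Imult I1 inv p Ip)+
  thus thesis by (rule that)
qed

section \<open>Power residues\<close>

lemma mod_eq_1_if_prime_factors:
  fixes N q :: nat
  assumes "q \<ge> 2" "N > 0" "\<And>p. prime p \<Longrightarrow> p dvd N \<Longrightarrow> p mod q = 1"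
  shows "N mod q = 1"
  using assms
proof (induction N rule: less_induct)
  case (less N)
  show ?case
  proof (cases "N = 1")
    case True
    thus ?thesis using assms(1) by simp
  next
    case False
    then obtain p where p: "prime p" "p dvd N" using prime_factor_nat by blast
    then obtain m where m: "N = p * m" by blast
    have "m < N" using m less.prems(2) prime_gt_1_nat[OF p(1)] by simp
    moreover have "m > 0" using m less.prems(2) by simp
    ultimately have "m mod q = 1" using less.IH[of m] less.prems(1,3) m by simp
    moreover have "p mod q = 1" using less.prems(3) p by blast
    ultimately have "(p * m) mod q = 1 * 1 mod q" by (metis mod_mult_eq)
    thus ?thesis using m assms(1) by simp
  qed
qed

text \<open>Euclid's argument with \<open>N = q * fact n - 1\<close>: all prime factors of
  \<open>N\<close> exceed \<open>n\<close>. If they were all 1 modulo \<open>q\<close>, so would be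
  \<open>N\<close>, which is -1 modulo \<open>q\<close>; then \<open>q\<close> would divide
  2.\<close>

lemma ex_large_prime_mod_neq_1:
  fixes q n :: nat
  assumes "q \<ge> 3"
  shows "\<exists>p>n. prime p \<and> p mod q \<noteq> 1"
proof (rule ccontr)
  assume "\<not> ?thesis"
  hence all: "p mod q = 1" if "p > n" "prime p" for p using that by blast
  define N where "N = q * fact n - 1"
  have qf: "q * fact n \<ge> 3" using assms fact_ge_1[of n] by (metis le_trans mult.commute mult_le_mono1 mult_1)
  hence N0: "N > 0" by (simp add: N_def)
  have "N mod q = 1"
  proof (rule mod_eq_1_if_prime_factors[OF _ N0])
    fix p assume p: "prime p" "p dvd N"
    have "p > n"
    proof (rule ccontr)
      assume "\<not> p > n"
      hence "p dvd fact n" using p(1) by (simp add: prime_dvd_fact_iff)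
      hence "p dvd q * fact n" by simp
      moreover have "q * fact n = N + 1" using qf by (simp add: N_def)
      ultimately have "p dvd 1" using p(2) by (metis dvd_add_right_iff)
      thus False using p(1) by simp
    qed
    thus "p mod q = 1" using all p(1) by blast
  qed (use assms in simp)
  moreover have "N + 1 = q * fact n" using qf by (simp add: N_def)
  hence "(N + 1) mod q = 0" by simp
  ultimately have "Suc 1 mod q = 0" by (metis Suc_eq_plus1 mod_Suc_eq)
  thus False using assms by simp
qed

text \<open>Here \<open>l\<close> is prime to \<open>p - 1\<close>, so it has an inverse
  \<open>u\<close> modulo \<open>p - 1\<close>, and \<open>a ^ u\<close> is an \<open>l\<close>-th
  root of \<open>a\<close> by Fermat.\<close>

lemma odd_power_residue_nat:
  fixes p l a :: nat
  assumes "prime p" "prime l" "p mod l \<noteq> 1" "\<not> p dvd a"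
  shows "\<exists>w. [w ^ l = a] (mod p)"
proof -
  have "\<not> l dvd p - 1"
  proof
    assume "l dvd p - 1"
    then obtain k where "p - 1 = l * k" by blast
    hence "p = 1 + l * k" using prime_gt_1_nat[OF assms(1)] by simp
    hence "p mod l = 1 mod l" by (simp only: mod_mult_self2)
    thus False using assms(3) prime_gt_1_nat[OF assms(2)] by simp
  qed
  hence "coprime l (p - 1)" using assms(2) by (simp add: prime_imp_coprime)
  then obtain u where u: "[l * u = 1] (mod (p - 1))" using cong_solve_coprime_nat by auto
  show ?thesis
  proof (cases "p = 2")
    case True
    have "[1 ^ l = a] (mod 2)" using assms(4) True by (simp add: cong_def odd_iff_mod_2_eq_one)
    thus ?thesis using True by blast
  next
    case False
    hence p3: "p - 1 \<ge> 2" using prime_ge_2_nat[OF assms(1)] by simp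
    have "l * u mod (p - 1) = 1" using u p3 by (simp add: cong_def)
    hence lu: "l * u = (p - 1) * (l * u div (p - 1)) + 1" by (metis mult_div_mod_eq)
    have "[a ^ (p - 1) = 1] (mod p)" by (rule fermat_theorem[OF assms(1,4)])
    hence "[(a ^ (p - 1)) ^ (l * u div (p - 1)) * a = 1 ^ (l * u div (p - 1)) * a] (mod p)"
      by (intro cong_mult cong_pow cong_refl)
    hence "[a ^ ((p - 1) * (l * u div (p - 1)) + 1) = a] (mod p)"
      by (simp add: power_mult power_add mult.commute)
    hence "[a ^ (l * u) = a] (mod p)" unfolding lu[symmetric] .
    hence "[(a ^ u) ^ l = a] (mod p)" by (simp only: power_mult[symmetric] mult.commute)
    thus ?thesis by blast
  qed
qed

text \<open>Write \<open>p = 4 * k + 3\<close>. By Fermat \<open>a ^ (2 * k + 1)\<close> is 1 or -1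
  modulo \<open>p\<close>; multiplying by \<open>a\<close> makes the square of
  \<open>a ^ (k + 1)\<close> congruent to \<open>a\<close> or \<open>- a\<close>.\<close>

lemma square_or_minus_square_nat:
  fixes p a :: nat
  assumes "prime p" "p mod 4 = 3" "\<not> p dvd a"
  shows "\<exists>w::int. [w ^ 2 = int a] (mod int p) \<or> [w ^ 2 = - int a] (mod int p)"
proof -
  define k where "k = p div 4"
  have pk: "p = 4 * k + 3" using assms(2) by (simp add: k_def) (metis mult_div_mod_eq)
  have "[a ^ (p - 1) = 1] (mod p)" by (rule fermat_theorem[OF assms(1,3)])
  moreover have "p - 1 = 4 * k + 2" using pk by simp
  ultimately have "[int (a ^ (4 * k + 2)) = int 1] (mod int p)" by (simp only: cong_int_iff)
  hence "int p dvd int a ^ (4 * k + 2) - 1" by (simp add: cong_iff_dvd_diff)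
  moreover have "int a ^ (4 * k + 2) = int a ^ (2 * k + 1) * int a ^ (2 * k + 1)"
  proof -
    have e: "4 * k + 2 = (2 * k + 1) + (2 * k + 1)" by simp
    show ?thesis unfolding e by (rule power_add)
  qed
  ultimately have "int p dvd int a ^ (2 * k + 1) * int a ^ (2 * k + 1) - 1" by (simp only:)
  also have "int a ^ (2 * k + 1) * int a ^ (2 * k + 1) - 1 = (int a ^ (2 * k + 1) - 1) * (int a ^ (2 * k + 1) + 1)"
    by (simp only: square_diff_one_factored mult.commute)
  finally have "int p dvd int a ^ (2 * k + 1) - 1 \<or> int p dvd int a ^ (2 * k + 1) + 1"
    using assms(1) by (simp add: prime_dvd_mult_iff)
  moreover have sq: "(int a ^ (k + 1)) ^ 2 = int a * int a ^ (2 * k + 1)"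
  proof -
    have e: "(k + 1) * 2 = Suc (2 * k + 1)" by simp
    show ?thesis unfolding power_mult[symmetric] e by (rule power_Suc)
  qed
  moreover have "int a * int a ^ (2 * k + 1) - int a = int a * (int a ^ (2 * k + 1) - 1)"
    "int a * int a ^ (2 * k + 1) - (- int a) = int a * (int a ^ (2 * k + 1) + 1)"
    by (simp_all add: algebra_simps)
  ultimately have "int p dvd (int a ^ (k + 1)) ^ 2 - int a \<or> int p dvd (int a ^ (k + 1)) ^ 2 - (- int a)"
    by (auto intro: dvd_mult)
  thus ?thesis unfolding cong_iff_dvd_diff by blast
qed

context residue_field
begin

lemma of_int_cong: "[a = b] (mod int p) \<Longrightarrow> of_int a \<doteq> of_int b"
  using of_int_I_iff[of "a - b"] by (simp add: cong_iff_dvd_diff equiv_mod_def)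

text \<open>For odd \<open>l\<close> a root exists already modulo \<open>p\<close>. For
  \<open>l = 2\<close> an integer is a square modulo \<open>p\<close> only up to sign, and
  \<open>\<i>\<close> in \<open>R\<close> turns -1 into a square.\<close>

lemma int_is_power:
  assumes "prime l" "l = 2 \<Longrightarrow> \<i> \<in> R \<and> p mod 4 = 3" "l \<noteq> 2 \<Longrightarrow> p mod l \<noteq> 1" "\<not> int p dvd v"
  shows "\<exists>w\<in>R. of_int v \<doteq> w ^ l"
proof -
  define a where "a = nat (v mod int p)"
  have p0: "int p > 0" using prime_gt_0_nat[OF prime_p] by simp
  have ia: "int a = v mod int p" using p0 by (simp add: a_def)
  hence av: "[int a = v] (mod int p)" by (simp add: cong_def)
  have "\<not> int p dvd int a" using assms(4) by (simp add: ia dvd_eq_mod_eq_0)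
  hence pa: "\<not> p dvd a" by simp
  show ?thesis
  proof (cases "l = 2")
    case False
    obtain w where "[w ^ l = a] (mod p)"
      using odd_power_residue_nat[OF prime_p assms(1) assms(3)[OF False] pa] by blast
    hence "[int (w ^ l) = int a] (mod int p)" by (simp only: cong_int_iff)
    hence "[v = int (w ^ l)] (mod int p)" using av by (meson cong_sym cong_trans)
    from of_int_cong[OF this] have "of_int v \<doteq> (of_nat w :: complex) ^ l" by simp
    thus ?thesis using of_nat_R by blast
  next
    case True
    obtain w :: int where w: "[w ^ 2 = int a] (mod int p) \<or> [w ^ 2 = - int a] (mod int p)"
      using square_or_minus_square_nat[OF prime_p _ pa] assms(2)[OF True] by blast
    show ?thesis
    proof (cases "[w ^ 2 = int a] (mod int p)")
      case 1: True
      hence "[v = w ^ 2] (mod int p)" using av by (meson cong_sym cong_trans)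
      from of_int_cong[OF this] have "of_int v \<doteq> (of_int w :: complex) ^ l" using True by simp
      thus ?thesis using of_int_R by blast
    next
      case 2: False
      hence "[w ^ 2 = - int a] (mod int p)" using w by blast
      hence "[- (w ^ 2) = int a] (mod int p)" using cong_minus_minus_iff by fastforce
      hence "[v = - (w ^ 2)] (mod int p)" using av by (meson cong_sym cong_trans)
      from of_int_cong[OF this] have "of_int v \<doteq> (\<i> * of_int w :: complex) ^ l"
        using True by (simp add: power_mult_distrib)
      moreover have "\<i> * of_int w \<in> R" using assms(2)[OF True] by (intro mult_R of_int_R) blast
      ultimately show ?thesis by blast
    qed
  qed
qed

text \<open>Since \<open>P\<close> splits over the complex numbers, \<open>\<mu>\<close> ought to be
  congruent to one of its roots. These need not lie in \<open>R\<close>, so everything is scaled by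
  \<open>q ^ l\<close>, itself an \<open>l\<close>-th power, after which each scaled root is the
  \<open>l\<close>-th power of an element of \<open>R\<close>.\<close>

lemma root_is_power:
  fixes P :: "int poly"
  defines "q \<equiv> lead_coeff P"
  assumes "P \<noteq> 0" "l > 0" "\<not> int p dvd q"
    and roots: "\<And>\<rho> \<tau>. poly (map_poly of_int P) \<tau> = 0 \<Longrightarrow> \<rho> ^ l = of_int q ^ l * \<tau> \<Longrightarrow> \<rho> \<in> R"
    and \<mu>: "\<mu> \<in> R" "poly (map_poly of_int P) \<mu> \<in> I"
  shows "\<exists>\<rho>\<in>R. of_int q ^ l * \<mu> \<doteq> \<rho> ^ l"
proof -
  define PC where "PC = (map_poly of_int P :: complex poly)"
  have "PC \<noteq> 0" using assms(2) by (simp add: PC_def map_poly_eq_0_iff)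
  have lc: "lead_coeff PC = of_int q" by (simp add: PC_def q_def degree_map_poly coeff_map_poly)
  obtain A where A: "PC = Polynomial.smult (lead_coeff PC) (\<Prod>x\<in>#A. [:-x, 1:])"
    using alg_closed_imp_factorization[OF \<open>PC \<noteq> 0\<close>] by blast
  have PCx: "poly PC x = of_int q * (\<Prod>\<tau>\<in>#A. x - \<tau>)" for x
  proof -
    have "poly (\<Prod>x\<in>#A. [:-x, 1:]) y = (\<Prod>\<tau>\<in>#A. y - \<tau>)" for y
      by (induction A) (auto simp: algebra_simps)
    thus ?thesis by (subst A) (simp add: lc)
  qed
  have "\<exists>r. \<forall>\<tau>\<in>#A. r \<tau> ^ l = of_int q ^ l * \<tau> \<and> r \<tau> \<in> R"
  proof (rule bchoice, rule ballI)
    fix \<tau> assume \<tau>: "\<tau> \<in># A"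
    obtain \<rho> where \<rho>: "\<rho> ^ l = of_int q ^ l * \<tau>" using nth_root_exists[OF assms(3)] by metis
    have "poly PC \<tau> = 0" using \<tau> by (auto simp: PCx prod_mset_zero_iff)
    hence "\<rho> \<in> R" using roots \<rho> by (simp add: PC_def)
    thus "\<exists>\<rho>. \<rho> ^ l = of_int q ^ l * \<tau> \<and> \<rho> \<in> R" using \<rho> by blast
  qed
  then obtain r where r: "\<And>\<tau>. \<tau> \<in># A \<Longrightarrow> r \<tau> ^ l = of_int q ^ l * \<tau>" "\<And>\<tau>. \<tau> \<in># A \<Longrightarrow> r \<tau> \<in> R" by blast
  have fac: "of_int q ^ l * \<mu> - r \<tau> ^ l \<in> R" if "\<tau> \<in># A" for \<tau>
    using r(2)[OF that] \<mu>(1) by (intro diff_R mult_R power_R of_int_R)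
  \<comment> \<open>One factor \<open>q ^ l\<close> for each root brings every factor of the product
    into \<open>R\<close>, where primality of \<open>I\<close> applies.\<close>
  have "(of_int q ^ l) ^ size A * poly PC \<mu> \<in> I"
    using \<mu>(2) unfolding PC_def by (intro mult_I[OF power_R[OF power_R[OF of_int_R]]])
  also have "(of_int q ^ l) ^ size A * poly PC \<mu> = of_int q * (\<Prod>\<tau>\<in>#A. of_int q ^ l * \<mu> - r \<tau> ^ l)"
  proof -
    have "(\<Prod>\<tau>\<in>#A. of_int q ^ l * \<mu> - r \<tau> ^ l) = (\<Prod>\<tau>\<in>#A. of_int q ^ l * (\<mu> - \<tau>))"
      using r(1) by (intro arg_cong[where f = prod_mset] image_mset_cong) (simp add: right_diff_distrib)
    also have "\<dots> = (of_int q ^ l) ^ size A * (\<Prod>\<tau>\<in>#A. \<mu> - \<tau>)"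
      by (simp add: prod_mset.distrib)
    finally show ?thesis by (simp add: PCx)
  qed
  finally have prod: "of_int q * (\<Prod>\<tau>\<in>#A. of_int q ^ l * \<mu> - r \<tau> ^ l) \<in> I" .
  have prodR: "(\<Prod>\<tau>\<in>#M. of_int q ^ l * \<mu> - r \<tau> ^ l) \<in> R" if "M \<subseteq># A" for M
    using that by (induction M) (auto intro!: mult_R fac one_R dest: mset_subset_eq_insertD)
  have ex: "\<exists>\<tau>\<in>#M. of_int q ^ l * \<mu> - r \<tau> ^ l \<in> I"
    if "M \<subseteq># A" "(\<Prod>\<tau>\<in>#M. of_int q ^ l * \<mu> - r \<tau> ^ l) \<in> I" for M
    using that
  proof (induction M)
    case empty
    thus ?case using one_I by simp
  next
    case (add \<tau> M)
    have M: "M \<subseteq># A" "\<tau> \<in># A" using add.prems(1) by (auto dest: mset_subset_eq_insertD)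
    have "(of_int q ^ l * \<mu> - r \<tau> ^ l) * (\<Prod>\<tau>\<in>#M. of_int q ^ l * \<mu> - r \<tau> ^ l) \<in> I"
      using add.prems(2) by simp
    hence "of_int q ^ l * \<mu> - r \<tau> ^ l \<in> I \<or> (\<Prod>\<tau>\<in>#M. of_int q ^ l * \<mu> - r \<tau> ^ l) \<in> I"
      by (rule prime_I[OF fac[OF M(2)] prodR[OF M(1)]])
    thus ?case using add.IH[OF M(1)] by auto
  qed
  have "of_int q \<notin> I" using assms(4) by (simp add: of_int_I_iff)
  hence "(\<Prod>\<tau>\<in>#A. of_int q ^ l * \<mu> - r \<tau> ^ l) \<in> I"
    using prime_I[OF of_int_R prodR prod] by blast
  then obtain \<tau> where "\<tau> \<in># A" "of_int q ^ l * \<mu> - r \<tau> ^ l \<in> I" using ex[of A] by blast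
  thus ?thesis using r(2) unfolding equiv_mod_def by blast
qed

end

section \<open>Integrality of the elements to be adjoined\<close>

lemma algebraic_int_nth_root:
  assumes "algebraic_int (y :: complex)" "\<rho> ^ l = y" "l > 0"
  shows "algebraic_int \<rho>"
proof (rule algebraic_int_root[OF assms(1)])
  have deg: "Polynomial.degree (Polynomial.monom (1::complex) l) = l"
    by (rule Polynomial.degree_monom_eq) simp
  show "poly (Polynomial.monom 1 l) \<rho> = y" using assms(2) by (simp add: poly_monom)
  show "\<forall>i. poly.coeff (Polynomial.monom (1::complex) l) i \<in> \<int>" by simp
  show "lead_coeff (Polynomial.monom (1::complex) l) = 1" unfolding deg by simp
  show "0 < Polynomial.degree (Polynomial.monom (1::complex) l)" unfolding deg by (rule assms(3))
qed

text \<open>Multiplying the equation of \<open>\<tau>\<close> by \<open>q ^ (l * D - 1)\<close>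
  produces a monic integer equation for \<open>q ^ l * \<tau>\<close>.\<close>

lemma algebraic_int_scaled_root:
  fixes P :: "int poly" and \<tau> :: complex
  assumes "P \<noteq> 0" "poly (map_poly of_int P) \<tau> = 0" "l > 0"
  shows "algebraic_int (of_int (lead_coeff P) ^ l * \<tau>)"
proof -
  define D where "D = Polynomial.degree P"
  define q where "q = lead_coeff P"
  \<comment> \<open>For \<open>m < D\<close> the exponent of \<open>q\<close> is
    \<open>l * D - 1 - l * m\<close>; it is not negative because \<open>l > 0\<close>.\<close>
  define a where "a m = poly.coeff P m * q ^ (l * (D - m) - 1)" for m
  define pp where "pp = (\<Sum>m<D. Polynomial.monom (of_int (a m)) m) + Polynomial.monom (1::complex) D"
  have coeff: "poly.coeff pp m = (if m < D then of_int (a m) else if m = D then 1 else 0)" for m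
    by (auto simp: pp_def coeff_sum)
  have P0: "(\<Sum>m\<le>D. of_int (poly.coeff P m) * \<tau> ^ m) = 0"
    using assms(2) by (simp add: poly_altdef coeff_map_poly degree_map_poly D_def)
  have "D > 0"
  proof (rule ccontr)
    assume "\<not> D > 0"
    hence "lead_coeff P = 0" using P0 by (simp add: D_def)
    thus False using assms(1) by simp
  qed
  have ex: "l * (D - m) - 1 + l * m = l * D - 1" if "m < D" for m
  proof -
    have "D = m + Suc (D - m - 1)" using \<open>m < D\<close> by simp
    then obtain k where k: "D = m + Suc k" by blast
    show ?thesis using assms(3) unfolding k by (cases l) (auto simp: algebra_simps)
  qed
  have "poly pp (of_int q ^ l * \<tau>) = (\<Sum>m<D. of_int (a m) * (of_int q ^ l * \<tau>) ^ m) + (of_int q ^ l * \<tau>) ^ D"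
    by (simp add: pp_def poly_sum poly_monom)
  also have "(\<Sum>m<D. of_int (a m) * (of_int q ^ l * \<tau>) ^ m) = (\<Sum>m<D. of_int q ^ (l * D - 1) * (of_int (poly.coeff P m) * \<tau> ^ m))"
  proof (intro sum.cong refl)
    fix m assume "m \<in> {..<D}"
    hence "(of_int q :: complex) ^ (l * D - 1) = of_int q ^ (l * (D - m) - 1) * of_int q ^ (l * m)"
      using ex[of m] by (simp add: power_add[symmetric])
    thus "of_int (a m) * (of_int q ^ l * \<tau>) ^ m = of_int q ^ (l * D - 1) * (of_int (poly.coeff P m) * \<tau> ^ m)"
      by (simp add: a_def power_mult_distrib power_mult mult_ac)
  qed
  also have "(of_int q ^ l * \<tau>) ^ D = of_int q ^ (l * D - 1) * (of_int (poly.coeff P D) * \<tau> ^ D)"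
  proof -
    have "(of_int q :: complex) ^ (l * D) = of_int q ^ (l * D - 1) * of_int q"
      using \<open>D > 0\<close> assms(3) by (metis mult_pos_pos power_minus_mult)
    thus ?thesis by (simp add: power_mult_distrib power_mult[symmetric] q_def D_def)
  qed
  also have "(\<Sum>m<D. of_int q ^ (l * D - 1) * (of_int (poly.coeff P m) * \<tau> ^ m)) + of_int q ^ (l * D - 1) * (of_int (poly.coeff P D) * \<tau> ^ D)
      = of_int q ^ (l * D - 1) * (\<Sum>m\<le>D. of_int (poly.coeff P m) * \<tau> ^ m)"
    by (simp add: sum_distrib_left distrib_left lessThan_Suc_atMost[symmetric])
  finally have root: "poly pp (of_int q ^ l * \<tau>) = 0" using P0 by simp
  have "Polynomial.degree pp = D"
  proof (rule antisym)
    show "Polynomial.degree pp \<le> D" by (intro Polynomial.degree_le) (auto simp: coeff)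
    show "D \<le> Polynomial.degree pp" by (intro Polynomial.le_degree) (simp add: coeff)
  qed
  hence "lead_coeff pp = 1" by (simp add: coeff)
  moreover have "\<forall>i. poly.coeff pp i \<in> \<int>" by (simp add: coeff)
  ultimately show ?thesis unfolding q_def[symmetric] using root by (rule algebraic_int.intros)
qed

lemma finite_scaled_roots:
  fixes P :: "int poly"
  assumes "P \<noteq> 0" "l > 0"
  shows "finite {\<rho> :: complex. \<exists>\<tau>. poly (map_poly of_int P) \<tau> = 0 \<and> \<rho> ^ l = a * \<tau>}"
proof -
  have "finite {\<rho> :: complex. \<rho> ^ l = y}" for y
  proof -
    let ?q = "Polynomial.monom 1 l - [:y:] :: complex poly"
    have "poly.coeff ?q l = 1" using assms(2) by (auto simp: coeff_pCons split: nat.splits)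
    hence "?q \<noteq> 0" by (metis coeff_0 zero_neq_one)
    hence "finite {\<rho>. poly ?q \<rho> = 0}" by (rule poly_roots_finite)
    thus ?thesis by (simp add: poly_monom)
  qed
  moreover have "finite {\<tau> :: complex. poly (map_poly of_int P) \<tau> = 0}"
    using assms(1) by (intro poly_roots_finite) (simp add: map_poly_eq_0_iff)
  ultimately have "finite (\<Union>\<tau>\<in>{\<tau> :: complex. poly (map_poly of_int P) \<tau> = 0}. {\<rho>. \<rho> ^ l = a * \<tau>})"
    by blast
  thus ?thesis by (rule finite_subset[rotated]) auto
qed

text \<open>The vanishing geometric sum is recorded instead of \<open>\<zeta> \<noteq> 1\<close>,
  because it survives reduction: \<open>\<zeta>\<close> congruent to 1 would force \<open>l\<close>
  into the ideal.\<close>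

lemma ex_root_of_unity:
  assumes "l \<ge> 2"
  shows "\<exists>\<zeta>::complex. (\<Sum>j<l. \<zeta> ^ j) = 0 \<and> \<zeta> ^ l = 1"
proof -
  let ?q = "\<Sum>j<l. Polynomial.monom 1 j :: complex poly"
  have "poly.coeff ?q (l - 1) = 1" using assms by (simp add: coeff_sum)
  hence "Polynomial.degree ?q \<ge> l - 1" by (intro Polynomial.le_degree) simp
  hence "Polynomial.degree ?q > 0" using assms by simp
  then obtain \<zeta> where "poly ?q \<zeta> = 0" using alg_closed_imp_poly_has_root by blast
  hence z: "(\<Sum>j<l. \<zeta> ^ j) = 0" by (simp add: poly_sum poly_monom)
  have "\<zeta> ^ l - 1 = (\<zeta> - 1) * (\<Sum>j<l. \<zeta> ^ j)" by (rule power_diff_1_eq)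
  thus ?thesis using z by auto
qed

section \<open>The construction\<close>

context residue_field
begin

lemma moment_cong:
  assumes "\<And>i. i \<in> {1..s} \<Longrightarrow> x i \<doteq> y i" "\<And>i. i \<in> {1..s} \<Longrightarrow> x i \<in> R" "\<And>i. i \<in> {1..s} \<Longrightarrow> y i \<in> R"
  shows "moment s c j x \<doteq> moment s c j y"
  unfolding moment_def
proof (rule equiv_sum)
  fix i assume i: "i \<in> {1..s}"
  show "of_int (c i) * x i ^ j \<doteq> of_int (c i) * y i ^ j"
    by (rule equiv_mult[OF equiv_refl equiv_power[OF assms(1)[OF i] assms(2)[OF i] assms(3)[OF i]]
        of_int_R power_R[OF assms(3)[OF i]]])
qed

lemma moment_scale: "moment s c j (\<lambda>i. x i * b) = b ^ j * (moment s c j x :: complex)"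
  by (simp add: moment_def power_mult_distrib sum_distrib_left mult_ac)

text \<open>In the binomial expansion every term but the last carries a moment of lower order, which
  lies in \<open>I\<close>.\<close>

lemma moment_shift:
  assumes "\<And>k. k < j \<Longrightarrow> moment s c k x \<in> I" "a \<in> R"
  shows "moment s c j (\<lambda>i. x i - a) \<doteq> moment s c j x"
proof -
  have "moment s c j (\<lambda>i. x i - a) = (\<Sum>i=1..s. \<Sum>k\<le>j. of_nat (j choose k) * (-a) ^ (j - k) * (of_int (c i) * x i ^ k))"
    unfolding moment_def
  proof (rule sum.cong[OF refl])
    fix i
    have "(x i - a) ^ j = (\<Sum>k\<le>j. of_nat (j choose k) * x i ^ k * (-a) ^ (j - k))"
      using binomial_ring[of "x i" "-a" j] by simp
    thus "of_int (c i) * (x i - a) ^ j = (\<Sum>k\<le>j. of_nat (j choose k) * (-a) ^ (j - k) * (of_int (c i) * x i ^ k))"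
      by (simp add: sum_distrib_left mult_ac)
  qed
  also have "\<dots> = (\<Sum>k\<le>j. of_nat (j choose k) * (-a) ^ (j - k) * moment s c k x)"
    unfolding moment_def by (subst sum.swap) (simp add: sum_distrib_left)
  also have "\<dots> = (\<Sum>k<j. of_nat (j choose k) * (-a) ^ (j - k) * moment s c k x) + moment s c j x"
    by (simp add: lessThan_Suc_atMost[symmetric])
  finally have "moment s c j (\<lambda>i. x i - a) - moment s c j x
      = (\<Sum>k<j. of_nat (j choose k) * (-a) ^ (j - k) * moment s c k x)" by simp
  also have "\<dots> \<in> I"
  proof (rule sum_I)
    fix k assume "k \<in> {..<j}"
    hence "moment s c k x \<in> I" by (intro assms(1)) simp
    thus "of_nat (j choose k) * (-a) ^ (j - k) * moment s c k x \<in> I"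
      by (rule mult_I[OF mult_R[OF of_nat_R power_R[OF uminus_R[OF assms(2)]]]])
  qed
  finally show ?thesis by (simp only: equiv_mod_def)
qed

text \<open>Normalising by an affine map multiplies the top moment by a power with exponent
  \<open>s - 1\<close>, an \<open>l\<close>-th power since \<open>l\<close> divides
  \<open>s - 1\<close>. As \<open>- v\<close> and the normalised top moment times
  \<open>q ^ l\<close> are also \<open>l\<close>-th powers, a zero would make \<open>h\<close> an
  \<open>l\<close>-th power.\<close>

lemma top_moment_avoids:
  assumes s: "s \<ge> 3" and l: "s - 1 = l * d" "l > 0"
    and elim: "\<And>z. (\<And>i. i \<in> {1..s} \<Longrightarrow> z i \<in> R) \<Longrightarrow> z 1 = 0 \<Longrightarrow> z 2 = 1 \<Longrightarrow>
       (\<And>i j. i \<in> {1..s} \<Longrightarrow> j \<in> {1..s} \<Longrightarrow> i \<noteq> j \<Longrightarrow> z i - z j \<notin> I) \<Longrightarrow>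
       (\<And>j. 1 \<le> j \<Longrightarrow> j \<le> s - 2 \<Longrightarrow> moment s c j z \<in> I) \<Longrightarrow>
       \<exists>\<rho>\<in>R. of_int q ^ l * moment s c (s - 1) z \<doteq> \<rho> ^ l"
    and q: "\<not> int p dvd q"
    and pow: "\<And>v. \<not> int p dvd v \<Longrightarrow> \<exists>w\<in>R. of_int v \<doteq> w ^ l"
    and h: "h \<in> R" "\<And>y. y \<in> R \<Longrightarrow> \<not> h \<doteq> y ^ l"
    and x: "\<And>i. i \<in> {1..s} \<Longrightarrow> x i \<in> R"
      "\<And>i j. i \<in> {1..s} \<Longrightarrow> j \<in> {1..s} \<Longrightarrow> i \<noteq> j \<Longrightarrow> x i - x j \<notin> I"
      "\<And>k. k \<le> s - 2 \<Longrightarrow> moment s c k x \<in> I"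
    and v: "\<not> int p dvd v"
  shows "moment s c (s - 1) x + h * of_int v \<notin> I"
proof
  assume bad: "moment s c (s - 1) x + h * of_int v \<in> I"
  have 12: "1 \<in> {1..s}" "2 \<in> {1..s}" using s by auto
  define b where "b = x 2 - x 1"
  have bR: "b \<in> R" unfolding b_def by (rule diff_R[OF x(1)[OF 12(2)] x(1)[OF 12(1)]])
  have "b \<notin> I" unfolding b_def by (rule x(2)[OF 12(2,1)]) simp
  then obtain b' where b': "b' \<in> R" "b * b' - 1 \<in> I" using inverse_mod[OF bR] by blast
  have b'I: "b' \<notin> I"
  proof
    assume "b' \<in> I"
    hence "b * b' - (b * b' - 1) \<in> I" by (rule diff_I[OF mult_I[OF bR] b'(2)])
    thus False using one_I by simp
  qed
  define y where "y i = (x i - x 1) * b'" for i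
  \<comment> \<open>The affine map gives \<open>y 2\<close> congruent to 1 only; \<open>elim\<close>
    asks for equality, so coordinate 2 is replaced by 1.\<close>
  define z where "z i = (if i = 2 then 1 else y i)" for i
  have yR: "y i \<in> R" if "i \<in> {1..s}" for i
    unfolding y_def by (rule mult_R[OF diff_R[OF x(1)[OF that] x(1)[OF 12(1)]] b'(1)])
  have zR: "z i \<in> R" if "i \<in> {1..s}" for i
    using yR[OF that] one_R by (simp add: z_def)
  have zy: "z i \<doteq> y i" if "i \<in> {1..s}" for i
    using equiv_sym[of "b * b'" 1] b'(2) by (simp add: z_def y_def b_def equiv_mod_def zero_I)
  have mom: "moment s c j z \<doteq> b' ^ j * moment s c j x" if j: "j \<le> s - 1" for j
  proof -
    have "moment s c j z \<doteq> moment s c j y" by (rule moment_cong[OF zy zR yR])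
    moreover have "moment s c j y = b' ^ j * moment s c j (\<lambda>i. x i - x 1)"
      unfolding y_def by (rule moment_scale)
    moreover have "b' ^ j * moment s c j (\<lambda>i. x i - x 1) \<doteq> b' ^ j * moment s c j x"
    proof (rule equiv_mult[OF equiv_refl moment_shift power_R[OF b'(1)] moment_R[OF x(1)]])
      show "moment s c k x \<in> I" if "k < j" for k using that j by (intro x(3)) simp
      show "x 1 \<in> R" by (rule x(1)[OF 12(1)])
    qed
    ultimately show ?thesis using equiv_trans by metis
  qed
  have "\<exists>\<rho>\<in>R. of_int q ^ l * moment s c (s - 1) z \<doteq> \<rho> ^ l"
  proof (rule elim[OF zR])
    show "z 1 = 0" by (simp add: z_def y_def)
    show "z 2 = 1" by (simp add: z_def)
    show "z i - z j \<notin> I" if ij: "i \<in> {1..s}" "j \<in> {1..s}" "i \<noteq> j" for i j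
    proof
      assume "z i - z j \<in> I"
      hence "y i - y j \<in> I"
        using equiv_I_iff[OF equiv_diff[OF zy[OF ij(1)] zy[OF ij(2)]]] by blast
      hence "(x i - x j) * b' \<in> I" by (simp add: y_def algebra_simps)
      hence "x i - x j \<in> I \<or> b' \<in> I"
        by (rule prime_I[OF diff_R[OF x(1)[OF ij(1)] x(1)[OF ij(2)]] b'(1)])
      thus False using x(2)[OF ij] b'I by blast
    qed
    show "moment s c j z \<in> I" if "1 \<le> j" "j \<le> s - 2" for j
    proof -
      have "b' ^ j * moment s c j x \<in> I" by (rule mult_I[OF power_R[OF b'(1)] x(3)[OF that(2)]])
      thus ?thesis using equiv_I_iff[OF mom[of j]] that(2) by simp
    qed
  qed
  then obtain \<rho> where \<rho>: "\<rho> \<in> R" "of_int q ^ l * moment s c (s - 1) z \<doteq> \<rho> ^ l" by blast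
  have "\<not> int p dvd - v" using v by simp
  then obtain w where w: "w \<in> R" "of_int (- v) \<doteq> w ^ l" using pow by blast
  have wI: "w \<notin> I"
  proof
    assume "w \<in> I"
    hence "w ^ l \<in> I" using l(2) mult_I'[OF _ power_R[OF w(1)], of w "l - 1"]
      by (metis Suc_diff_1 power_Suc)
    hence "of_int (- v) \<in> I" using equiv_I_iff[OF w(2)] by simp
    thus False using \<open>\<not> int p dvd - v\<close> by (simp only: of_int_I_iff)
  qed
  \<comment> \<open>Chosen so that \<open>u ^ l * h\<close> is congruent to \<open>q ^ l\<close>
    times the top moment of \<open>z\<close>, and hence to \<open>\<rho> ^ l\<close>; then
    \<open>u\<close> is inverted.\<close>
  define u where "u = of_int q * (b' ^ d * w)"
  have uR: "u \<in> R" unfolding u_def by (rule mult_R[OF of_int_R mult_R[OF power_R[OF b'(1)] w(1)]])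
  have powI: "b' ^ k \<notin> I" for k
  proof (induction k)
    case (Suc k)
    thus ?case using prime_I[OF b'(1) power_R[OF b'(1)], of k] b'I by auto
  qed (use one_I in simp)
  have "of_int q \<notin> I" using q by (simp only: of_int_I_iff) simp
  hence "u \<notin> I"
    unfolding u_def
    using prime_I[OF of_int_R mult_R[OF power_R[OF b'(1)] w(1)], of q d]
      prime_I[OF power_R[OF b'(1)] w(1), of d] powI[of d] wI by blast
  then obtain t where t: "t \<in> R" "u * t - 1 \<in> I" using inverse_mod[OF uR] by blast
  have mx: "moment s c (s - 1) x \<doteq> h * of_int (- v)"
    using bad by (simp add: equiv_mod_def)
  have "h * w ^ l \<doteq> h * of_int (- v)"
    by (rule equiv_mult[OF equiv_refl equiv_sym[OF w(2)] h(1) of_int_R])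
  hence "h * w ^ l \<doteq> moment s c (s - 1) x" by (rule equiv_trans[OF _ equiv_sym[OF mx]])
  hence "b' ^ (s - 1) * (h * w ^ l) \<doteq> b' ^ (s - 1) * moment s c (s - 1) x"
    by (rule equiv_mult[OF equiv_refl _ power_R[OF b'(1)] moment_R[OF x(1)]])
  hence "b' ^ (s - 1) * (h * w ^ l) \<doteq> moment s c (s - 1) z"
    by (rule equiv_trans[OF _ equiv_sym[OF mom[OF order_refl]]])
  hence "of_int q ^ l * (b' ^ (s - 1) * (h * w ^ l)) \<doteq> of_int q ^ l * moment s c (s - 1) z"
    by (rule equiv_mult[OF equiv_refl _ power_R[OF of_int_R] moment_R[OF zR]])
  hence "of_int q ^ l * (b' ^ (s - 1) * (h * w ^ l)) \<doteq> \<rho> ^ l" by (rule equiv_trans[OF _ \<rho>(2)])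
  moreover have "of_int q ^ l * (b' ^ (s - 1) * (h * w ^ l)) = u ^ l * h"
    unfolding l(1) u_def by (simp add: power_mult_distrib power_mult[symmetric] mult_ac)
  ultimately have uh: "u ^ l * h \<doteq> \<rho> ^ l" by (simp only:)
  have 1: "t ^ l * (u ^ l * h) \<doteq> t ^ l * \<rho> ^ l"
    by (rule equiv_mult[OF equiv_refl uh power_R[OF t(1)] power_R[OF \<rho>(1)]])
  have 2: "(u * t) ^ l * h \<doteq> 1 ^ l * h"
  proof (rule equiv_mult[OF equiv_power equiv_refl])
    show "u * t \<doteq> 1" using t(2) by (simp only: equiv_mod_def)
  qed (intro mult_R uR t(1) one_R power_R h(1))+
  have 3: "t ^ l * (u ^ l * h) = (u * t) ^ l * h" by (simp add: power_mult_distrib mult_ac)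
  have "1 ^ l * h \<doteq> t ^ l * \<rho> ^ l" by (rule equiv_trans[OF equiv_sym[OF 2] 1[unfolded 3]])
  hence "h \<doteq> (t * \<rho>) ^ l" by (simp only: power_one mult_1_left power_mult_distrib)
  thus False using h(2)[OF mult_R[OF t(1) \<rho>(1)]] by blast
qed

text \<open>The set encodes the points \<open>(y, ..., y ^ (s - 2), y ^ (s - 1) + h * g)\<close> by
  the basis coordinates of their entries, read as digits in base \<open>K * p\<close>. Without
  carries, a solution becomes a system of moment congruences modulo \<open>I\<close>.\<close>

lemma construction:
  fixes s :: nat and c :: "nat \<Rightarrow> int" and G :: "int set"
  defines "K \<equiv> \<Sum>i=1..s. \<bar>c i\<bar>"
  assumes s: "s \<ge> 3" and prim: "primitive_form s c" and sum0: "(\<Sum>i=1..s. c i) = 0"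
    and nz: "\<And>i. i \<in> {1..s} \<Longrightarrow> c i \<noteq> 0"
    and G: "finite G" "G \<subseteq> {0..<g}" "form_free s c G" "K * g \<le> int p" and Kp: "K < int p"
    and h: "h \<in> R" "h \<notin> I"
    and avoid: "\<And>x v. (\<And>i. i \<in> {1..s} \<Longrightarrow> x i \<in> R) \<Longrightarrow>
      (\<And>i j. i \<in> {1..s} \<Longrightarrow> j \<in> {1..s} \<Longrightarrow> i \<noteq> j \<Longrightarrow> x i - x j \<notin> I) \<Longrightarrow>
      (\<And>k. k \<le> s - 2 \<Longrightarrow> moment s c k x \<in> I) \<Longrightarrow> \<not> int p dvd v \<Longrightarrow>
      moment s c (s - 1) x + h * of_int v \<notin> I"
  obtains e A where "e \<le> card B" "A \<subseteq> {0..<(K * int p) ^ (e * (s - 1))}" "form_free s c A"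
    "card A = p ^ e * card G"
proof -
  obtain S X where S: "finite S" "S \<subseteq> R" "card S \<le> card B"
    "\<And>x. x \<in> R \<Longrightarrow> \<exists>n\<in>PiE S (\<lambda>_. {0..<int p}). x \<doteq> (\<Sum>b\<in>S. of_int (n b) * b)"
    and X: "finite X" "X \<subseteq> R" "card X = p ^ card S"
    "\<And>x. x \<in> R \<Longrightarrow> \<exists>y\<in>X. x \<doteq> y" "\<And>x y. x \<in> X \<Longrightarrow> y \<in> X \<Longrightarrow> x \<doteq> y \<Longrightarrow> x = y"
    by (rule ex_residues) (rule that; assumption)
  define e where "e = card S"
  obtain \<beta> where \<beta>: "bij_betw \<beta> {..<e} S"
    using ex_bij_betw_nat_finite[OF S(1)] by (auto simp: e_def atLeast0LessThan)
  have "\<forall>x\<in>R. \<exists>n. n \<in> PiE S (\<lambda>_. {0..<int p}) \<and> x \<doteq> (\<Sum>b\<in>S. of_int (n b) * b)" using S(4) by blast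
  from bchoice[OF this] obtain co
    where co': "\<forall>x\<in>R. co x \<in> PiE S (\<lambda>_. {0..<int p}) \<and> x \<doteq> (\<Sum>b\<in>S. of_int (co x b) * b)" ..
  have co: "co x \<in> PiE S (\<lambda>_. {0..<int p})" "x \<doteq> (\<Sum>b\<in>S. of_int (co x b) * b)" if "x \<in> R" for x
    by (rule conjunct1[OF bspec[OF co' that]], rule conjunct2[OF bspec[OF co' that]])
  have K0: "K > 0"
  proof -
    have "\<bar>c 1\<bar> \<le> K" unfolding K_def using s by (intro member_le_sum) auto
    moreover have "c 1 \<noteq> 0" using nz[of 1] s by auto
    ultimately show ?thesis by linarith
  qed
  have cK: "\<bar>sum c T\<bar> \<le> K" if "T \<subseteq> {1..s}" for T
  proof -
    have "\<bar>sum c T\<bar> \<le> (\<Sum>i\<in>T. \<bar>c i\<bar>)" by (rule sum_abs)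
    also have "\<dots> \<le> K" unfolding K_def using that by (intro sum_mono2) auto
    finally show ?thesis .
  qed
  define Q where "Q = K * int p"
  have "1 * int p \<le> Q" unfolding Q_def using K0 by (intro mult_right_mono) auto
  hence pQ: "int p \<le> Q" by simp
  define E where "E j y g = (if j < s - 2 then y ^ Suc j else y ^ (s - 1) + h * of_int g)" for j and y :: complex and g :: int
  have ER: "E j y g \<in> R" if "y \<in> X" for j y g
  proof -
    have "y \<in> R" using that X(2) by blast
    thus ?thesis unfolding E_def using h(1) by (auto intro!: R_intros)
  qed
  \<comment> \<open>Digit \<open>j * e + m\<close> is coordinate \<open>m\<close> of entry
    \<open>j\<close> of the point.\<close>
  define u where "u y g k = co (E (k div e) y g) (\<beta> (k mod e))" for y g k
  define D where "D = e * (s - 1)"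
  define val where "val = (\<lambda>(y, g). \<Sum>k<D. u y g k * Q ^ k)"
  have idx: "j * e + m < D" "(j * e + m) div e = j" "(j * e + m) mod e = m" if jm: "j < s - 1" "m < e" for j m
  proof -
    have "j * e + m < (j + 1) * e" using jm by simp
    also have "\<dots> \<le> (s - 1) * e" using jm by (intro mult_right_mono) auto
    finally show "j * e + m < D" by (simp add: D_def mult.commute)
  qed (use jm in auto)
  have uQ: "u y g k \<in> {0..<int p}" if yk: "y \<in> X" "k < D" for y g k
  proof -
    have "e > 0" using yk(2) by (cases e) (auto simp: D_def)
    hence "\<beta> (k mod e) \<in> S" using \<beta> by (auto simp: bij_betw_def)
    thus ?thesis unfolding u_def using co(1)[OF ER[OF yk(1)]] by (auto simp: PiE_def Pi_def)
  qed
  have uQ': "u y g k \<in> {0..<Q}" if "y \<in> X" "k < D" for y g k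
    using uQ[OF that, of g] pQ by auto
  \<comment> \<open>Since \<open>K \<ge> 1\<close>, also \<open>g \<le> p\<close>, so the elements
    of \<open>G\<close> are distinct modulo \<open>p\<close> and can be recovered from the last
    entry.\<close>
  have gp: "g1 = g2" if g12: "g1 \<in> G" "g2 \<in> G" "int p dvd g1 - g2" for g1 g2
  proof -
    have "1 * g \<le> K * g" using g12 G(2) K0 by (intro mult_right_mono) auto
    hence "g \<le> int p" using G(4) by linarith
    moreover have "g1 \<in> {0..<g}" "g2 \<in> {0..<g}" using g12(1,2) G(2) by blast+
    ultimately have "\<bar>g1 - g2\<bar> < int p" by auto
    thus ?thesis using g12(3) by (metis dvd_imp_le_int eq_iff_diff_eq_0 linorder_not_less abs_of_nat)
  qed
  have inj: "inj_on val (X \<times> G)"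
  proof (rule inj_onI)
    fix a a' assume a: "a \<in> X \<times> G" "a' \<in> X \<times> G" "val a = val a'"
    obtain y g1 y' g2 where yg: "a = (y, g1)" "a' = (y', g2)" by (metis prod.exhaust)
    have m: "y \<in> X" "g1 \<in> G" "y' \<in> X" "g2 \<in> G" using a yg by auto
    have ueq: "u y g1 k = u y' g2 k" if "k < D" for k
      by (rule digits_unique[OF uQ'[OF m(1)] uQ'[OF m(3)] _ that]) (use a(3) yg in \<open>simp_all add: val_def\<close>)
    have Eeq: "E j y g1 \<doteq> E j y' g2" if j: "j < s - 1" for j
    proof -
      have "co (E j y g1) b = co (E j y' g2) b" if b: "b \<in> S" for b
      proof -
        obtain i where i: "i < e" "b = \<beta> i" using \<beta> b by (auto simp: bij_betw_def)
        show ?thesis using ueq[OF idx(1)[OF j i(1)]] idx[OF j i(1)] i(2) by (simp add: u_def)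
      qed
      hence "(\<Sum>b\<in>S. of_int (co (E j y g1) b) * b) = (\<Sum>b\<in>S. of_int (co (E j y' g2) b) * b)"
        by (intro sum.cong) simp_all
      thus ?thesis using co(2)[OF ER[OF m(1)], of j g1] equiv_sym[OF co(2)[OF ER[OF m(3)], of j g2]]
        by (simp add: equiv_trans)
    qed
    have "y \<doteq> y'" using Eeq[of 0] s by (simp add: E_def)
    hence yy: "y = y'" by (rule X(5)[OF m(1,3)])
    have "y ^ (s - 1) + h * of_int g1 \<doteq> y' ^ (s - 1) + h * of_int g2"
      using Eeq[of "s - 2"] s by (simp add: E_def)
    hence "h * of_int (g1 - g2) \<in> I" using yy by (simp add: equiv_mod_def algebra_simps)
    hence "of_int (g1 - g2) \<in> I" using prime_I[OF h(1) of_int_R] h(2) by blast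
    hence "int p dvd g1 - g2" by (simp only: of_int_I_iff)
    hence "g1 = g2" by (rule gp[OF m(2,4)])
    thus "a = a'" using yg yy by simp
  qed
  define A where "A = val ` (X \<times> G)"
  have "card A = p ^ e * card G"
    unfolding A_def by (simp add: card_image[OF inj] card_cartesian_product X(3) e_def)
  moreover have "A \<subseteq> {0..<Q ^ D}"
  proof
    fix a assume "a \<in> A"
    then obtain y g1 where y: "y \<in> X" and a: "a = (\<Sum>k<D. u y g1 k * Q ^ k)" by (auto simp: A_def val_def)
    show "a \<in> {0..<Q ^ D}"
      using digits_less[of D "u y g1" Q, OF uQ'[OF y]] digits_nonneg[of D "u y g1" Q, OF uQ'[OF y]]
      unfolding a by simp
  qed
  moreover have "form_free s c A"
    unfolding form_free_iff
  proof (intro allI impI, elim conjE)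
    fix a assume aA: "\<forall>i\<in>{1..s}. a i \<in> A" and sol: "(\<Sum>i=1..s. c i * a i) = 0"
    have "\<forall>i\<in>{1..s}. \<exists>w. w \<in> X \<times> G \<and> a i = val w" using aA unfolding A_def by blast
    from bchoice[OF this] obtain w where w': "\<forall>i\<in>{1..s}. w i \<in> X \<times> G \<and> a i = val (w i)" ..
    have w: "w i \<in> X \<times> G" "a i = val (w i)" if "i \<in> {1..s}" for i
      by (rule conjunct1[OF bspec[OF w' that]], rule conjunct2[OF bspec[OF w' that]])
    define y where "y i = fst (w i)" for i
    define \<gamma> where "\<gamma> i = snd (w i)" for i
    have yX: "y i \<in> X" and \<gamma>G: "\<gamma> i \<in> G" if "i \<in> {1..s}" for i
      using w(1)[OF that] by (auto simp: y_def \<gamma>_def)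
    have yR: "y i \<in> R" if "i \<in> {1..s}" for i using yX[OF that] X(2) by blast
    have aval: "a i = (\<Sum>k<D. u (y i) (\<gamma> i) k * Q ^ k)" if "i \<in> {1..s}" for i
      using w(2)[OF that] by (simp add: val_def y_def \<gamma>_def case_prod_beta)
    have dig: "(\<Sum>i=1..s. c i * u (y i) (\<gamma> i) k) = 0" if k: "k < D" for k
    proof (rule digitwise_solution[where q = "int p" and Q = Q and D = D])
      show "u (y i) (\<gamma> i) k \<in> {0..<int p}" if "i \<in> {1..s}" "k < D" for i k
        by (rule uQ[OF yX[OF that(1)] that(2)])
      show "0 < (\<Sum>i=1..s. \<bar>c i\<bar>)" using K0 by (simp add: K_def)
      show "(\<Sum>i=1..s. \<bar>c i\<bar>) * int p \<le> Q" by (simp add: Q_def K_def)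
      show "(\<Sum>i=1..s. c i * (\<Sum>k<D. u (y i) (\<gamma> i) k * Q ^ k)) = 0"
        using sol aval by simp
    qed (rule k)
    have EI: "(\<Sum>i=1..s. of_int (c i) * E j (y i) (\<gamma> i)) \<in> I" if j: "j < s - 1" for j
    proof -
      have 1: "(\<Sum>i=1..s. of_int (c i) * E j (y i) (\<gamma> i)) \<doteq>
          (\<Sum>i=1..s. of_int (c i) * (\<Sum>b\<in>S. of_int (co (E j (y i) (\<gamma> i)) b) * b))"
      proof (rule equiv_sum)
        fix i assume i: "i \<in> {1..s}"
        have "(\<Sum>b\<in>S. of_int (co (E j (y i) (\<gamma> i)) b) * b) \<in> R"
          using S(2) by (intro sum_R mult_R of_int_R) blast
        thus "of_int (c i) * E j (y i) (\<gamma> i) \<doteq> of_int (c i) * (\<Sum>b\<in>S. of_int (co (E j (y i) (\<gamma> i)) b) * b)"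
          by (rule equiv_mult[OF equiv_refl co(2)[OF ER[OF yX[OF i]]] of_int_R])
      qed
      have 2: "(\<Sum>i=1..s. of_int (c i) * (\<Sum>b\<in>S. of_int (co (E j (y i) (\<gamma> i)) b) * b))
          = (\<Sum>b\<in>S. of_int (\<Sum>i=1..s. c i * co (E j (y i) (\<gamma> i)) b) * b)"
        unfolding sum_distrib_left of_int_sum sum_distrib_right of_int_mult
        by (subst sum.swap) (simp only: mult.assoc)
      have 3: "(\<Sum>i=1..s. c i * co (E j (y i) (\<gamma> i)) b) = 0" if b: "b \<in> S" for b
      proof -
        obtain m where m: "m < e" "b = \<beta> m" using \<beta> b by (auto simp: bij_betw_def)
        show ?thesis using dig[OF idx(1)[OF j m(1)]] idx[OF j m(1)] m(2) by (simp add: u_def)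
      qed
      have "(\<Sum>b\<in>S. of_int (\<Sum>i=1..s. c i * co (E j (y i) (\<gamma> i)) b) * b) = 0"
        by (intro sum.neutral ballI) (simp only: 3 of_int_0 mult_zero_left)
      with 1 show ?thesis unfolding 2 by (simp only: equiv_0_iff)
    qed
    have mom: "moment s c k y \<in> I" if k: "k \<le> s - 2" for k
    proof (cases k)
      case 0
      have "moment s c 0 y = of_int (\<Sum>i=1..s. c i)" by (simp add: moment_def)
      thus ?thesis unfolding 0 sum0 using zero_I by simp
    next
      case (Suc j)
      thus ?thesis using EI[of j] k by (simp add: moment_def E_def)
    qed
    define v where "v = (\<Sum>i=1..s. c i * \<gamma> i)"
    have top: "moment s c (s - 1) y + h * of_int v \<in> I"
    proof -
      have "(\<Sum>i=1..s. of_int (c i) * E (s - 2) (y i) (\<gamma> i)) \<in> I" using s by (intro EI) simp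
      also have "(\<Sum>i=1..s. of_int (c i) * E (s - 2) (y i) (\<gamma> i)) = moment s c (s - 1) y + h * of_int v"
        by (simp add: E_def moment_def v_def distrib_left sum.distrib sum_distrib_left mult_ac)
      finally show ?thesis .
    qed
    have vp: "\<bar>v\<bar> < int p"
    proof -
      have "\<bar>v\<bar> < K * g" unfolding v_def K_def
      proof (rule abs_form_less)
        show "\<gamma> i \<in> {0..<g}" if "i \<in> {1..s}" for i using \<gamma>G[OF that] G(2) by blast
        show "0 < (\<Sum>i=1..s. \<bar>c i\<bar>)" using K0 by (simp only: K_def)
      qed
      thus ?thesis using G(4) by simp
    qed
    have yz: "zero_sum_fibres s c y"
    proof (rule ccontr)
      assume ny: "\<not> zero_sum_fibres s c y"
      define W where "W = y ` {1..s}"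
      \<comment> \<open>The fibre sums are the weights of a Vandermonde relation between the
        distinct values in \<open>W\<close>. They are at most \<open>K < p\<close> in absolute
        value, so divisibility by \<open>p\<close> means that they vanish.\<close>
      define C where "C t = (\<Sum>i\<in>{i\<in>{1..s}. y i = t}. c i)" for t
      have WX: "W \<subseteq> X" using yX by (auto simp: W_def)
      have Wm: "(\<Sum>t\<in>W. of_int (C t) * t ^ m) = moment s c m y" for m
      proof -
        have "(\<Sum>t\<in>W. of_int (C t) * t ^ m) = (\<Sum>t\<in>W. \<Sum>i\<in>{i\<in>{1..s}. y i = t}. of_int (c i) * y i ^ m)"
          by (intro sum.cong refl) (simp add: C_def sum_distrib_right)
        also have "\<dots> = moment s c m y" unfolding moment_def W_def by (rule sum.group) auto
        finally show ?thesis .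
      qed
      have kernel: "C t = 0" if Wc: "\<And>m. m < card W \<Longrightarrow> moment s c m y \<in> I" and t: "t \<in> W" for t
      proof -
        have "of_int (C t) \<in> I"
        proof (rule vandermonde_kernel[where S = W and v = "\<lambda>t. t" and C = "\<lambda>t. of_int (C t)"])
          show "finite W" by (simp add: W_def)
          show "i \<in> R" if "i \<in> W" for i using that WX X(2) by blast
          show "\<not> i \<doteq> k" if "i \<in> W" "k \<in> W" "i \<noteq> k" for i k using that WX X(5) by blast
          show "(\<Sum>i\<in>W. of_int (C i) * i ^ m) \<in> I" if "m < card W" for m
            unfolding Wm by (rule Wc[OF that])
        qed (use t of_int_R in auto)
        hence "int p dvd C t" by (simp only: of_int_I_iff)
        moreover have "\<bar>C t\<bar> \<le> K" unfolding C_def by (rule cK) auto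
        ultimately show ?thesis using Kp
          by (metis dvd_imp_le_int abs_of_nat linorder_not_less order_le_less_trans)
      qed
      \<comment> \<open>With fewer than \<open>s\<close> values the moments of order at most
        \<open>s - 2\<close> would already annihilate every fibre sum.\<close>
      have "card W \<ge> s"
      proof (rule ccontr)
        assume "\<not> card W \<ge> s"
        hence C0: "C t = 0" if "t \<in> W" for t using that by (intro kernel mom) auto
        have "C t = 0" for t
        proof (cases "t \<in> W")
          case False
          hence "{i\<in>{1..s}. y i = t} = {}" by (auto simp: W_def)
          thus ?thesis unfolding C_def by (simp only: sum.empty)
        qed (rule C0)
        thus False using ny by (simp add: zero_sum_fibres_def C_def)
      qed
      moreover have "card W \<le> s" unfolding W_def using card_image_le[of "{1..s}" y] by simp
      ultimately have cW: "card W = s" by simp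
      hence injy: "inj_on y {1..s}" by (intro eq_card_imp_inj_on) (auto simp: W_def)
      have dist: "y i - y j \<notin> I" if ij: "i \<in> {1..s}" "j \<in> {1..s}" "i \<noteq> j" for i j
      proof
        assume "y i - y j \<in> I"
        hence "y i \<doteq> y j" by (simp only: equiv_mod_def)
        hence "y i = y j" by (rule X(5)[OF yX[OF ij(1)] yX[OF ij(2)]])
        thus False using injy ij by (auto dest: inj_onD)
      qed
      show False
      proof (cases "int p dvd v")
        case False
        thus False using avoid[OF yR dist mom False] top by blast
      next
        \<comment> \<open>Now the top moment vanishes too, so there are \<open>s\<close> moment
          conditions on \<open>s\<close> distinct values, and the Vandermonde kernel would make the
          coefficient \<open>c 1\<close> zero.\<close>
        case True
        hence "v = 0" using vp by (metis dvd_imp_le_int abs_of_nat linorder_not_less)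
        hence "moment s c (s - 1) y \<in> I" using top by simp
        hence all: "moment s c m y \<in> I" if "m < card W" for m
          using that mom[of m] cW by (cases "m = s - 1") auto
        have "C (y 1) = 0" using s by (intro kernel[OF all]) (auto simp: W_def)
        moreover have "{i\<in>{1..s}. y i = y 1} = {1}" using injy s by (auto dest: inj_onD)
        hence "C (y 1) = c 1" unfolding C_def by simp
        ultimately show False using nz[of 1] s by simp
      qed
    qed
    \<comment> \<open>With \<open>y\<close> zero-sum only the contribution of \<open>G\<close>
      remains in the last entry, which forces \<open>v = 0\<close> and lets freeness of
      \<open>G\<close> apply.\<close>
    have "moment s c (s - 1) y = 0"
      unfolding moment_def by (rule zero_sum_fibres_sum[OF yz, of "\<lambda>t. t ^ (s - 1)"])
    hence "h * of_int v \<in> I" using top by simp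
    hence "of_int v \<in> I" using prime_I[OF h(1) of_int_R] h(2) by blast
    hence "int p dvd v" by (simp only: of_int_I_iff)
    hence "v = 0" using vp by (metis dvd_imp_le_int abs_of_nat linorder_not_less)
    hence "zero_sum_fibres s c \<gamma>" using G(3) \<gamma>G unfolding form_free_iff v_def by blast
    from zero_sum_fibres_comp[OF zero_sum_fibres_Pair[OF prim yz this], of val]
    have "zero_sum_fibres s c (\<lambda>i. val (w i))" by (simp add: y_def \<gamma>_def)
    thus "zero_sum_fibres s c a"
      using zero_sum_fibres_cong[of s a "\<lambda>i. val (w i)"] w(2) by blast
  qed
  ultimately show thesis
    using that[of e A] S(3) by (simp add: e_def Q_def D_def)
qed

end

theorem theorem3:
  fixes s :: nat and c :: "nat \<Rightarrow> int"
  assumes "s \<ge> 3"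
    and "translation_invariant_form s c"
    and "primitive_form s c"
  shows "\<exists>\<epsilon>>0. \<exists>C>0. \<forall>N::nat. N \<ge> 1 \<longrightarrow>
           real (r_form s c N) \<ge> C * real N powr (1 / (real s - 1) + \<epsilon>)"
proof -
  have nz: "\<And>i. i \<in> {1..s} \<Longrightarrow> c i \<noteq> 0" and sum0: "(\<Sum>i=1..s. c i) = 0"
    using assms(2) by (auto simp: translation_invariant_form_def)
  define K where "K = (\<Sum>i=1..s. \<bar>c i\<bar>)"
  have cK: "\<bar>c i\<bar> \<le> K" if "i \<in> {1..s}" for i
    unfolding K_def by (rule member_le_sum[OF that]) auto
  have K0: "K > 0" using cK[of 1] nz[of 1] assms(1) by simp
  have "s - 1 \<noteq> 1" using assms(1) by simp
  then obtain l where l: "prime l" "l dvd s - 1" using prime_factor_nat by blast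
  then obtain d where d: "s - 1 = l * d" by blast
  have l2: "l \<ge> 2" and l0: "l > 0" using prime_ge_2_nat[OF l(1)] by auto
  obtain P :: "int poly" and p0 where P: "P \<noteq> 0" and elim:
    "\<And>R I B p z. residue_field R I B p \<Longrightarrow> p0 \<le> p \<Longrightarrow> (\<And>i. i \<in> {1..s} \<Longrightarrow> \<not> int p dvd c i) \<Longrightarrow>
       (\<And>i. i \<in> {1..s} \<Longrightarrow> z i \<in> R) \<Longrightarrow> z 1 = 0 \<Longrightarrow> z 2 = 1 \<Longrightarrow>
       (\<And>i j. i \<in> {1..s} \<Longrightarrow> j \<in> {1..s} \<Longrightarrow> i \<noteq> j \<Longrightarrow> z i - z j \<notin> I) \<Longrightarrow>
       (\<And>j. 1 \<le> j \<Longrightarrow> j \<le> s - 2 \<Longrightarrow> moment s c j z \<in> I) \<Longrightarrow>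
       poly (map_poly of_int P) (moment s c (s - 1) z) \<in> I"
  proof (rule eliminant[OF assms(1), of c], goal_cases)
    case (1 P p0)
    show ?case by (rule 1(1)[OF 1(2,3)])
  qed
  define q where "q = lead_coeff P"
  have q0: "q \<noteq> 0" using P by (simp add: q_def)
  obtain \<zeta> :: complex where \<zeta>: "(\<Sum>j<l. \<zeta> ^ j) = 0" "\<zeta> ^ l = 1" using ex_root_of_unity[OF l2] by blast
  \<comment> \<open>The scaled roots make normalised top moments \<open>l\<close>-th powers,
    \<open>\<zeta>\<close> yields a non-power \<open>h\<close>, and \<open>\<i>\<close> takes care
    of signs when \<open>l = 2\<close>.\<close>
  define Z where "Z = {\<rho>. \<exists>\<tau>. poly (map_poly of_int P) \<tau> = 0 \<and> \<rho> ^ l = of_int q ^ l * \<tau>} \<union> {\<zeta>, \<i>}"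
  have "finite Z" unfolding Z_def using finite_scaled_roots[OF P l0] by simp
  moreover have "algebraic_int z" if z: "z \<in> Z" for z
  proof (cases "z \<in> {\<zeta>, \<i>}")
    case True
    thus ?thesis using algebraic_int_nth_root[OF algebraic_int_1 \<zeta>(2) l0] by auto
  next
    case False
    then obtain \<tau> where "poly (map_poly of_int P) \<tau> = 0" "z ^ l = of_int q ^ l * \<tau>"
      using z unfolding Z_def by blast
    thus ?thesis
      using algebraic_int_nth_root[OF algebraic_int_scaled_root[OF P _ l0] _ l0] unfolding q_def by blast
  qed
  ultimately obtain R B where RB: "finite_subring R B" and ZR: "Z \<subseteq> R"
    using ex_finite_subring by blast
  \<comment> \<open>This size depends on \<open>K\<close> and \<open>card B\<close> but not on
    \<open>p\<close>, so \<open>p\<close> can be taken large afterwards; it outweighs the powers of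
    \<open>K\<close> lost in the digit construction.\<close>
  define M where "M = nat (K ^ (card B + 1)) + 1"
  define Y where "Y = K + 1"
  define G where "G = (\<lambda>k. Y ^ k) ` {..<M}"
  have Y1: "Y > 1" using K0 by (simp add: Y_def)
  have "inj_on (\<lambda>k. Y ^ k) {..<M}" using Y1 by (auto intro!: inj_onI simp: power_inject_exp)
  hence cG: "card G = M" by (simp add: G_def card_image)
  have finG: "finite G" and subG: "G \<subseteq> {0..<Y ^ M}"
    using Y1 by (auto simp: G_def intro: power_strict_increasing)
  have freeG: "form_free s c G"
    by (rule form_free_powers[where Y = Y and M = M]) (auto simp: Y_def K_def G_def)
  \<comment> \<open>A prime beyond \<open>n\<close> divides none of the nonzero integers
    \<open>c i\<close>, \<open>q\<close> and \<open>l\<close>, and it exceeds \<open>p0\<close>, 2,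
    \<open>K\<close> and \<open>K * Y ^ M\<close>.\<close>
  define n where "n = p0 + nat \<bar>q\<bar> + l + nat (K * Y ^ M) + nat K + 2"
  have "0 \<le> K * Y ^ M" using K0 Y1 by simp
  hence n_ge: "K \<le> int n" "K * Y ^ M \<le> int n" "\<bar>q\<bar> \<le> int n" "int l \<le> int n" "p0 \<le> n"
    using K0 by (simp_all add: n_def)
  \<comment> \<open>For \<open>l = 2\<close> the condition modulo 4 leaves
    \<open>p mod 4 = 3\<close>, as \<open>p\<close> is odd; modulo 2 no large prime would avoid the
    residue 1.\<close>
  have "(if l = 2 then 4 else l) \<ge> 3" using l2 by simp
  then obtain p where p: "p > n" "prime p" "p mod (if l = 2 then 4 else l) \<noteq> 1"
    using ex_large_prime_mod_neq_1 by blast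
  have p4: "p mod 4 = 3" if "l = 2"
  proof -
    have "odd p" using p(1,2) prime_odd_nat[of p] by (simp add: n_def)
    moreover have "p mod 4 \<noteq> 1" using p(3) that by simp
    ultimately show ?thesis by presburger
  qed
  have small: "\<not> int p dvd a" if a: "a \<noteq> 0" "\<bar>a\<bar> \<le> int n" for a
  proof
    assume "int p dvd a"
    hence "\<bar>int p\<bar> \<le> \<bar>a\<bar>" by (rule dvd_imp_le_int[OF a(1)])
    thus False using a(2) p(1) by simp
  qed
  obtain I where I: "residue_field R I B p" using ex_residue_field[OF RB p(2)] by blast
  interpret residue_field R I B p by (rule I)
  have pc: "\<not> int p dvd c i" if "i \<in> {1..s}" for i
    using cK[OF that] n_ge(1) by (intro small nz[OF that]) simp
  have pq: "\<not> int p dvd q" using q0 n_ge(3) by (intro small)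
  have \<zeta>R: "\<zeta> \<in> R" and iR: "\<i> \<in> R" using ZR by (auto simp: Z_def)
  have "\<zeta> - 1 \<notin> I"
  proof
    assume "\<zeta> - 1 \<in> I"
    hence z1: "equiv_mod \<zeta> 1" by (simp only: equiv_mod_def)
    have "equiv_mod (\<Sum>j<l. \<zeta> ^ j) (\<Sum>j<l. 1 ^ j)"
      by (intro equiv_sum equiv_power[OF z1 \<zeta>R one_R])
    hence "equiv_mod 0 (of_int (int l))" using \<zeta>(1) by simp
    hence "of_int (int l) \<in> I" using equiv_0_iff equiv_sym by blast
    hence "int p dvd int l" by (simp only: of_int_I_iff)
    thus False using small[of "int l"] l0 n_ge(4) by simp
  qed
  then obtain h where h: "h \<in> R" "\<And>y. y \<in> R \<Longrightarrow> \<not> equiv_mod h (y ^ l)" using ex_nonpower[OF \<zeta>R \<zeta>(2)] by blast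
  have hI: "h \<notin> I" using h(2)[OF zero_R] l0 by (simp add: equiv_0_iff power_0_left)
  have pow: "\<exists>w\<in>R. equiv_mod (of_int v) (w ^ l)" if "\<not> int p dvd v" for v
    by (rule int_is_power[OF l(1) _ _ that]) (use iR p4 p(3) in auto)
  have top: "\<exists>\<rho>\<in>R. equiv_mod (of_int q ^ l * moment s c (s - 1) z) (\<rho> ^ l)"
    if z: "\<And>i. i \<in> {1..s} \<Longrightarrow> z i \<in> R" "z 1 = 0" "z 2 = 1"
      "\<And>i j. i \<in> {1..s} \<Longrightarrow> j \<in> {1..s} \<Longrightarrow> i \<noteq> j \<Longrightarrow> z i - z j \<notin> I"
      "\<And>j. 1 \<le> j \<Longrightarrow> j \<le> s - 2 \<Longrightarrow> moment s c j z \<in> I" for z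
    unfolding q_def
  proof (rule root_is_power[OF P l0 pq[unfolded q_def]])
    show "\<rho> \<in> R" if "poly (map_poly of_int P) \<tau> = 0" "\<rho> ^ l = of_int (lead_coeff P) ^ l * \<tau>" for \<rho> \<tau>
      using that ZR unfolding Z_def q_def by blast
    show "moment s c (s - 1) z \<in> R" by (rule moment_R[OF z(1)])
    have "p0 \<le> p" using p(1) n_ge(5) by simp
    thus "poly (map_poly of_int P) (moment s c (s - 1) z) \<in> I" by (rule elim[OF I _ pc z])
  qed
  obtain e A where eA: "e \<le> card B" "A \<subseteq> {0..<(K * int p) ^ (e * (s - 1))}" "form_free s c A"
    "card A = p ^ e * card G"
    unfolding K_def
  proof (rule construction[OF assms(1,3) sum0 nz finG subG freeG _ _ h(1) hI])
    show "(\<Sum>i=1..s. \<bar>c i\<bar>) * Y ^ M \<le> int p" "(\<Sum>i=1..s. \<bar>c i\<bar>) < int p"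
      unfolding K_def[symmetric] using p(1) n_ge(1,2) by linarith+
    show "moment s c (s - 1) x + h * of_int v \<notin> I"
      if "\<And>i. i \<in> {1..s} \<Longrightarrow> x i \<in> R"
        "\<And>i j. i \<in> {1..s} \<Longrightarrow> j \<in> {1..s} \<Longrightarrow> i \<noteq> j \<Longrightarrow> x i - x j \<notin> I"
        "\<And>k. k \<le> s - 2 \<Longrightarrow> moment s c k x \<in> I" "\<not> int p dvd v" for x v
      by (rule top_moment_avoids[OF assms(1) d l0 top pq pow h that])
  qed
  define k where "k = nat K"
  have k: "K = int k" "k \<ge> 1" using K0 by (auto simp: k_def)
  have Mk: "M = k ^ (card B + 1) + 1" by (simp only: M_def k(1) of_nat_power[symmetric] nat_int)
  \<comment> \<open>Both sides contain \<open>p ^ (e * (s - 1))\<close>. After cancelling it,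
    \<open>K ^ (e * (s - 1) + 1)\<close> has to be below \<open>M ^ (s - 1)\<close>, which follows
    from \<open>e \<le> card B\<close>.\<close>
  have "K * int ((k * p) ^ (e * (s - 1))) < int (card A) ^ (s - 1)"
  proof -
    have "k * k ^ (e * (s - 1)) \<le> (k ^ (card B + 1)) ^ (s - 1)"
    proof -
      have "e * (s - 1) + 1 \<le> (e + 1) * (s - 1)" using assms(1) by simp
      also have "\<dots> \<le> (card B + 1) * (s - 1)" using eA(1) by (intro mult_right_mono) auto
      finally have "k ^ (e * (s - 1) + 1) \<le> k ^ ((card B + 1) * (s - 1))" using k(2) by (intro power_increasing)
      moreover have "k ^ (e * (s - 1) + 1) = k * k ^ (e * (s - 1))" by simp
      moreover have "k ^ ((card B + 1) * (s - 1)) = (k ^ (card B + 1)) ^ (s - 1)" by (rule power_mult)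
      ultimately show ?thesis by (simp only:)
    qed
    also have "\<dots> < M ^ (s - 1)" using assms(1) unfolding Mk by (intro power_strict_mono) auto
    finally have "k * k ^ (e * (s - 1)) * p ^ (e * (s - 1)) < M ^ (s - 1) * p ^ (e * (s - 1))"
      using prime_gt_0_nat[OF p(2)] by simp
    hence "k * (k * p) ^ (e * (s - 1)) < (p ^ e * M) ^ (s - 1)"
      by (simp add: power_mult_distrib power_mult mult_ac)
    hence "int (k * (k * p) ^ (e * (s - 1))) < int ((p ^ e * M) ^ (s - 1))" by (simp only: of_nat_less_iff)
    thus ?thesis by (simp add: eA(4) cG k(1))
  qed
  moreover have "A \<subseteq> {0..<int ((k * p) ^ (e * (s - 1)))}" using eA(2) by (simp add: k(1))
  ultimately show ?thesis
    using polynomial_lower_bound[OF assms(3) sum0 K0[unfolded K_def] assms(1) eA(3)] unfolding K_def by blast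
qed

end
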